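(* Let $q=2^n\ge 4$ and let $G\in\{PSL_2(q),\,PSU_3(q),\,Sz(q)\}$. Put $\chi(G)=5$ if $G=Sz(q)$ and $\chi(G)=3$ if $G\in\{PSL_2(q),PSU_3(q)\}$. Let $\omega(G)$ be the set of element orders of $G$, let $\pi$ be the set of all odd integers in $\omega(G)\setminus\{2,\chi(G)\}$, and let $X$ be the (unique) conjugacy class of involutions of $G$. Then the $\pi$-local fusion graph $F_\pi(G,X)$ is a vertex-transitive edge-regular Deza graph of diameter $2$ with parameters $(v,k,b,a)$ as follows: (1) $(q^2-1,\ q(q-2),\ q(q-3),\ (q-2)^2)$ if $G=PSL_2(q)$; (2) $((q^2+1)(q-1),\ q^2(q-2),\ (q-2)^2(q+1),\ q^2(q-3))$ if $G=Sz(q)$; (3) $((q^3+1)(q-1),\ q^3(q-2),\ (q-2)^2(q^2+q+1),\ q^3(q-3))$ if $G=PSU_3(q)$. Moreover, $F_\pi(G,X)$ is a divisible design graph in which every class of the canonical partition is the set of involutions of a Sylow $2$-subgroup of $G$.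
   Context: All graphs are finite, undirected, without loops or multiple edges. $PSU_3(q)$ denotes the projective special unitary group of dimension $3$ defined over $\mathbb{F}_{q^2}$. $Sz(q)$ denotes the Suzuki group, which is defined (and simple) for $q=2^n$ with $n\ge 3$ odd; the statement for $Sz(q)$ concerns these $q$ only. Each of the groups $G$ considered has exactly one conjugacy class $X$ of involutions. For a group $G$ with a conjugacy class $X$ of involutions and a set $\pi\subseteq\omega(G)$ consisting only of odd numbers, the $\pi$-local fusion graph $F_\pi(G,X)$ is the graph with vertex set $X$ in which $x$ and $y$ are adjacent if and only if $x\neq y$ and the order of the product $xy$ lies in $\pi$. A regular graph of valency $k$ on $v$ vertices is a Deza graph with parameters $(v,k,b,a)$, where $a\le b$, if for any two distinct vertices the number of their common neighbours is $a$ or $b$ (the values $a$ and $b$ are allowed to be equal). A regular graph is edge-regular if the number of common neighbours of two adjacent vertices is the same for all pairs of adjacent vertices. A graph is vertex-transitive if its automorphism group acts transitively on its vertices. A divisible design graph is a regular graph whose vertex set admits a partition into classes of the same size such that the number of common neighbours of any two distinct vertices depends only on whether these two vertices belong to the same class or not; such a partition is called canonical. *)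

theory Defs
  imports
    "HOL-Analysis.Analysis"
    "HOL-Algebra.Multiplicative_Group"
    "HOL-Algebra.Generated_Groups"
    "HOL-Library.Extended_Nat"
    "HOL-Library.Disjoint_Sets"
begin

section \<open>Graphs\<close>

record 'v ugraph =
  verts :: "'v set"
  adj :: "'v \<Rightarrow> 'v \<Rightarrow> bool"

definition simple_graph :: "'v ugraph \<Rightarrow> bool" where
  "simple_graph \<Gamma> \<longleftrightarrow> finite (verts \<Gamma>) \<and>
     (\<forall>x y. adj \<Gamma> x y \<longrightarrow> x \<in> verts \<Gamma> \<and> y \<in> verts \<Gamma> \<and> x \<noteq> y \<and> adj \<Gamma> y x)"

definition neighbours :: "'v ugraph \<Rightarrow> 'v \<Rightarrow> 'v set" where
  "neighbours \<Gamma> x = {y \<in> verts \<Gamma>. adj \<Gamma> x y}"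

definition num_common :: "'v ugraph \<Rightarrow> 'v \<Rightarrow> 'v \<Rightarrow> nat" where
  "num_common \<Gamma> x y = card (neighbours \<Gamma> x \<inter> neighbours \<Gamma> y)"

definition regular_of_valency :: "'v ugraph \<Rightarrow> nat \<Rightarrow> bool" where
  "regular_of_valency \<Gamma> k \<longleftrightarrow>
     simple_graph \<Gamma> \<and> (\<forall>x\<in>verts \<Gamma>. card (neighbours \<Gamma> x) = k)"

definition regular_graph :: "'v ugraph \<Rightarrow> bool" where
  "regular_graph \<Gamma> \<longleftrightarrow> (\<exists>k. regular_of_valency \<Gamma> k)"

definition deza_graph :: "'v ugraph \<Rightarrow> nat \<Rightarrow> nat \<Rightarrow> nat \<Rightarrow> nat \<Rightarrow> bool" where
  "deza_graph \<Gamma> v k b a \<longleftrightarrow>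
     regular_of_valency \<Gamma> k \<and> card (verts \<Gamma>) = v \<and> a \<le> b \<and>
     (\<forall>x\<in>verts \<Gamma>. \<forall>y\<in>verts \<Gamma>. x \<noteq> y \<longrightarrow> num_common \<Gamma> x y = a \<or> num_common \<Gamma> x y = b)"

definition edge_regular :: "'v ugraph \<Rightarrow> bool" where
  "edge_regular \<Gamma> \<longleftrightarrow>
     regular_graph \<Gamma> \<and> (\<exists>c. \<forall>x y. adj \<Gamma> x y \<longrightarrow> num_common \<Gamma> x y = c)"

definition graph_automorphism :: "'v ugraph \<Rightarrow> ('v \<Rightarrow> 'v) \<Rightarrow> bool" where
  "graph_automorphism \<Gamma> f \<longleftrightarrow> bij_betw f (verts \<Gamma>) (verts \<Gamma>) \<and>
     (\<forall>x\<in>verts \<Gamma>. \<forall>y\<in>verts \<Gamma>. adj \<Gamma> (f x) (f y) \<longleftrightarrow> adj \<Gamma> x y)"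

definition vertex_transitive :: "'v ugraph \<Rightarrow> bool" where
  "vertex_transitive \<Gamma> \<longleftrightarrow>
     (\<forall>x\<in>verts \<Gamma>. \<forall>y\<in>verts \<Gamma>. \<exists>f. graph_automorphism \<Gamma> f \<and> f x = y)"

text \<open>The length of a shortest walk; it is \<open>\<infinity>\<close> if there is no walk, so a graph of finite
  diameter is connected.\<close>

definition graph_dist :: "'v ugraph \<Rightarrow> 'v \<Rightarrow> 'v \<Rightarrow> enat" where
  "graph_dist \<Gamma> x y = (INF n\<in>{n. (adj \<Gamma> ^^ n) x y}. enat n)"

definition graph_diameter :: "'v ugraph \<Rightarrow> enat" where
  "graph_diameter \<Gamma> = (SUP x\<in>verts \<Gamma>. SUP y\<in>verts \<Gamma>. graph_dist \<Gamma> x y)"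

definition canonical_partition :: "'v ugraph \<Rightarrow> 'v set set \<Rightarrow> bool" where
  "canonical_partition \<Gamma> P \<longleftrightarrow> partition_on (verts \<Gamma>) P \<and> (\<exists>m. \<forall>C\<in>P. card C = m) \<and>
     (\<exists>c1 c2. \<forall>x\<in>verts \<Gamma>. \<forall>y\<in>verts \<Gamma>. x \<noteq> y \<longrightarrow>
        num_common \<Gamma> x y = (if \<exists>C\<in>P. x \<in> C \<and> y \<in> C then c1 else c2))"

definition divisible_design_graph :: "'v ugraph \<Rightarrow> bool" where
  "divisible_design_graph \<Gamma> \<longleftrightarrow> regular_graph \<Gamma> \<and> (\<exists>P. canonical_partition \<Gamma> P)"


section \<open>Involutions and local fusion graphs\<close>

definition element_orders :: "('g, 'm) monoid_scheme \<Rightarrow> nat set" where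
  "element_orders G = group.ord G ` carrier G"

definition involutions :: "('g, 'm) monoid_scheme \<Rightarrow> 'g set" where
  "involutions G = {x \<in> carrier G. group.ord G x = 2}"

definition conjugacy_class :: "('g, 'm) monoid_scheme \<Rightarrow> 'g \<Rightarrow> 'g set" where
  "conjugacy_class G x = {g \<otimes>\<^bsub>G\<^esub> x \<otimes>\<^bsub>G\<^esub> inv\<^bsub>G\<^esub> g | g. g \<in> carrier G}"

definition involution_class :: "('g, 'm) monoid_scheme \<Rightarrow> 'g set \<Rightarrow> bool" where
  "involution_class G C \<longleftrightarrow> (\<exists>x\<in>involutions G. C = conjugacy_class G x)"

definition local_fusion_graph :: "('g, 'm) monoid_scheme \<Rightarrow> nat set \<Rightarrow> 'g set \<Rightarrow> 'g ugraph" where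
  "local_fusion_graph G \<pi> C =
     \<lparr>verts = C, adj = \<lambda>x y. x \<in> C \<and> y \<in> C \<and> x \<noteq> y \<and> group.ord G (x \<otimes>\<^bsub>G\<^esub> y) \<in> \<pi>\<rparr>"

definition odd_orders_except :: "('g, 'm) monoid_scheme \<Rightarrow> nat \<Rightarrow> nat set" where
  "odd_orders_except G c = {m \<in> element_orders G - {2, c}. odd m}"

definition sylow2_subgroup :: "('g, 'm) monoid_scheme \<Rightarrow> 'g set \<Rightarrow> bool" where
  "sylow2_subgroup G S \<longleftrightarrow> subgroup S G \<and> card S = 2 ^ multiplicity 2 (order G)"

definition sylow2_involution_sets :: "('g, 'm) monoid_scheme \<Rightarrow> 'g set set" where
  "sylow2_involution_sets G = {S \<inter> involutions G | S. sylow2_subgroup G S}"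


section \<open>The groups\<close>

definition GL_group :: "('a::field^'n^'n) monoid" where
  "GL_group = \<lparr>carrier = {A. invertible A}, mult = (**), one = mat 1\<rparr>"

definition SL_group :: "('a::field^'n^'n) monoid" where
  "SL_group = GL_group\<lparr>carrier := {A. det A = 1}\<rparr>"

text \<open>Over a field with \<open>q\<^sup>2\<close> elements the map \<open>x \<mapsto> x ^ q\<close> is the automorphism of order 2, and
  \<^term>\<open>SU_group q\<close> is the special isometry group of the Hermitian form whose Gram matrix is the
  identity matrix. Over a finite field, all nondegenerate Hermitian forms of a given dimension
  are equivalent.\<close>

definition conj_transpose :: "nat \<Rightarrow> 'a::field^'n^'n \<Rightarrow> 'a^'n^'n" where
  "conj_transpose q A = (\<chi> i j. (A $ j $ i) ^ q)"

definition SU_group :: "nat \<Rightarrow> ('a::field^'n^'n) monoid" where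
  "SU_group q = GL_group\<lparr>carrier := {A. A ** conj_transpose q A = mat 1 \<and> det A = 1}\<rparr>"

definition projective :: "('a::field^'n^'n) monoid \<Rightarrow> ('a^'n^'n) set monoid" where
  "projective K = K Mod (carrier K \<inter> range mat)"

text \<open>\<open>PSL\<^sub>2(q)\<close> is \<^term>\<open>PSL2 :: ('a::field^2^2) set monoid\<close> for a field \<^typ>\<open>'a\<close> with \<open>q\<close>
  elements; \<open>PSU\<^sub>3(q)\<close> is \<^term>\<open>PSU3 q :: ('b::field^3^3) set monoid\<close> for a field \<^typ>\<open>'b\<close> with
  \<open>q\<^sup>2\<close> elements.\<close>

definition PSL2 :: "('a::field^2^2) set monoid" where
  "PSL2 = projective SL_group"

definition PSU3 :: "nat \<Rightarrow> ('a::field^3^3) set monoid" where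
  "PSU3 q = projective (SU_group q)"

text \<open>Suzuki's generators of \<open>Sz(q)\<close> as a subgroup of \<open>GL\<^sub>4(q)\<close>, for \<open>q = 2 ^ (2 * m + 1)\<close>. The
  automorphism \<open>\<theta>\<close> of the field satisfies \<open>\<theta> (\<theta> x) = x\<^sup>2\<close>, and its inverse is
  \<open>x \<mapsto> x ^ (2 ^ m)\<close>. The diagonal entries of \<open>suzuki_diag\<close> are
  \<open>\<zeta>\<^sub>1, \<zeta>\<^sub>2, \<zeta>\<^sub>2\<^sup>-\<^sup>1, \<zeta>\<^sub>1\<^sup>-\<^sup>1\<close>, where \<open>\<theta> \<zeta>\<^sub>1 = c * \<theta> c\<close> and \<open>\<theta> \<zeta>\<^sub>2 = c\<close>.\<close>

definition suzuki_theta :: "nat \<Rightarrow> 'a::field \<Rightarrow> 'a" where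
  "suzuki_theta m x = x ^ (2 ^ (m + 1))"

definition suzuki_unipotent :: "nat \<Rightarrow> 'a::field \<Rightarrow> 'a \<Rightarrow> 'a^4^4" where
  "suzuki_unipotent m a b = (let \<theta> = suzuki_theta m in
     vector [vector [1, 0, 0, 0],
             vector [a, 1, 0, 0],
             vector [b, \<theta> a, 1, 0],
             vector [a^2 * \<theta> a + a * b + \<theta> b, a * \<theta> a + b, a, 1]])"

definition suzuki_diag :: "nat \<Rightarrow> 'a::field \<Rightarrow> 'a^4^4" where
  "suzuki_diag m c = (let \<zeta>1 = c ^ (1 + 2 ^ m); \<zeta>2 = c ^ (2 ^ m) in
     vector [vector [\<zeta>1, 0, 0, 0],
             vector [0, \<zeta>2, 0, 0],
             vector [0, 0, inverse \<zeta>2, 0],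
             vector [0, 0, 0, inverse \<zeta>1]])"

definition suzuki_flip :: "'a::field^4^4" where
  "suzuki_flip =
     vector [vector [0, 0, 0, 1],
             vector [0, 0, 1, 0],
             vector [0, 1, 0, 0],
             vector [1, 0, 0, 0]]"

definition Suzuki_group :: "nat \<Rightarrow> ('a::field^4^4) monoid" where
  "Suzuki_group m = subgroup_generated GL_group
     ({suzuki_unipotent m a b | a b. True} \<union> {suzuki_diag m c | c. c \<noteq> 0} \<union> {suzuki_flip})"

end

(* Two involutions of G commute exactly when they lie in the same Sylow 2-subgroup, so commuting is an
   equivalence relation. If x, y do not commute, then xy has odd order (otherwise the central involution
   of the dihedral group <x, y> commutes with both), and x, y are adjacent unless xy has order 3 (5 for Sz(q)).

   Being in exceptional position, o(xy) = 3 or 5, is an antipodal cover of a complete graph: an involution has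
   exactly one exceptional partner in each foreign class, and two non-commuting involutions have a constant number
   c of common exceptional neighbours. All parameters follow from c and the number of classes. A Sylow
   2-subgroup acts by conjugation on the odd number of involutions, hence centralises one of them, and this
   determines its involutions.

   The involutions are transvections in SL_2(q) and SU_3(q), indexed by nonzero vectors and by isotropic vectors up to
   norm-1 scalars; those of Sz(q) are indexed by the vectors on the cone over the Suzuki-Tits ovoid, in an equivariant
   way. In each case a form B on these vectors decides everything: x_v and x_w commute iff B(v, w) = 0 and are in
   exceptional position iff B(v, w) = 1 (for SU_3 take the norm of the Hermitian form). So c is a number of common
   solutions, namely 1, q + 1 and q^2 + q + 1. The centres of SL_2(q) and SU_3(q) have odd order, so passing to
   the quotient changes neither the involutions nor the order of a product of two of them. *)

theory Submission
  imports
    Defs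
    "HOL-Algebra.Group_Action"
    "HOL-Algebra.SndIsomorphismGrp"
    "HOL-Algebra.Sylow"
begin

section \<open>Complements of antipodal covers\<close>

text \<open>A commuting class is indexed by the nonzero multiples of one vector, and the forms are
  homogeneous in the scalar; this is why each foreign class holds exactly one exceptional partner.
  The value 1 singles out the orders 3 and 5 for different reasons. For transvections, order 3 is
  the braid relation xyx = yxy, which compares two transvections. In Sz(q) the trace of xy is the
  square of the form; as trace(A^2) = trace(A)^2 in characteristic 2, order 5 forces the cube of the
  form to be 1, and a field of order 2^n with n odd has no other cube root of 1.

  The obstacle for Sz(q) is that only generators are given. They lie in the group of all linear maps
  preserving an alternating form and the cone; there the stabiliser of a cone vector can be
  computed, it consists of the unipotent generators, and this yields the parametrisation of the
  involutions.

  The count of common neighbours across classes minus the count inside a class is c - (q - 3). So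
  the larger count is the one inside a class for PSL_2 and the other one for Sz and PSU_3, and for
  PSL_2(4) the two coincide, so that the counts do not single out a partition.\<close>

lemma relpowp_2: "(P ^^ 2) x z \<longleftrightarrow> (\<exists>y. P x y \<and> P y z)"
  by (simp add: numeral_2_eq_2 relcompp.simps)

lemma graph_dist_le: "(adj F ^^ n) x y \<Longrightarrow> graph_dist F x y \<le> enat n"
  unfolding graph_dist_def by (rule INF_lower) simp

lemma graph_dist_ge_2:
  assumes "x \<noteq> y" "\<not> adj F x y"
  shows "graph_dist F x y \<ge> 2"
proof -
  have "enat 2 \<le> enat n" if "(adj F ^^ n) x y" for n
  proof -
    have "n \<noteq> 0" using that assms by (cases n) auto
    moreover have "n \<noteq> 1" using that assms by (auto)
    ultimately show ?thesis by simp
  qed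
  then show ?thesis unfolding graph_dist_def
    by (intro INF_greatest) (simp add: numeral_eq_enat)
qed

text \<open>A partition is determined by its relation of lying in one block. This half is used
  twice, with the two partitions exchanged.\<close>

lemma partition_on_subset_if_same_blocks:
  assumes P: "partition_on A P" and Q: "partition_on A Q"
    and eq: "\<And>x y. \<lbrakk>x \<in> A; y \<in> A\<rbrakk> \<Longrightarrow> (\<exists>C\<in>P. x \<in> C \<and> y \<in> C) \<longleftrightarrow> (\<exists>C\<in>Q. x \<in> C \<and> y \<in> C)"
  shows "P \<subseteq> Q"
proof
  fix C assume C: "C \<in> P"
  then obtain x where x: "x \<in> C" using P by (metis ex_in_conv partition_onD3)
  have subP: "D \<subseteq> A" if "D \<in> P" for D using that P by (auto simp: partition_on_def)
  have subQ: "D \<subseteq> A" if "D \<in> Q" for D using that Q by (auto simp: partition_on_def)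
  have uP: "D = E" if "D \<in> P" "E \<in> P" "z \<in> D" "z \<in> E" for D E z
    using P that by (auto simp: partition_on_def disjoint_def)
  have uQ: "D = E" if "D \<in> Q" "E \<in> Q" "z \<in> D" "z \<in> E" for D E z
    using Q that by (auto simp: partition_on_def disjoint_def)
  have xA: "x \<in> A" using C x subP by blast
  then obtain D where D: "D \<in> Q" "x \<in> D" using eq[of x x] C x by blast
  have "C = D"
  proof (intro equalityI subsetI)
    fix y assume y: "y \<in> C"
    then have "y \<in> A" using C subP by blast
    then obtain E where "E \<in> Q" "x \<in> E" "y \<in> E" using eq[of x y] C x y xA by blast
    then show "y \<in> D" using uQ[of D E x] D by blast
  next
    fix y assume y: "y \<in> D"
    then have "y \<in> A" using D subQ by blast
    then obtain E where "E \<in> P" "x \<in> E" "y \<in> E" using eq[of x y] D y xA by blast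
    then show "y \<in> C" using uP[of C E x] C x by blast
  qed
  then show "C \<in> Q" using D by simp
qed

lemma partition_on_eq_if_same_blocks:
  assumes P: "partition_on A P" and Q: "partition_on A Q"
    and eq: "\<And>x y. \<lbrakk>x \<in> A; y \<in> A\<rbrakk> \<Longrightarrow> (\<exists>C\<in>P. x \<in> C \<and> y \<in> C) \<longleftrightarrow> (\<exists>C\<in>Q. x \<in> C \<and> y \<in> C)"
  shows "P = Q"
proof (rule equalityI)
  show "P \<subseteq> Q" by (rule partition_on_subset_if_same_blocks[OF P Q eq])
  show "Q \<subseteq> P" by (rule partition_on_subset_if_same_blocks[OF Q P eq[symmetric]])
qed

text \<open>\<open>R\<close> is an antipodal cover of a complete graph, with \<open>s + 1\<close> fibres \<open>sim\<close> of size \<open>q - 1\<close>;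
  the graph under study is its complement with the fibres kept edgeless.\<close>

locale antipodal_cover =
  fixes X :: "'v set" and sim R :: "'v \<Rightarrow> 'v \<Rightarrow> bool" and q s c :: nat
  assumes fin: "finite X"
    and sim_refl: "x \<in> X \<Longrightarrow> sim x x"
    and sim_sym: "\<lbrakk>x \<in> X; y \<in> X; sim x y\<rbrakk> \<Longrightarrow> sim y x"
    and sim_trans: "\<lbrakk>x \<in> X; y \<in> X; z \<in> X; sim x y; sim y z\<rbrakk> \<Longrightarrow> sim x z"
    and R_sym: "\<lbrakk>x \<in> X; y \<in> X; R x y\<rbrakk> \<Longrightarrow> R y x"
    and R_not_sim: "\<lbrakk>x \<in> X; y \<in> X; R x y\<rbrakk> \<Longrightarrow> \<not> sim x y"
    and card_class: "x \<in> X \<Longrightarrow> card {y \<in> X. sim x y} = q - 1"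
    and card_X: "card X = (s + 1) * (q - 1)"
    and partner: "\<lbrakk>x \<in> X; y \<in> X; \<not> sim x y\<rbrakk> \<Longrightarrow> \<exists>!z. z \<in> X \<and> sim y z \<and> R x z"
    and common: "\<lbrakk>x \<in> X; y \<in> X; \<not> sim x y\<rbrakk> \<Longrightarrow> card {z \<in> X. R x z \<and> R y z} = c"
    and q_ge: "4 \<le> q" and s_ge: "1 \<le> s"
begin

lemma partner_ex: "\<lbrakk>x \<in> X; y \<in> X; \<not> sim x y\<rbrakk> \<Longrightarrow> \<exists>z\<in>X. sim y z \<and> R x z"
  using partner[of x y, THEN ex1_implies_ex] by blast

lemma partner_unique:
  assumes "x \<in> X" "y \<in> X" "\<not> sim x y" "z \<in> X" "sim y z" "R x z" "w \<in> X" "sim y w" "R x w"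
  shows "z = w"
  by (rule Uniq_D[OF ex1_iff_ex_Uniq[THEN iffD1, OF partner[OF assms(1-3)], THEN conjunct2]])
    (use assms in auto)

section \<open>Fibres, \<open>R\<close>-neighbourhoods and numbers of common neighbours\<close>

definition cls where "cls x = {y \<in> X. sim x y}"
definition nbR where "nbR x = {y \<in> X. R x y}"
definition graph where
  "graph = \<lparr>verts = X, adj = \<lambda>x y. x \<in> X \<and> y \<in> X \<and> \<not> sim x y \<and> \<not> R x y\<rparr>"

lemma fin_sets [simp]: "finite (cls x)" "finite (nbR x)"
  using fin by (auto simp: cls_def nbR_def)

lemma cls_sub: "cls x \<subseteq> X" "nbR x \<subseteq> X"
  by (auto simp: cls_def nbR_def)

lemma cls_eq: "\<lbrakk>x \<in> X; y \<in> X; sim x y\<rbrakk> \<Longrightarrow> cls x = cls y"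
  unfolding cls_def using sim_trans sim_sym by blast

lemma cls_disj: "\<lbrakk>x \<in> X; y \<in> X; \<not> sim x y\<rbrakk> \<Longrightarrow> cls x \<inter> cls y = {}"
  unfolding cls_def using sim_trans sim_sym by blast

lemma cls_nbR_disj: "x \<in> X \<Longrightarrow> cls x \<inter> nbR x = {}"
  unfolding cls_def nbR_def using R_not_sim by blast

lemma card_cls: "x \<in> X \<Longrightarrow> card (cls x) = q - 1"
  using card_class by (simp add: cls_def)

lemma ex_other_class:
  assumes "x \<in> X" shows "\<exists>y\<in>X. \<not> sim x y"
proof (rule ccontr)
  assume "\<not> ?thesis"
  then have "X = cls x" by (auto simp: cls_def)
  then have "(s + 1) * (q - 1) = 1 * (q - 1)" using card_cls[OF assms] card_X by simp
  then have "s + 1 = 1 \<or> q - 1 = 0" by (metis mult_right_cancel)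
  then show False using q_ge s_ge by (cases "q = 1") auto
qed

lemma ex_same_class:
  assumes "x \<in> X" shows "\<exists>y\<in>X. sim x y \<and> y \<noteq> x"
proof (rule ccontr)
  assume "\<not> ?thesis"
  then have "cls x \<subseteq> {x}" by (auto simp: cls_def)
  then have "card (cls x) \<le> 1" using card_mono[of "{x}" "cls x"] by simp
  then show False using card_cls[OF assms] q_ge by simp
qed

lemma nbR_cls:
  assumes "x \<in> X" "y \<in> X" "\<not> sim x y"
  shows "card (nbR x \<inter> cls y) = 1"
proof -
  obtain z where "z \<in> X" "sim y z" "R x z"
    using partner_ex[OF assms] by blast
  then have mem: "z \<in> nbR x \<inter> cls y" by (simp add: nbR_def cls_def)
  have "nbR x \<inter> cls y = {z}"
  proof (rule equalityI[OF subsetI])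
    fix w assume "w \<in> nbR x \<inter> cls y"
    then have "w = z"
      using partner_unique[OF assms, of w z] mem by (simp add: nbR_def cls_def)
    then show "w \<in> {z}" by simp
  qed (use mem in simp)
  then show ?thesis by simp
qed

text \<open>Every fibre other than that of \<open>x\<close> contains exactly one
  \<open>R\<close>-neighbour of \<open>x\<close>, so the complement of \<open>cls x\<close> is the
  disjoint union of the fibres of these neighbours; dividing by the fibre size leaves
  \<open>s\<close>.\<close>

lemma card_nbR:
  assumes "x \<in> X" shows "card (nbR x) = s"
proof -
  have "X - cls x = (\<Union>z\<in>nbR x. cls z)"
  proof (intro equalityI subsetI)
    fix y assume y: "y \<in> X - cls x"
    then obtain z where "z \<in> X" "sim y z" "R x z" using partner_ex[of x y] assms by (auto simp: cls_def)
    then show "y \<in> (\<Union>z\<in>nbR x. cls z)" using y sim_sym by (auto simp: nbR_def cls_def)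
  next
    fix y assume "y \<in> (\<Union>z\<in>nbR x. cls z)"
    then obtain z where z: "z \<in> X" "R x z" "y \<in> X" "sim z y" by (auto simp: nbR_def cls_def)
    then have "\<not> sim x z" using R_not_sim assms by blast
    then have "\<not> sim x y" using z sim_trans sim_sym assms by blast
    then show "y \<in> X - cls x" using z by (auto simp: cls_def)
  qed
  also have "card \<dots> = (\<Sum>z\<in>nbR x. card (cls z))"
  proof (rule card_UN_disjoint)
    show "\<forall>i\<in>nbR x. \<forall>j\<in>nbR x. i \<noteq> j \<longrightarrow> cls i \<inter> cls j = {}"
    proof (intro ballI impI)
      fix i j assume ij: "i \<in> nbR x" "j \<in> nbR x" "i \<noteq> j"
      then have i: "i \<in> X" "R x i" and j: "j \<in> X" "R x j" by (auto simp: nbR_def)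
      have "\<not> sim i j"
        using partner_unique[of x i i j] R_not_sim[of x i] assms i j \<open>i \<noteq> j\<close> sim_refl[of i] by auto
      then show "cls i \<inter> cls j = {}" using ij cls_disj by (auto simp: nbR_def)
    qed
  qed auto
  also have "\<dots> = (\<Sum>z\<in>nbR x. q - 1)"
    by (rule sum.cong) (auto simp: nbR_def card_cls)
  finally have "card (X - cls x) = card (nbR x) * (q - 1)" by simp
  moreover have "card (X - cls x) = card X - card (cls x)"
    by (rule card_Diff_subset) (auto simp: cls_def fin)
  ultimately have "card (nbR x) * (q - 1) = s * (q - 1)"
    using card_X card_cls[OF assms] by (metis Suc_eq_plus1 add_diff_cancel_left' mult_Suc)
  then show ?thesis using q_ge by auto
qed

lemma neighbours_graph: "x \<in> X \<Longrightarrow> neighbours graph x = X - (cls x \<union> nbR x)"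
  by (auto simp: neighbours_def graph_def cls_def nbR_def)

lemma valency:
  assumes "x \<in> X" shows "card (neighbours graph x) = s * (q - 2)"
proof -
  have "card (neighbours graph x) = card X - card (cls x \<union> nbR x)"
    unfolding neighbours_graph[OF assms] using cls_sub by (intro card_Diff_subset) auto
  also have "card (cls x \<union> nbR x) = (q - 1) + s"
    using card_Un_disjoint[of "cls x" "nbR x"] cls_nbR_disj assms card_cls card_nbR by simp
  finally have "card (neighbours graph x) = (s + 1) * (q - 1) - ((q - 1) + s)"
    using card_X by simp
  \<comment> \<open>Substituting \<open>r + 4\<close> for \<open>q\<close> turns the truncated
    subtractions into polynomial arithmetic; the same device returns in the later counts.\<close>
  moreover obtain r where "q = r + 4" using q_ge by (metis add.commute le_Suc_ex)
  ultimately show ?thesis by (simp add: algebra_simps)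
qed

text \<open>The two \<open>R\<close>-neighbourhoods are disjoint, since a common neighbour would
  have two partners in the fibre of \<open>x\<close> and \<open>y\<close>. The removed set is
  therefore one fibre and two disjoint sets of size \<open>s\<close>.\<close>

lemma num_common_sim:
  assumes "x \<in> X" "y \<in> X" "x \<noteq> y" "sim x y"
  shows "num_common graph x y = s * (q - 3)"
proof -
  have eq: "neighbours graph x \<inter> neighbours graph y = X - (cls x \<union> (nbR x \<union> nbR y))"
    using assms neighbours_graph cls_eq by auto
  have d: "nbR x \<inter> nbR y = {}"
  proof (rule ccontr)
    assume "nbR x \<inter> nbR y \<noteq> {}"
    then obtain z where z: "z \<in> X" "R z x" "R z y" using R_sym assms by (auto simp: nbR_def)
    then have "\<not> sim z x" using R_not_sim assms by blast
    then show False using partner_unique[of z x x y] z assms sim_refl[of x] by simp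
  qed
  have "cls x \<inter> (nbR x \<union> nbR y) = {}"
    using cls_nbR_disj[of x] cls_nbR_disj[of y] cls_eq[of x y] assms by auto
  then have "card (cls x \<union> (nbR x \<union> nbR y)) = (q - 1) + (s + s)"
    using card_Un_disjoint[of "cls x" "nbR x \<union> nbR y"] card_Un_disjoint[of "nbR x" "nbR y"] d
      assms card_cls card_nbR by simp
  moreover have "card (X - (cls x \<union> (nbR x \<union> nbR y))) = card X - card (cls x \<union> (nbR x \<union> nbR y))"
    using cls_sub by (intro card_Diff_subset) auto
  ultimately have "num_common graph x y = (s + 1) * (q - 1) - ((q - 1) + (s + s))"
    unfolding num_common_def eq using card_X by simp
  moreover obtain r where "q = r + 4" using q_ge by (metis add.commute le_Suc_ex)
  ultimately show ?thesis by (simp add: algebra_simps)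
qed

text \<open>Each \<open>R\<close>-neighbourhood meets the fibre of the other vertex in one point,
  which is already removed with that fibre. \<open>?A\<close> and \<open>?B\<close> are the
  neighbourhoods without this point; they have size \<open>s - 1\<close> and overlap in
  \<open>c\<close> points.\<close>

lemma num_common_not_sim:
  assumes "x \<in> X" "y \<in> X" "\<not> sim x y"
  shows "num_common graph x y = (s - 1) * (q - 3) + c"
proof -
  let ?A = "nbR x - cls y" and ?B = "nbR y - cls x"
  have eq: "neighbours graph x \<inter> neighbours graph y = X - ((cls x \<union> cls y) \<union> (?A \<union> ?B))"
    using assms neighbours_graph by auto
  have ns: "\<not> sim y x" using assms sim_sym by blast
  have cA: "card ?A = s - 1"
    using card_Diff_subset_Int[of "nbR x" "cls y"] nbR_cls[of x y] card_nbR assms by simp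
  have cB: "card ?B = s - 1"
    using card_Diff_subset_Int[of "nbR y" "cls x"] nbR_cls[of y x] card_nbR assms ns by simp
  have "?A \<inter> ?B = {z \<in> X. R x z \<and> R y z}"
    using R_not_sim assms by (auto simp: nbR_def cls_def)
  then have cAB: "card (?A \<inter> ?B) = c" using common[OF assms] by simp
  have cU: "card (?A \<union> ?B) + c = 2 * (s - 1)"
    using card_Un_Int[of ?A ?B] cA cB cAB by simp
  have d: "(cls x \<union> cls y) \<inter> (?A \<union> ?B) = {}"
    using cls_nbR_disj[of x] cls_nbR_disj[of y] assms by auto
  have "card (cls x \<union> cls y) = 2 * (q - 1)"
    using card_Un_disjoint[of "cls x" "cls y"] cls_disj[OF assms] card_cls assms by simp
  then have cc: "card ((cls x \<union> cls y) \<union> (?A \<union> ?B)) = 2 * (q - 1) + card (?A \<union> ?B)"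
    using card_Un_disjoint[OF _ _ d] by simp
  moreover have "card (X - ((cls x \<union> cls y) \<union> (?A \<union> ?B))) = card X - card ((cls x \<union> cls y) \<union> (?A \<union> ?B))"
    using cls_sub by (intro card_Diff_subset) auto
  ultimately have n: "num_common graph x y = (s + 1) * (q - 1) - (2 * (q - 1) + card (?A \<union> ?B))"
    unfolding num_common_def eq using card_X by simp
  obtain r where r: "q = r + 4" using q_ge by (metis add.commute le_Suc_ex)
  obtain t where t: "s = t + 1" using s_ge by (metis add.commute le_Suc_ex)
  show ?thesis using n cU unfolding r t by (simp add: algebra_simps)
qed

lemma simple_graph_graph: "simple_graph graph"
  using fin sim_refl sim_sym R_sym by (auto simp: simple_graph_def graph_def)

lemma verts_graph [simp]: "verts graph = X" by (simp add: graph_def)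

lemma regular: "regular_of_valency graph (s * (q - 2))"
  using simple_graph_graph valency by (auto simp: regular_of_valency_def)

lemma edge_regular: "edge_regular graph"
proof -
  have "num_common graph x y = (s - 1) * (q - 3) + c" if "adj graph x y" for x y
    using that num_common_not_sim by (auto simp: graph_def)
  then show ?thesis using regular unfolding edge_regular_def regular_graph_def by blast
qed

text \<open>The disjunction leaves open which of the two counts is the larger one, because this
  depends on \<open>c\<close>.\<close>

lemma deza:
  assumes "s * (q - 3) = a \<and> (s - 1) * (q - 3) + c = b \<or> s * (q - 3) = b \<and> (s - 1) * (q - 3) + c = a"
    and "a \<le> b"
  shows "deza_graph graph ((s + 1) * (q - 1)) (s * (q - 2)) b a"
  unfolding deza_graph_def verts_graph
proof (intro conjI ballI impI)
  show "num_common graph x y = a \<or> num_common graph x y = b" if "x \<in> X" "y \<in> X" "x \<noteq> y" for x y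
    using assms(1) num_common_sim[OF that] num_common_not_sim[OF that(1,2)] by (cases "sim x y") auto
qed (use regular card_X assms in auto)

text \<open>Both counts of common neighbours are positive; across fibres this rests on
  \<open>c > 0\<close> when \<open>s = 1\<close>. Distance 2 is attained because a fibre has at
  least three vertices and no edges.\<close>

lemma diameter:
  assumes "X \<noteq> {}" "c > 0"
  shows "graph_diameter graph = 2"
proof (rule antisym)
  have "graph_dist graph x y \<le> enat 2" if xy: "x \<in> X" "y \<in> X" for x y
  proof (cases "x = y")
    case True
    then have "graph_dist graph x y \<le> enat 0" by (intro graph_dist_le) simp
    then show ?thesis by (simp add: order.trans)
  next
    case False
    have "num_common graph x y > 0"
      using num_common_sim[of x y] num_common_not_sim[of x y] xy False q_ge s_ge assms
      by (cases "sim x y") auto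
    then obtain z where "z \<in> neighbours graph x" "z \<in> neighbours graph y"
      unfolding num_common_def card_gt_0_iff by blast
    then have "adj graph x z" "adj graph z y"
      using simple_graph_graph by (auto simp: neighbours_def simple_graph_def)
    then show ?thesis by (intro graph_dist_le) (auto simp: relpowp_2)
  qed
  then show "graph_diameter graph \<le> 2"
    unfolding graph_diameter_def by (auto intro!: SUP_least simp: numeral_eq_enat)
next
  obtain x where x: "x \<in> X" using assms by blast
  obtain y where y: "y \<in> X" "sim x y" "y \<noteq> x" using ex_same_class[OF x] by blast
  have "2 \<le> graph_dist graph x y"
    by (rule graph_dist_ge_2) (use y in \<open>auto simp: graph_def\<close>)
  also have "\<dots> \<le> (SUP y\<in>X. graph_dist graph x y)" using y by (intro SUP_upper)
  also have "\<dots> \<le> graph_diameter graph" unfolding graph_diameter_def verts_graph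
    using x by (intro SUP_upper)
  finally show "2 \<le> graph_diameter graph" .
qed

lemma partition_classes: "partition_on X (cls ` X)"
proof (rule partition_onI)
  show "\<Union> (cls ` X) = X" using sim_refl by (auto simp: cls_def)
  show "disjnt p p'" if "p \<in> cls ` X" "p' \<in> cls ` X" "p \<noteq> p'" for p p'
    using that cls_disj cls_eq unfolding disjnt_def by blast
  show "{} \<notin> cls ` X" using sim_refl by (auto simp: cls_def)
qed

lemma same_cls_iff:
  "\<lbrakk>x \<in> X; y \<in> X\<rbrakk> \<Longrightarrow> (\<exists>C\<in>cls ` X. x \<in> C \<and> y \<in> C) \<longleftrightarrow> sim x y"
proof
  assume xy: "x \<in> X" "y \<in> X"
  show "sim x y" if C: "\<exists>C\<in>cls ` X. x \<in> C \<and> y \<in> C"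
  proof -
    obtain z where z: "z \<in> X" "x \<in> cls z" "y \<in> cls z" using C by (elim bexE imageE) simp
    then have "sim z x" "sim z y" by (simp_all add: cls_def)
    then show ?thesis using sim_trans[OF xy(1) z(1) xy(2)] sim_sym[OF z(1) xy(1)] by simp
  qed
  show "\<exists>C\<in>cls ` X. x \<in> C \<and> y \<in> C" if "sim x y"
    using that xy sim_refl by (intro bexI[of _ "cls x"]) (simp_all add: cls_def)
qed

lemma canonical: "canonical_partition graph (cls ` X)"
  unfolding canonical_partition_def verts_graph
proof (intro conjI exI ballI impI)
  show "partition_on X (cls ` X)" by (rule partition_classes)
  show "card C = q - 1" if "C \<in> cls ` X" for C using that card_cls by auto
  show "num_common graph x y = (if \<exists>C\<in>cls ` X. x \<in> C \<and> y \<in> C then s * (q - 3) else (s - 1) * (q - 3) + c)"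
    if "x \<in> X" "y \<in> X" "x \<noteq> y" for x y
    using that num_common_sim num_common_not_sim same_cls_iff by simp
qed

lemma divisible: "divisible_design_graph graph"
  using regular canonical unfolding divisible_design_graph_def regular_graph_def by blast

text \<open>The constants of \<open>P\<close> are its own, so a priori its blocks could collect the
  pairs from different fibres instead of those from one fibre. Transitivity of lying in one block
  excludes this.\<close>

lemma canonical_unique:
  assumes ne: "s * (q - 3) \<noteq> (s - 1) * (q - 3) + c"
    and can: "canonical_partition graph P"
  shows "P = cls ` X"
proof -
  note can' = can[unfolded canonical_partition_def verts_graph]
  note pP = can'[THEN conjunct1]
  note ex = can'[THEN conjunct2, THEN conjunct2]
  define S where "S x y \<longleftrightarrow> (\<exists>C\<in>P. x \<in> C \<and> y \<in> C)" for x y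
  have "\<exists>c1 c2. \<forall>x\<in>X. \<forall>y\<in>X. x \<noteq> y \<longrightarrow> num_common graph x y = (if S x y then c1 else c2)"
    using ex unfolding S_def .
  then obtain c1 c2 where "\<forall>x\<in>X. \<forall>y\<in>X. x \<noteq> y \<longrightarrow> num_common graph x y = (if S x y then c1 else c2)"
    by (elim exE)
  then have c12: "num_common graph x y = (if S x y then c1 else c2)" if "x \<in> X" "y \<in> X" "x \<noteq> y" for x y
    using that by simp
  have Srefl: "S x x" if "x \<in> X" for x using that pP unfolding S_def partition_on_def by blast
  have Ssym: "S y x" if "S x y" for x y using that unfolding S_def by blast
  have Strans: "S x z" if "S x y" "S y z" for x y z
    using that pP unfolding S_def partition_on_def disjoint_def by blast
  have key: "S x y \<longleftrightarrow> sim x y" if xy: "x \<in> X" "y \<in> X" "x \<noteq> y" for x y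
  proof -
    obtain y' where y': "y' \<in> X" "sim x y'" "y' \<noteq> x" using ex_same_class xy by blast
    obtain z where z: "z \<in> X" "\<not> sim x z" using ex_other_class xy by blast
    have zx: "z \<noteq> x" "z \<noteq> y'" using z y' sim_refl by blast+
    have ns: "\<not> sim y' z" using y' z sim_trans xy by blast
    have n1: "num_common graph x y' = s * (q - 3)" using num_common_sim y' xy by simp
    have n2: "num_common graph x z = (s - 1) * (q - 3) + c" using num_common_not_sim z xy by simp
    have n3: "num_common graph y' z = (s - 1) * (q - 3) + c" using num_common_not_sim z y' ns by simp
    \<comment> \<open>Otherwise the pairs \<open>x\<close>, \<open>z\<close> and \<open>y'\<close>,
      \<open>z\<close>, which have the other count, would each share a block, and \<open>z\<close>
      would put \<open>x\<close> and \<open>y'\<close> together after all.\<close>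
    have "S x y'"
    proof (rule ccontr)
      assume no: "\<not> S x y'"
      then have c2: "c2 = s * (q - 3)" using c12[of x y'] y' xy n1 by simp
      then have "S x z" using c12[of x z] z xy n2 ne zx by (auto split: if_splits)
      moreover have "S y' z" using c12[of y' z] z y' n3 ne zx c2 by (auto split: if_splits)
      ultimately show False using no Ssym Strans by blast
    qed
    then have c1: "c1 = s * (q - 3)" using c12[of x y'] y' xy n1 by simp
    have "\<not> S x z" using c12[of x z] z xy n2 ne zx c1 by (auto split: if_splits)
    then have c2: "c2 = (s - 1) * (q - 3) + c" using c12[of x z] z xy n2 zx by simp
    show ?thesis
      using c12[OF xy] c1 c2 ne num_common_sim[of x y] num_common_not_sim[of x y] xy by (auto split: if_splits)
  qed
  have "(\<exists>C\<in>P. x \<in> C \<and> y \<in> C) \<longleftrightarrow> (\<exists>C\<in>cls ` X. x \<in> C \<and> y \<in> C)"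
    if "x \<in> X" "y \<in> X" for x y
    unfolding same_cls_iff[OF that] S_def[symmetric]
    using key[of x y] that Srefl sim_refl by (cases "x = y") auto
  then show ?thesis by (rule partition_on_eq_if_same_blocks[OF pP partition_classes])
qed

end

section \<open>Involutions\<close>

text \<open>Without a fixed point every orbit in \<open>Y\<close> would have size a power of 2
  greater than 1, and \<open>Y\<close>, a disjoint union of orbits, would be even.\<close>

lemma (in group_action) two_group_fixed_point:
  assumes ord: "order G = 2 ^ k" and Y: "Y \<subseteq> E" "finite Y" "odd (card Y)"
    and inv: "\<And>g y. \<lbrakk>g \<in> carrier G; y \<in> Y\<rbrakk> \<Longrightarrow> \<phi> g y \<in> Y"
  shows "\<exists>y\<in>Y. \<forall>g\<in>carrier G. \<phi> g y = y"
proof (rule ccontr)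
  assume no: "\<not> ?thesis"
  let ?O = "orbit G \<phi>"
  have sub: "?O y \<subseteq> Y" if "y \<in> Y" for y using inv that by (auto simp: orbit_def)
  have "Y = \<Union> (?O ` Y)" using sub orbit_refl Y by blast
  moreover have "card (\<Union> (?O ` Y)) = sum card (?O ` Y)"
  proof (rule card_Union_disjoint)
    show "pairwise disjnt (?O ` Y)"
      using Y disjoint_union unfolding pairwise_def disjnt_def orbits_def by blast
    show "finite A" if "A \<in> ?O ` Y" for A using that sub Y(2) finite_subset by blast
  qed
  moreover have "even (sum card (?O ` Y))"
  proof (rule dvd_sum)
    fix A assume "A \<in> ?O ` Y"
    then obtain y where y: "y \<in> Y" "A = ?O y" by blast
    have "card A dvd 2 ^ k"
      using orbit_stabilizer_theorem[of y] y Y ord by (metis dvd_triv_left subsetD)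
    then obtain i where i: "card A = 2 ^ i" by (metis divides_primepow_nat two_is_prime_nat)
    have "i \<noteq> 0"
    proof
      assume "i = 0"
      then obtain w where w: "A = {w}" using i card_1_singletonE by auto
      have "y \<in> A" using orbit_refl y Y by auto
      then have "A = {y}" using w by simp
      then have "\<forall>g\<in>carrier G. \<phi> g y = y" using y by (auto simp: orbit_def)
      then show False using no y by blast
    qed
    then show "even (card A)" using i by simp
  qed
  ultimately show False using Y by simp
qed

context group begin

lemma involutions_iff: "x \<in> involutions G \<longleftrightarrow> x \<in> carrier G \<and> x \<noteq> \<one> \<and> x \<otimes> x = \<one>"
proof (cases "x \<in> carrier G")
  case True
  have "ord x = 2 \<longleftrightarrow> x \<noteq> \<one> \<and> x \<otimes> x = \<one>"
  proof -
    have "x \<otimes> x = \<one> \<longleftrightarrow> ord x dvd 2" using True pow_eq_id[of x 2] by (simp add: numeral_2_eq_2)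
    moreover have "ord x dvd 2 \<longleftrightarrow> ord x = 1 \<or> ord x = 2"
      by (metis dvd_refl one_dvd prime_nat_iff two_is_prime_nat)
    ultimately show ?thesis using ord_eq_1[OF True] by auto
  qed
  then show ?thesis using True by (simp add: involutions_def)
qed (simp add: involutions_def)

lemma involutionsI: "\<lbrakk>x \<in> carrier G; x \<noteq> \<one>; x \<otimes> x = \<one>\<rbrakk> \<Longrightarrow> x \<in> involutions G"
  using involutions_iff by blast

lemma involution_closed [simp]: "x \<in> involutions G \<Longrightarrow> x \<in> carrier G"
  by (simp add: involutions_def)

lemma involution_sq [simp]: "x \<in> involutions G \<Longrightarrow> x \<otimes> x = \<one>"
  using involutions_iff by blast

lemma involution_cancel [simp]: "\<lbrakk>x \<in> involutions G; y \<in> carrier G\<rbrakk> \<Longrightarrow> x \<otimes> (x \<otimes> y) = y"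
  by (metis involution_closed involution_sq l_one m_assoc)

lemma involution_inv [simp]: "x \<in> involutions G \<Longrightarrow> inv x = x"
  by (simp add: inv_equality)

lemma inv_prod_involutions:
  "\<lbrakk>x \<in> involutions G; y \<in> involutions G\<rbrakk> \<Longrightarrow> inv (x \<otimes> y) = y \<otimes> x"
  by (simp add: inv_mult_group)

text \<open>In the dihedral group generated by \<open>x\<close> and \<open>y\<close>, the reflection
  \<open>x\<close> inverts the rotations. Both the central involution and the conjugating element
  below are found among these powers.\<close>

lemma dihedral_pow:
  assumes "x \<in> involutions G" "y \<in> involutions G"
  shows "x \<otimes> (x \<otimes> y) [^] (m::nat) = inv ((x \<otimes> y) [^] m) \<otimes> x"
proof (induction m)
  case 0 then show ?case using assms by simp
next
  case (Suc m)
  have "x \<otimes> (x \<otimes> y) [^] Suc m = (x \<otimes> (x \<otimes> y) [^] m) \<otimes> (x \<otimes> y)"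
    using assms by (simp add: m_assoc)
  also have "\<dots> = inv ((x \<otimes> y) [^] m) \<otimes> y"
    using Suc assms by (simp add: m_assoc)
  also have "\<dots> = inv ((x \<otimes> y) [^] m) \<otimes> inv (x \<otimes> y) \<otimes> x"
    using assms by (simp add: inv_prod_involutions m_assoc)
  also have "\<dots> = inv ((x \<otimes> y) [^] Suc m) \<otimes> x"
    using assms by (subst nat_pow_Suc2) (auto simp: inv_mult_group)
  finally show ?case .
qed

lemma prod_commuting_involutions:
  assumes "x \<in> involutions G" "y \<in> involutions G" "x \<otimes> y = y \<otimes> x" "x \<noteq> y"
  shows "x \<otimes> y \<in> involutions G"
proof -
  have "x \<otimes> y \<otimes> (x \<otimes> y) = x \<otimes> y \<otimes> (y \<otimes> x)" using assms(3) by simp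
  also have "\<dots> = \<one>" using assms(1,2) by (simp add: m_assoc)
  finally have "x \<otimes> y \<otimes> (x \<otimes> y) = \<one>" .
  moreover have "x \<otimes> y \<noteq> \<one>"
    using assms(1,2,4) involution_inv inv_equality involution_closed by metis
  ultimately show ?thesis using assms(1,2) by (intro involutionsI) simp_all
qed

text \<open>Makes commuting a property of the order of the product, so that it carries over along
  maps preserving these orders.\<close>

lemma commuting_iff_sq:
  assumes "x \<in> involutions G" "y \<in> involutions G"
  shows "x \<otimes> y = y \<otimes> x \<longleftrightarrow> (x \<otimes> y) [^] (2::nat) = \<one>"
proof -
  have "(x \<otimes> y) [^] (2::nat) = (x \<otimes> y) \<otimes> (x \<otimes> y)" using assms by (simp add: numeral_2_eq_2)
  moreover have "(x \<otimes> y) \<otimes> (x \<otimes> y) = \<one> \<longleftrightarrow> x \<otimes> y = inv (x \<otimes> y)"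
    using assms by (metis inv_equality involution_closed m_closed r_inv)
  ultimately show ?thesis using assms by (simp add: inv_prod_involutions)
qed

text \<open>If xy has order 2k, its k-th power is an involution. It is inverted by \<open>x\<close>,
  hence commutes with \<open>x\<close>; it also commutes with xy, and therefore with
  \<open>y\<close>.\<close>

lemma even_order_central_involution:
  assumes xy: "x \<in> involutions G" "y \<in> involutions G" and "even (ord (x \<otimes> y))" "ord (x \<otimes> y) > 0"
  shows "\<exists>z\<in>involutions G. x \<otimes> z = z \<otimes> x \<and> z \<otimes> y = y \<otimes> z"
proof -
  let ?t = "x \<otimes> y"
  have t: "?t \<in> carrier G" using xy by simp
  obtain k where k: "ord ?t = 2 * k" "k > 0" using assms(3,4) by (auto elim: evenE)
  define z where "z = ?t [^] k"
  have zc: "z \<in> carrier G" using t by (simp add: z_def)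
  have "z \<otimes> z = ?t [^] ord ?t" unfolding z_def k(1) using t by (simp add: nat_pow_mult mult_2)
  then have zz: "z \<otimes> z = \<one>" using t by simp
  have "z \<noteq> \<one>" unfolding z_def using pow_eq_id[OF t, of k] k by (auto dest: dvd_imp_le)
  then have z: "z \<in> involutions G" using zz zc by (intro involutionsI)
  have xz: "x \<otimes> z = z \<otimes> x" using dihedral_pow[OF xy, of k] z by (simp add: z_def[symmetric])
  have tz: "?t \<otimes> z = z \<otimes> ?t" unfolding z_def using t by (metis nat_pow_Suc nat_pow_Suc2)
  have "z \<otimes> y = z \<otimes> (x \<otimes> ?t)" using xy by simp
  also have "\<dots> = x \<otimes> (z \<otimes> ?t)" using xz xy zc by (metis involution_closed m_assoc t)
  also have "\<dots> = y \<otimes> z" using tz xy zc by (metis involution_cancel involution_closed m_assoc t)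
  finally show ?thesis using z xz by blast
qed

text \<open>If t = xy has order 2m + 1, then t^m does it: t^m x t^(-m) = t^(2m) x = t^(-1) x = (yx)x
  = y.\<close>

lemma odd_order_conjugate:
  assumes xy: "x \<in> involutions G" "y \<in> involutions G" and odd: "odd (ord (x \<otimes> y))"
  shows "\<exists>g\<in>carrier G. y = g \<otimes> x \<otimes> inv g"
proof -
  let ?t = "x \<otimes> y"
  have t: "?t \<in> carrier G" using xy by simp
  obtain m where m: "ord ?t = Suc (2 * m)" using odd by (auto elim: oddE)
  have "?t [^] (m + m) \<otimes> ?t = \<one>" using m t by (metis mult_2 nat_pow_Suc pow_ord_eq_1)
  then have "?t [^] (m + m) = inv ?t" using t by (metis inv_equality inv_inv nat_pow_closed)
  then have e: "?t [^] m \<otimes> ?t [^] m = y \<otimes> x"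
    using t inv_prod_involutions[OF xy] by (simp add: nat_pow_mult)
  let ?g = "?t [^] m"
  have g: "?g \<in> carrier G" using t by simp
  have "x \<otimes> inv ?g = ?g \<otimes> x"
    using dihedral_pow[OF xy, of m] g xy
    by (metis inv_closed involution_closed inv_solve_left inv_solve_right m_assoc m_closed)
  then have "?g \<otimes> x \<otimes> inv ?g = ?g \<otimes> ?g \<otimes> x" using g xy by (simp add: m_assoc)
  also have "\<dots> = y" using e xy by (simp add: m_assoc)
  finally show ?thesis using g by (intro bexI[of _ ?g]) simp_all
qed

text \<open>By the second isomorphism theorem the order of the product \<open>N <#> S\<close>
  divides the product of the orders of \<open>N\<close> and \<open>S\<close>. This is what lets a
  Sylow subgroup absorb a normal 2-subgroup.\<close>

lemma two_group_normal_join: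
  assumes fin: "finite (carrier G)" and N: "N \<lhd> G" and S: "subgroup S G"
    and cS: "card S = 2 ^ a" and cN: "card N = 2 ^ b"
  shows "\<exists>H e. subgroup H G \<and> S \<subseteq> H \<and> N \<subseteq> H \<and> card H = 2 ^ e"
proof -
  interpret second_isomorphism_grp N G S
    using N S by (simp add: second_isomorphism_grp_def second_isomorphism_grp_axioms_def)
  let ?H = "N <#> S"
  have H: "subgroup ?H G" by (rule normal_set_mult_subgroup)
  have NH: "N \<subseteq> ?H" and SH: "S \<subseteq> ?H" using H_contained_in_set_mult S_contained_in_set_mult by auto
  have finH: "finite ?H" using H fin subgroup.subset finite_subset by metis
  interpret H: group "G\<lparr>carrier := ?H\<rparr>" using H subgroup_imp_group by blast
  interpret S: group "G\<lparr>carrier := S\<rparr>" using S subgroup_imp_group by blast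
  have NsH: "subgroup N (G\<lparr>carrier := ?H\<rparr>)"
    using subgroup_incl[OF normal_imp_subgroup[OF N] H NH] .
  have l1: "card (rcosets\<^bsub>G\<lparr>carrier := ?H\<rparr>\<^esub> N) * card N = card ?H"
    using H.lagrange[OF NsH] by (simp add: order_def)
  have l2: "card (rcosets\<^bsub>G\<lparr>carrier := S\<rparr>\<^esub> (N \<inter> S)) * card (N \<inter> S) = card S"
    using S.lagrange[OF normal_imp_subgroup[OF normal_subgrp_intersection_normal]]
    by (simp add: order_def Int_commute)
  have "card (carrier (G\<lparr>carrier := S\<rparr> Mod (N \<inter> S))) = card (carrier (G\<lparr>carrier := ?H\<rparr> Mod N))"
    using normal_intersection_quotient_isom bij_betw_same_card unfolding iso_def by blast
  then have eq: "card (rcosets\<^bsub>G\<lparr>carrier := S\<rparr>\<^esub> (N \<inter> S)) = card (rcosets\<^bsub>G\<lparr>carrier := ?H\<rparr>\<^esub> N)"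
    by (simp add: FactGroup_def)
  have "card ?H dvd 2 ^ (a + b)"
    using l1 l2 eq cS cN by (metis dvd_triv_left mult_dvd_mono power_add dvd_refl)
  then obtain e where "card ?H = 2 ^ e" by (metis divides_primepow_nat two_is_prime_nat)
  then show ?thesis using H NH SH by blast
qed

end

section \<open>Groups whose commuting relation on involutions is transitive\<close>

lemma (in group) inv_cancel_left [simp]:
  assumes "g \<in> carrier G" "y \<in> carrier G"
  shows "inv g \<otimes> (g \<otimes> y) = y"
proof -
  have "inv g \<otimes> (g \<otimes> y) = (inv g \<otimes> g) \<otimes> y" using assms by (simp only: m_assoc inv_closed)
  then show ?thesis using assms by simp
qed

lemma (in group) conjugate_mult:
  assumes "x \<in> carrier G" "y \<in> carrier G" "g \<in> carrier G"
  shows "(g \<otimes> x \<otimes> inv g) \<otimes> (g \<otimes> y \<otimes> inv g) = g \<otimes> (x \<otimes> y) \<otimes> inv g"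
  using assms by (simp add: m_assoc)

lemma (in group) conjugate_cancel:
  assumes "x \<in> carrier G" "g \<in> carrier G"
  shows "inv g \<otimes> (g \<otimes> x \<otimes> inv g) \<otimes> g = x"
  using assms by (simp add: m_assoc)

lemma (in group) conjugate_inj:
  "\<lbrakk>x \<in> carrier G; y \<in> carrier G; g \<in> carrier G\<rbrakk> \<Longrightarrow> g \<otimes> x \<otimes> inv g = g \<otimes> y \<otimes> inv g \<longleftrightarrow> x = y"
  by (metis conjugate_cancel)

lemma (in group) involution_neq_one: "x \<in> involutions G \<Longrightarrow> x \<noteq> \<one>"
  using involutions_iff by blast

lemma (in group) conjugate_involution:
  assumes "x \<in> involutions G" "g \<in> carrier G"
  shows "g \<otimes> x \<otimes> inv g \<in> involutions G"
proof (rule involutionsI)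
  show "g \<otimes> x \<otimes> inv g \<noteq> \<one>"
    using conjugate_inj[of x \<one> g] assms involution_neq_one[OF assms(1)] by simp
qed (use assms in \<open>simp_all add: conjugate_mult\<close>)

lemma (in group) conjugate_pow:
  assumes "x \<in> carrier G" "g \<in> carrier G"
  shows "(g \<otimes> x \<otimes> inv g) [^] (m::nat) = g \<otimes> (x [^] m) \<otimes> inv g"
proof (induction m)
  case (Suc m)
  then show ?case using conjugate_mult[of "x [^] m" x g] assms by simp
qed (use assms in simp)

lemma (in group) conjugate_ord:
  assumes "x \<in> carrier G" "g \<in> carrier G"
  shows "ord (g \<otimes> x \<otimes> inv g) = ord x"
proof -
  have "(g \<otimes> x \<otimes> inv g) [^] m = \<one> \<longleftrightarrow> x [^] m = \<one>" for m :: nat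
    using conjugate_inj[of "x [^] m" \<one> g] assms by (simp add: conjugate_pow)
  then show ?thesis using assms ord_unique[of "g \<otimes> x \<otimes> inv g" "ord x"] pow_eq_id[of x] by simp
qed

lemma (in group) conjugate_subgroup:
  assumes S: "subgroup S G" and g: "g \<in> carrier G"
  shows "subgroup ((\<lambda>x. g \<otimes> x \<otimes> inv g) ` S) G"
proof -
  have sub: "S \<subseteq> carrier G" using S by (rule subgroup.subset)
  show ?thesis
  proof (rule subgroupI)
    show "(\<lambda>x. g \<otimes> x \<otimes> inv g) ` S \<subseteq> carrier G" using sub g by auto
    show "(\<lambda>x. g \<otimes> x \<otimes> inv g) ` S \<noteq> {}" using subgroup.one_closed[OF S] by auto
    fix a assume "a \<in> (\<lambda>x. g \<otimes> x \<otimes> inv g) ` S"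
    then obtain x where x: "x \<in> S" "a = g \<otimes> x \<otimes> inv g" by auto
    then have "inv a = g \<otimes> inv x \<otimes> inv g" using sub g by (auto simp: inv_mult_group m_assoc)
    then show "inv a \<in> (\<lambda>x. g \<otimes> x \<otimes> inv g) ` S" using x subgroup.m_inv_closed[OF S] by auto
    fix b assume "b \<in> (\<lambda>x. g \<otimes> x \<otimes> inv g) ` S"
    then obtain y where y: "y \<in> S" "b = g \<otimes> y \<otimes> inv g" by auto
    have "a \<otimes> b = g \<otimes> (x \<otimes> y) \<otimes> inv g" unfolding x y
      by (rule conjugate_mult) (use x y sub g in auto)
    then show "a \<otimes> b \<in> (\<lambda>x. g \<otimes> x \<otimes> inv g) ` S" using x y subgroup.m_closed[OF S] by auto
  qed
qed

text \<open>Here \<open>r\<close> is the exceptional order, \<open>2 ^ k\<close> the order of the centre of a Sylow 2-subgroup, \<open>s + 1\<close>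
  the number of Sylow 2-subgroups, and \<open>c\<close> the number of involutions in exceptional position to two given
  non-commuting ones.\<close>

locale fusion_group = group G for G (structure) +
  fixes r k s c :: nat
  assumes finite_G: "finite (carrier G)"
    and r_odd: "odd r" "r \<noteq> 1"
    and k_ge: "2 \<le> k" and s: "even s" "0 < s" and c_pos: "0 < c"
    and commute_trans: "\<lbrakk>x \<in> involutions G; y \<in> involutions G; z \<in> involutions G;
          x \<otimes> y = y \<otimes> x; y \<otimes> z = z \<otimes> y\<rbrakk> \<Longrightarrow> x \<otimes> z = z \<otimes> x"
    and card_commuting: "x \<in> involutions G \<Longrightarrow> card {y \<in> involutions G. x \<otimes> y = y \<otimes> x} = 2 ^ k - 1"
    and card_involutions: "card (involutions G) = (s + 1) * (2 ^ k - 1)"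
    and exceptional_partner: "\<lbrakk>x \<in> involutions G; y \<in> involutions G; x \<otimes> y \<noteq> y \<otimes> x\<rbrakk> \<Longrightarrow>
          \<exists>!z. z \<in> involutions G \<and> y \<otimes> z = z \<otimes> y \<and> ord (x \<otimes> z) = r"
    and exceptional_common: "\<lbrakk>x \<in> involutions G; y \<in> involutions G; x \<otimes> y \<noteq> y \<otimes> x\<rbrakk> \<Longrightarrow>
          card {z \<in> involutions G. ord (x \<otimes> z) = r \<and> ord (y \<otimes> z) = r} = c"
begin

lemma q_ge: "4 \<le> (2::nat) ^ k"
  using power_increasing[OF k_ge, of "2::nat"] by simp

lemma ord_commuting:
  assumes "x \<in> involutions G" "y \<in> involutions G" "x \<otimes> y = y \<otimes> x"
  shows "ord (x \<otimes> y) = (if x = y then 1 else 2)"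
proof (cases "x = y")
  case False
  then have "x \<otimes> y \<in> involutions G" by (rule prod_commuting_involutions[OF assms])
  then show ?thesis using False unfolding involutions_def by simp
qed (use assms(1) in simp)

lemma exceptional_not_commute:
  assumes "x \<in> involutions G" "y \<in> involutions G" "ord (x \<otimes> y) = r"
  shows "x \<otimes> y \<noteq> y \<otimes> x"
proof
  assume "x \<otimes> y = y \<otimes> x"
  from ord_commuting[OF assms(1,2) this] show False using assms(3) r_odd by (simp split: if_splits)
qed

lemma odd_ord:
  assumes xy: "x \<in> involutions G" "y \<in> involutions G" "x \<otimes> y \<noteq> y \<otimes> x"
  shows "odd (ord (x \<otimes> y))"
proof
  assume "even (ord (x \<otimes> y))"
  moreover have "ord (x \<otimes> y) > 0" using ord_ge_1[OF finite_G, of "x \<otimes> y"] xy by simp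
  ultimately obtain z where "z \<in> involutions G" "x \<otimes> z = z \<otimes> x" "z \<otimes> y = y \<otimes> z"
    using even_order_central_involution[OF xy(1,2)] by blast
  then show False using commute_trans[OF xy(1) _ xy(2)] xy(3) by simp
qed

lemma finite_involutions: "finite (involutions G)"
  by (rule finite_subset[OF _ finite_G]) (simp add: subset_iff)

lemma ord_prod_sym:
  assumes "x \<in> involutions G" "y \<in> involutions G"
  shows "ord (y \<otimes> x) = ord (x \<otimes> y)"
  using ord_inv[of "x \<otimes> y"] unfolding inv_prod_involutions[OF assms] using assms by simp

lemma antipodal: "antipodal_cover (involutions G) (\<lambda>x y. x \<otimes> y = y \<otimes> x) (\<lambda>x y. ord (x \<otimes> y) = r) (2 ^ k) s c"
proof (rule antipodal_cover.intro)
  show "finite (involutions G)" by (rule finite_involutions)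
  show "ord (y \<otimes> x) = r" if "x \<in> involutions G" "y \<in> involutions G" "ord (x \<otimes> y) = r" for x y
    using that(3) unfolding ord_prod_sym[OF that(1,2)] .
  show "x \<otimes> z = z \<otimes> x"
    if "x \<in> involutions G" "y \<in> involutions G" "z \<in> involutions G"
      "x \<otimes> y = y \<otimes> x" "y \<otimes> z = z \<otimes> y" for x y z
    by (rule commute_trans[OF that])
  show "x \<otimes> y \<noteq> y \<otimes> x" if "x \<in> involutions G" "y \<in> involutions G" "ord (x \<otimes> y) = r" for x y
    by (rule exceptional_not_commute[OF that])
  show "1 \<le> s" using s by simp
  show "y \<otimes> x = x \<otimes> y" if "x \<otimes> y = y \<otimes> x" for x y using that by (rule sym)
qed (rule refl card_commuting card_involutions exceptional_partner exceptional_common q_ge | assumption)+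

sublocale antipodal_cover "involutions G" "\<lambda>x y. x \<otimes> y = y \<otimes> x" "\<lambda>x y. ord (x \<otimes> y) = r" "2 ^ k" s c
  by (rule antipodal)

text \<open>Non-commuting involutions are conjugate because their product has odd order; commuting
  ones are both conjugate to an involution of another class.\<close>

lemma involutions_conjugate:
  assumes "x \<in> involutions G" "y \<in> involutions G"
  shows "\<exists>g\<in>carrier G. y = g \<otimes> x \<otimes> inv g"
proof -
  have noncomm: "\<exists>g\<in>carrier G. y = g \<otimes> x \<otimes> inv g"
    if "x \<in> involutions G" "y \<in> involutions G" "x \<otimes> y \<noteq> y \<otimes> x" for x y
    by (rule odd_order_conjugate[OF that(1,2) odd_ord[OF that]])
  show ?thesis
  proof (cases "x \<otimes> y = y \<otimes> x")
    case True
    obtain z where z: "z \<in> involutions G" "x \<otimes> z \<noteq> z \<otimes> x" using ex_other_class[OF assms(1)] by blast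
    have zy: "z \<otimes> y \<noteq> y \<otimes> z" using commute_trans[OF assms z(1) True] z(2) by metis
    obtain g where g: "g \<in> carrier G" "z = g \<otimes> x \<otimes> inv g" using noncomm[OF assms(1) z] by blast
    obtain h where h: "h \<in> carrier G" "y = h \<otimes> z \<otimes> inv h" using noncomm[OF z(1) assms(2) zy] by blast
    have "y = (h \<otimes> g) \<otimes> x \<otimes> inv (h \<otimes> g)" unfolding h(2) g(2)
      using g(1) h(1) assms(1) by (simp add: inv_mult_group m_assoc)
    then show ?thesis using g(1) h(1) by blast
  qed (rule noncomm[OF assms])
qed

lemma involution_class_eq: "involution_class G C \<Longrightarrow> C = involutions G"
proof -
  assume "involution_class G C"
  then obtain x where x: "x \<in> involutions G" "C = conjugacy_class G x" by (auto simp: involution_class_def)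
  show ?thesis unfolding x(2) conjugacy_class_def
  proof (intro equalityI subsetI)
    fix y assume "y \<in> involutions G"
    then obtain g where "g \<in> carrier G" "y = g \<otimes> x \<otimes> inv g" using involutions_conjugate[OF x(1)] by blast
    then show "y \<in> {g \<otimes> x \<otimes> inv g |g. g \<in> carrier G}" by blast
  qed (use conjugate_involution[OF x(1)] in blast)
qed

abbreviation "F \<equiv> local_fusion_graph G (odd_orders_except G r) (involutions G)"

text \<open>The order 1 belongs to \<open>odd_orders_except G r\<close>, but it arises only for
  \<open>x = y\<close>, which adjacency excludes. The other commuting pairs have order 2, and all
  non-commuting pairs have odd order.\<close>

lemma fusion_graph_eq: "F = graph"
proof -
  have "x \<noteq> y \<and> ord (x \<otimes> y) \<in> odd_orders_except G r \<longleftrightarrow>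
      x \<otimes> y \<noteq> y \<otimes> x \<and> ord (x \<otimes> y) \<noteq> r" if "x \<in> involutions G" "y \<in> involutions G" for x y
  proof (cases "x \<otimes> y = y \<otimes> x")
    case True
    show ?thesis unfolding ord_commuting[OF that True] using True by (simp add: odd_orders_except_def)
  next
    case False
    then have "x \<noteq> y" by blast
    moreover have "ord (x \<otimes> y) \<in> element_orders G" using that by (simp add: element_orders_def)
    moreover have "odd (ord (x \<otimes> y))" by (rule odd_ord[OF that False])
    ultimately show ?thesis using False by (auto simp: odd_orders_except_def)
  qed
  then show ?thesis unfolding local_fusion_graph_def graph_def by (auto intro!: ext)
qed

lemma fusion_vertex_transitive: "vertex_transitive F"
  unfolding vertex_transitive_def
proof (intro ballI)
  fix x y assume "x \<in> verts F" "y \<in> verts F"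
  then have xy: "x \<in> involutions G" "y \<in> involutions G" by (simp_all add: local_fusion_graph_def)
  obtain g where g: "g \<in> carrier G" "y = g \<otimes> x \<otimes> inv g" using involutions_conjugate[OF xy] by blast
  let ?f = "\<lambda>x. g \<otimes> x \<otimes> inv g"
  have inj: "inj_on ?f (involutions G)"
    using conjugate_inj g by (intro inj_onI) simp
  have "?f ` involutions G \<subseteq> involutions G" using conjugate_involution g by auto
  then have "?f ` involutions G = involutions G" using endo_inj_surj[OF fin _ inj] by blast
  then have bij: "bij_betw ?f (involutions G) (involutions G)" using inj by (simp add: bij_betw_def)
  have "adj F (?f a) (?f b) \<longleftrightarrow> adj F a b" if "a \<in> involutions G" "b \<in> involutions G" for a b
    using that g conjugate_involution[of a g] conjugate_involution[of b g]
    by (simp add: local_fusion_graph_def conjugate_mult conjugate_ord conjugate_inj)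
  then have "graph_automorphism F ?f" using bij by (simp add: graph_automorphism_def local_fusion_graph_def)
  then show "\<exists>f. graph_automorphism F f \<and> f x = y" using g by blast
qed

text \<open>Commuting involutions multiply to an involution or to 1. The subgroup has order
  \<open>2 ^ k\<close> and will turn out to be normal in the centraliser of \<open>z\<close>, which
  makes the join with a Sylow subgroup possible.\<close>

lemma class_subgroup:
  assumes z: "z \<in> involutions G"
  shows "subgroup (insert \<one> (cls z)) G"
proof (rule subgroupI)
  have mem: "x \<in> involutions G" "z \<otimes> x = x \<otimes> z" if "x \<in> cls z" for x using that by (auto simp: cls_def)
  show "insert \<one> (cls z) \<subseteq> carrier G" using mem by auto
  show "inv x \<in> insert \<one> (cls z)" if "x \<in> insert \<one> (cls z)" for x using that mem by auto
  show "x \<otimes> y \<in> insert \<one> (cls z)" if "x \<in> insert \<one> (cls z)" "y \<in> insert \<one> (cls z)" for x y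
  proof (cases "x = \<one> \<or> y = \<one> \<or> x = y")
    case True
    then show ?thesis using that mem by auto
  next
    case False
    then have xy: "x \<in> cls z" "y \<in> cls z" using that by auto
    have c: "x \<otimes> y = y \<otimes> x"
      using commute_trans[OF mem(1)[OF xy(1)] z mem(1)[OF xy(2)] mem(2)[OF xy(1), symmetric] mem(2)[OF xy(2)]] .
    have "x \<otimes> y \<in> involutions G" by (rule prod_commuting_involutions) (use mem xy c False in auto)
    moreover have "z \<otimes> (x \<otimes> y) = x \<otimes> (z \<otimes> y)" using mem[OF xy(1)] mem[OF xy(2)] z
      by (metis involution_closed m_assoc)
    then have "z \<otimes> (x \<otimes> y) = x \<otimes> y \<otimes> z" using mem[OF xy(1)] mem[OF xy(2)] z
      by (metis involution_closed m_assoc)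
    ultimately show ?thesis by (simp add: cls_def)
  qed
qed auto

text \<open>A Sylow subgroup acts by conjugation on the odd number of involutions, so it centralises
  one of them, and it contains the commuting class of that involution by maximality.\<close>

lemma sylow_involutions_eq_class:
  assumes S: "sylow2_subgroup G S"
  shows "\<exists>z\<in>involutions G. S \<inter> involutions G = cls z"
proof -
  let ?I = "involutions G"
  have sS: "subgroup S G" and cS: "card S = 2 ^ multiplicity 2 (order G)"
    using S by (auto simp: sylow2_subgroup_def)
  have subS: "S \<subseteq> carrier G" using sS by (rule subgroup.subset)
  interpret A: group_action "G\<lparr>carrier := S\<rparr>" "carrier G" "\<lambda>g. (\<lambda>h \<in> carrier G. g \<otimes> h \<otimes> (inv g))"
    by (rule group_action.induced_action[OF action_by_conjugation sS])
  have "odd (card ?I)" using card_involutions s k_ge by simp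
  then have "\<exists>z\<in>?I. \<forall>g\<in>carrier (G\<lparr>carrier := S\<rparr>). (\<lambda>h\<in>carrier G. g \<otimes> h \<otimes> inv g) z = z"
  proof (intro A.two_group_fixed_point)
    show "order (G\<lparr>carrier := S\<rparr>) = 2 ^ multiplicity 2 (order G)" using cS by (simp add: order_def)
    show "(\<lambda>h\<in>carrier G. g \<otimes> h \<otimes> inv g) y \<in> ?I" if "g \<in> carrier (G\<lparr>carrier := S\<rparr>)" "y \<in> ?I" for g y
      using conjugate_involution[of y g] that subS by auto
  qed (use finite_involutions in auto)
  then obtain z where z: "z \<in> ?I" "\<forall>g\<in>S. g \<otimes> z \<otimes> inv g = z" by auto
  have cz: "g \<otimes> z = z \<otimes> g" if "g \<in> S" for g
  proof -
    have "g \<otimes> z \<otimes> inv g = z" "g \<in> carrier G" using z that subS by auto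
    then show ?thesis using z(1) by (metis inv_solve_right involution_closed m_closed)
  qed
  have sub1: "S \<inter> ?I \<subseteq> cls z" using cz by (auto simp: cls_def)
  \<comment> \<open>The centraliser contains \<open>S\<close>, and conjugation by its elements
    permutes the involutions commuting with \<open>z\<close>; so the class of \<open>z\<close>
    becomes normal here, though not in \<open>G\<close>.\<close>
  define C where "C = {g \<in> carrier G. g \<otimes> z = z \<otimes> g}"
  have C: "subgroup C G"
  proof (rule subgroupI)
    show "inv g \<in> C" if "g \<in> C" for g
    proof -
      have g: "g \<in> carrier G" "g \<otimes> z = z \<otimes> g" using that by (auto simp: C_def)
      then have "z \<otimes> inv g = inv g \<otimes> z"
        using z(1) by (metis inv_closed inv_solve_left inv_solve_right involution_closed m_assoc m_closed)
      then show ?thesis using g by (simp add: C_def)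
    qed
    show "g \<otimes> h \<in> C" if "g \<in> C" "h \<in> C" for g h
    proof -
      have gh: "g \<in> carrier G" "g \<otimes> z = z \<otimes> g" "h \<in> carrier G" "h \<otimes> z = z \<otimes> h"
        using that by (auto simp: C_def)
      have "g \<otimes> h \<otimes> z = g \<otimes> (z \<otimes> h)" using gh z(1) by (simp add: m_assoc)
      also have "\<dots> = z \<otimes> g \<otimes> h" using gh(1,3) z(1) by (simp add: m_assoc[symmetric] gh(2))
      finally show ?thesis using gh z(1) by (simp add: C_def m_assoc)
    qed
  qed (use z in \<open>auto simp: C_def\<close>)
  interpret C: group "G\<lparr>carrier := C\<rparr>" using C subgroup_imp_group by blast
  let ?N = "insert \<one> (cls z)"
  have NC: "?N \<subseteq> C" using z by (auto simp: C_def cls_def)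
  have SC: "S \<subseteq> C" using cz subS by (auto simp: C_def)
  have clsC: "x \<in> cls z \<longleftrightarrow> x \<in> ?I \<and> x \<in> C" for x using z by (auto simp: C_def cls_def)
  have "?N \<lhd> (G\<lparr>carrier := C\<rparr>)"
  proof (subst C.normal_inv_iff, intro conjI ballI)
    show "subgroup ?N (G\<lparr>carrier := C\<rparr>)" using subgroup_incl[OF class_subgroup[OF z(1)] C NC] .
    fix g h assume gh: "g \<in> carrier (G\<lparr>carrier := C\<rparr>)" "h \<in> ?N"
    then have g: "g \<in> C" "g \<in> carrier G" using C subgroup.subset by auto
    have "g \<otimes> h \<otimes> inv g \<in> ?N"
    proof (cases "h = \<one>")
      case False
      then have "h \<in> ?I" "h \<in> C" using gh clsC by auto
      then have "g \<otimes> h \<otimes> inv g \<in> ?I" "g \<otimes> h \<otimes> inv g \<in> C"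
        using conjugate_involution g subgroup.m_closed[OF C] subgroup.m_inv_closed[OF C] by auto
      then show ?thesis using clsC by simp
    qed (use g in simp)
    then show "g \<otimes>\<^bsub>G\<lparr>carrier := C\<rparr>\<^esub> h \<otimes>\<^bsub>G\<lparr>carrier := C\<rparr>\<^esub> inv\<^bsub>G\<lparr>carrier := C\<rparr>\<^esub> g \<in> ?N"
      using m_inv_consistent[OF C g(1)] by simp
  qed
  moreover have "\<one> \<notin> cls z" using involution_neq_one by (auto simp: cls_def)
  then have "card ?N = 2 ^ k" using card_cls[OF z(1)] by simp
  moreover have "finite (carrier (G\<lparr>carrier := C\<rparr>))"
    using finite_G C subgroup.subset finite_subset by fastforce
  ultimately obtain H e where H: "subgroup H (G\<lparr>carrier := C\<rparr>)" "S \<subseteq> H" "?N \<subseteq> H" "card H = 2 ^ e"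
    using C.two_group_normal_join[OF _ _ subgroup_incl[OF sS C SC] cS] by blast
  have HG: "subgroup H G" using incl_subgroup[OF C H(1)] .
  have "2 ^ e dvd order G" using lagrange[OF HG] H(4) by (metis dvd_triv_right)
  moreover have "order G \<noteq> 0" using finite_G order_gt_0_iff_finite by simp
  ultimately have "e \<le> multiplicity 2 (order G)" by (intro multiplicity_geI) auto
  then have "card H \<le> card S" unfolding H(4) cS by (intro power_increasing) auto
  moreover have "finite H" using HG finite_G subgroup.subset finite_subset by metis
  ultimately have "S = H" using H(2) card_seteq by blast
  then have "cls z \<subseteq> S \<inter> ?I" using H(3) by (auto simp: cls_def)
  then show ?thesis using sub1 z(1) by blast
qed

text \<open>One Sylow subgroup exists and gives one class; since all involutions are conjugate, its
  conjugates reach every class.\<close>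

lemma sylow2_involution_sets_eq: "sylow2_involution_sets G = cls ` involutions G"
proof (intro equalityI subsetI)
  fix A assume "A \<in> sylow2_involution_sets G"
  then obtain S where "A = S \<inter> involutions G" "sylow2_subgroup G S" by (auto simp: sylow2_involution_sets_def)
  then show "A \<in> cls ` involutions G" using sylow_involutions_eq_class by auto
next
  fix A assume "A \<in> cls ` involutions G"
  then obtain x where x: "x \<in> involutions G" "A = cls x" by auto
  let ?m = "multiplicity 2 (order G)"
  have "order G = 2 ^ ?m * (order G div 2 ^ ?m)" by (simp add: multiplicity_dvd)
  then obtain S where S: "subgroup S G" "card S = 2 ^ ?m"
    using sylow_thm[OF two_is_prime_nat is_group _ finite_G] by blast
  then have "sylow2_subgroup G S" by (simp add: sylow2_subgroup_def)
  then obtain z where z: "z \<in> involutions G" "S \<inter> involutions G = cls z" using sylow_involutions_eq_class by blast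
  then have zS: "z \<in> S" by (auto simp: cls_def)
  obtain g where g: "g \<in> carrier G" "x = g \<otimes> z \<otimes> inv g" using involutions_conjugate[OF z(1) x(1)] by blast
  let ?T = "(\<lambda>x. g \<otimes> x \<otimes> inv g) ` S"
  have "inj_on (\<lambda>x. g \<otimes> x \<otimes> inv g) S"
  proof (rule inj_onI)
    fix x y assume "x \<in> S" "y \<in> S" "g \<otimes> x \<otimes> inv g = g \<otimes> y \<otimes> inv g"
    then show "x = y" using conjugate_inj[of x y g] g(1) subgroup.mem_carrier[OF S(1)] by simp
  qed
  then have "card ?T = card S" by (rule card_image)
  then have T: "sylow2_subgroup G ?T" using conjugate_subgroup[OF S(1) g(1)] S(2) by (simp add: sylow2_subgroup_def)
  then obtain w where w: "w \<in> involutions G" "?T \<inter> involutions G = cls w" using sylow_involutions_eq_class by blast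
  have "x \<in> cls w" using w(2) x(1) zS g(2) by blast
  then have "cls w = cls x" using cls_eq[OF w(1) x(1)] by (simp add: cls_def)
  then show "A \<in> sylow2_involution_sets G" using w(2) x(2) T by (auto simp: sylow2_involution_sets_def)
qed

theorem fusion_graph_properties:
  assumes C: "involution_class G C"
    and v: "v = (s + 1) * (2 ^ k - 1)" and d: "d = s * (2 ^ k - 2)"
    and ab: "s * (2 ^ k - 3) = a \<and> (s - 1) * (2 ^ k - 3) + c = b \<or> s * (2 ^ k - 3) = b \<and> (s - 1) * (2 ^ k - 3) + c = a"
    and "a \<le> b"
  defines "\<Gamma> \<equiv> local_fusion_graph G (odd_orders_except G r) C"
  shows "vertex_transitive \<Gamma> \<and> Defs.edge_regular \<Gamma> \<and> graph_diameter \<Gamma> = 2 \<and>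
    deza_graph \<Gamma> v d b a \<and>
    divisible_design_graph \<Gamma> \<and> canonical_partition \<Gamma> (sylow2_involution_sets G) \<and>
    (a \<noteq> b \<longrightarrow> (\<forall>P. canonical_partition \<Gamma> P \<longrightarrow> P = sylow2_involution_sets G))"
proof -
  have CI: "C = involutions G" using involution_class_eq[OF C] .
  have ne: "involutions G \<noteq> {}" using C by (auto simp: involution_class_def)
  have g: "\<Gamma> = graph" unfolding \<Gamma>_def CI by (rule fusion_graph_eq)
  show ?thesis unfolding g v d sylow2_involution_sets_eq
  proof (intro conjI impI allI)
    show "vertex_transitive graph" using fusion_vertex_transitive unfolding fusion_graph_eq .
    show "P = cls ` involutions G" if "a \<noteq> b" "canonical_partition graph P" for P
      by (rule canonical_unique[OF _ that(2)]) (use that(1) ab in metis)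
  qed (fact edge_regular diameter[OF ne c_pos] deza[OF ab \<open>a \<le> b\<close>] divisible canonical)+
qed

end

section \<open>Models and central quotients\<close>

lemma card_eq_fibres:
  assumes "finite A" "\<And>y. y \<in> B \<Longrightarrow> card {x \<in> A. h x = y} = f" "h ` A \<subseteq> B" "finite B"
  shows "card A = f * card B"
proof -
  have "A = (\<Union>y\<in>B. {x \<in> A. h x = y})" using assms(3) by auto
  also have "card \<dots> = (\<Sum>y\<in>B. card {x \<in> A. h x = y})"
    by (rule card_UN_disjoint) (use assms in auto)
  also have "\<dots> = f * card B" using assms(2) by simp
  finally show ?thesis .
qed

text \<open>The common interface for the three families. Involutions are indexed by \<open>V\<close>
  with all fibres of size \<open>f\<close>, and the counts are made in \<open>V\<close> and divided
  by \<open>f\<close>. Only the values 0 and 1 of \<open>\<beta>\<close> are interpreted, as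
  commuting and exceptional position, and the proofs for the individual groups reduce to counting
  solutions of \<open>\<beta> v w = 0\<close> and \<open>\<beta> v w = 1\<close>.\<close>

lemma (in group) fusion_group_modelI:
  fixes V :: "'v set" and x :: "'v \<Rightarrow> 'a" and \<beta> :: "'v \<Rightarrow> 'v \<Rightarrow> 'f::zero_neq_one"
  assumes fin: "finite (carrier G)" "finite V"
    and prm: "odd r" "r \<noteq> 1" "2 \<le> k" "even s" "0 < s" "0 < c" "0 < f"
    and surj: "x ` V = involutions G"
    and fibre: "\<And>v. v \<in> V \<Longrightarrow> card {w \<in> V. x w = x v} = f"
    and comm: "\<And>v w. \<lbrakk>v \<in> V; w \<in> V\<rbrakk> \<Longrightarrow> x v \<otimes> x w = x w \<otimes> x v \<longleftrightarrow> \<beta> v w = 0"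
    and exc: "\<And>v w. \<lbrakk>v \<in> V; w \<in> V\<rbrakk> \<Longrightarrow> ord (x v \<otimes> x w) = r \<longleftrightarrow> \<beta> v w = 1"
    and trans: "\<And>u v w. \<lbrakk>u \<in> V; v \<in> V; w \<in> V; \<beta> u v = 0; \<beta> v w = 0\<rbrakk> \<Longrightarrow> \<beta> u w = 0"
    and card_V: "card V = f * ((s + 1) * (2 ^ k - 1))"
    and card_zero: "\<And>v. v \<in> V \<Longrightarrow> card {w \<in> V. \<beta> v w = 0} = f * (2 ^ k - 1)"
    and ex_one: "\<And>v w. \<lbrakk>v \<in> V; w \<in> V; \<beta> v w \<noteq> 0\<rbrakk> \<Longrightarrow> \<exists>u\<in>V. \<beta> w u = 0 \<and> \<beta> v u = 1"
    and unique_one: "\<And>u v w. \<lbrakk>u \<in> V; v \<in> V; w \<in> V; \<beta> v w = 0; \<beta> u v = 1; \<beta> u w = 1\<rbrakk> \<Longrightarrow> x v = x w"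
    and card_one: "\<And>v w. \<lbrakk>v \<in> V; w \<in> V; \<beta> v w \<noteq> 0\<rbrakk> \<Longrightarrow> card {u \<in> V. \<beta> v u = 1 \<and> \<beta> w u = 1} = f * c"
  shows "fusion_group G r k s c"
proof
  have finI: "finite (involutions G)" using surj fin(2) by (metis finite_imageI)
  have count: "card {v \<in> V. P (x v)} = f * card {y \<in> involutions G. P y}" for P
  proof (rule card_eq_fibres)
    fix y assume y: "y \<in> {y \<in> involutions G. P y}"
    then obtain v where v: "v \<in> V" "y = x v" using surj by auto
    then have "{w \<in> {v \<in> V. P (x v)}. x w = y} = {w \<in> V. x w = x v}" using y by auto
    then show "card {w \<in> {v \<in> V. P (x v)}. x w = y} = f" using fibre v by simp
  next
    show "x ` {v \<in> V. P (x v)} \<subseteq> {y \<in> involutions G. P y}" using surj by blast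
    show "finite {y \<in> involutions G. P y}" using finI by simp
  qed (use fin in simp)
  have obt: "\<exists>v\<in>V. y = x v" if "y \<in> involutions G" for y using that surj by auto
  have xI: "x v \<in> involutions G" if "v \<in> V" for v using that surj by auto
  show "y \<otimes> w = w \<otimes> y"
    if I: "y \<in> involutions G" "z \<in> involutions G" "w \<in> involutions G"
      and c1: "y \<otimes> z = z \<otimes> y" and c2: "z \<otimes> w = w \<otimes> z" for y z w
  proof -
    obtain a b c where "a \<in> V" "b \<in> V" "c \<in> V" "y = x a" "z = x b" "w = x c" using I obt by metis
    then show ?thesis using c1 c2 comm[of a b] comm[of b c] comm[of a c] trans[of a b c] by metis
  qed
  show "card {w \<in> involutions G. y \<otimes> w = w \<otimes> y} = 2 ^ k - 1" if y: "y \<in> involutions G" for y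
  proof -
    obtain v where v: "v \<in> V" "y = x v" using obt[OF y] by blast
    have "{w \<in> V. x v \<otimes> x w = x w \<otimes> x v} = {w \<in> V. \<beta> v w = 0}"
      using comm[OF v(1)] by (intro Collect_cong conj_cong refl)
    then show ?thesis using count[of "\<lambda>w. y \<otimes> w = w \<otimes> y"] card_zero[OF v(1)] v(2) prm(7) by simp
  qed
  show "card (involutions G) = (s + 1) * (2 ^ k - 1)"
    using count[of "\<lambda>_. True"] card_V prm(7) by simp
  fix y z assume yz: "y \<in> involutions G" "z \<in> involutions G" "y \<otimes> z \<noteq> z \<otimes> y"
  then obtain v w where vw: "v \<in> V" "w \<in> V" "y = x v" "z = x w" using obt by metis
  then have nz: "\<beta> v w \<noteq> 0" using comm[of v w] yz(3) by simp
  show "\<exists>!t. t \<in> involutions G \<and> z \<otimes> t = t \<otimes> z \<and> ord (y \<otimes> t) = r"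
  proof (rule ex_ex1I)
    obtain u where u: "u \<in> V" "\<beta> w u = 0" "\<beta> v u = 1" using ex_one[OF vw(1,2) nz] by blast
    then show "\<exists>t. t \<in> involutions G \<and> z \<otimes> t = t \<otimes> z \<and> ord (y \<otimes> t) = r"
      using comm[OF vw(2) u(1)] exc[OF vw(1) u(1)] vw xI[OF u(1)] by metis
    fix t1 t2 assume t: "t1 \<in> involutions G \<and> z \<otimes> t1 = t1 \<otimes> z \<and> ord (y \<otimes> t1) = r"
      "t2 \<in> involutions G \<and> z \<otimes> t2 = t2 \<otimes> z \<and> ord (y \<otimes> t2) = r"
    then obtain a b where ab: "a \<in> V" "b \<in> V" "t1 = x a" "t2 = x b" using obt by metis
    have z: "\<beta> w b = 0" "\<beta> a w = 0" "\<beta> v a = 1" "\<beta> v b = 1"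
      using comm[of w b] comm[of a w] exc[of v a] exc[of v b] ab vw t by metis+
    then have "\<beta> a b = 0" using trans[of a w b] ab vw by simp
    then show "t1 = t2" using unique_one[of v a b] ab vw z by simp
  qed
  have "{u \<in> V. ord (x v \<otimes> x u) = r \<and> ord (x w \<otimes> x u) = r} = {u \<in> V. \<beta> v u = 1 \<and> \<beta> w u = 1}"
    using exc[OF vw(1)] exc[OF vw(2)] by (intro Collect_cong conj_cong refl)
  then show "card {t \<in> involutions G. ord (y \<otimes> t) = r \<and> ord (z \<otimes> t) = r} = c"
    using count[of "\<lambda>t. ord (y \<otimes> t) = r \<and> ord (z \<otimes> t) = r"] card_one[OF vw(1,2) nz] vw(3,4) prm(7) by simp
qed (use fin prm in simp_all)

text \<open>Orders of products of two involutions determine both relations, so the involutions of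
  \<open>G\<close> themselves can serve as a model for those of \<open>H\<close>. The form is then
  three-valued, with 2 standing for neither relation.\<close>

lemma (in fusion_group) transfer:
  assumes H: "group H" "finite (carrier H)"
    and bij: "bij_betw h (involutions G) (involutions H)"
    and ord: "\<And>x y. \<lbrakk>x \<in> involutions G; y \<in> involutions G\<rbrakk> \<Longrightarrow> group.ord H (h x \<otimes>\<^bsub>H\<^esub> h y) = ord (x \<otimes> y)"
  shows "fusion_group H r k s c"
proof -
  interpret H: group H by (rule H(1))
  have comm: "h x \<otimes>\<^bsub>H\<^esub> h y = h y \<otimes>\<^bsub>H\<^esub> h x \<longleftrightarrow> x \<otimes> y = y \<otimes> x"
    if xy: "x \<in> involutions G" "y \<in> involutions G" for x y
  proof -
    have hxy: "h x \<in> involutions H" "h y \<in> involutions H" using bij xy bij_betwE by metis+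
    show ?thesis unfolding commuting_iff_sq[OF xy] H.commuting_iff_sq[OF hxy]
      using ord[OF xy] pow_eq_id[of "x \<otimes> y" 2] H.pow_eq_id[of "h x \<otimes>\<^bsub>H\<^esub> h y" 2] xy hxy by simp
  qed
  have im: "h ` involutions G = involutions H" using bij by (simp add: bij_betw_def)
  have card1: "card {v \<in> involutions G. P (h v)} = card {y \<in> involutions H. P y}" for P
  proof (rule bij_betw_same_card[of h])
    show "bij_betw h {v \<in> involutions G. P (h v)} {y \<in> involutions H. P y}"
      using bij unfolding bij_betw_def by (auto intro: inj_on_subset)
  qed
  define \<beta> :: "'a \<Rightarrow> 'a \<Rightarrow> nat"
    where "\<beta> x y = (if x \<otimes> y = y \<otimes> x then 0 else if ord (x \<otimes> y) = r then 1 else 2)" for x y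
  have b0: "\<beta> x y = 0 \<longleftrightarrow> x \<otimes> y = y \<otimes> x" for x y by (simp add: \<beta>_def)
  have b1: "\<beta> x y = 1 \<longleftrightarrow> ord (x \<otimes> y) = r" if "x \<in> involutions G" "y \<in> involutions G" for x y
    using exceptional_not_commute[OF that] by (auto simp: \<beta>_def)
  show ?thesis
  proof (rule H.fusion_group_modelI[where V = "involutions G" and x = h and f = 1 and \<beta> = \<beta>])
    show "card {w \<in> involutions G. h w = h v} = 1" if "v \<in> involutions G" for v
    proof -
      have "{w \<in> involutions G. h w = h v} = {v}" using bij that unfolding bij_betw_def inj_on_def by auto
      then show ?thesis by simp
    qed
    show "h v \<otimes>\<^bsub>H\<^esub> h w = h w \<otimes>\<^bsub>H\<^esub> h v \<longleftrightarrow> \<beta> v w = 0" if "v \<in> involutions G" "w \<in> involutions G" for v w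
      unfolding b0 by (rule comm[OF that])
    show "H.ord (h v \<otimes>\<^bsub>H\<^esub> h w) = r \<longleftrightarrow> \<beta> v w = 1" if "v \<in> involutions G" "w \<in> involutions G" for v w
      unfolding b1[OF that] ord[OF that] by (rule refl)
    show "\<beta> u w = 0"
      if "u \<in> involutions G" "v \<in> involutions G" "w \<in> involutions G" "\<beta> u v = 0" "\<beta> v w = 0" for u v w
      using that(4,5) unfolding b0 by (rule commute_trans[OF that(1-3)])
    show "card {w \<in> involutions G. \<beta> v w = 0} = 1 * (2 ^ k - 1)" if "v \<in> involutions G" for v
      unfolding b0 using card_commuting[OF that] by simp
    have p: "\<exists>!z. z \<in> involutions G \<and> \<beta> w z = 0 \<and> \<beta> v z = 1"
      if "v \<in> involutions G" "w \<in> involutions G" "\<beta> v w \<noteq> 0" for v w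
    proof -
      have "(z \<in> involutions G \<and> \<beta> w z = 0 \<and> \<beta> v z = 1) \<longleftrightarrow>
          (z \<in> involutions G \<and> w \<otimes> z = z \<otimes> w \<and> ord (v \<otimes> z) = r)" for z
        unfolding b0 using b1[OF that(1), of z] by blast
      then show ?thesis using exceptional_partner[OF that(1,2) that(3)[unfolded b0]] by simp
    qed
    show "\<exists>u\<in>involutions G. \<beta> w u = 0 \<and> \<beta> v u = 1"
      if "v \<in> involutions G" "w \<in> involutions G" "\<beta> v w \<noteq> 0" for v w
      using ex1_implies_ex[OF p[OF that]] by blast
    show "h v = h w" if "u \<in> involutions G" "v \<in> involutions G" "w \<in> involutions G"
      "\<beta> v w = 0" "\<beta> u v = 1" "\<beta> u w = 1" for u v w
    proof -
      have "\<beta> v v = 0" "\<beta> u v \<noteq> 0" using that by (simp_all add: b0)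
      then have "v = w" using p[OF that(1,2)] that by blast
      then show ?thesis by simp
    qed
    show "card {u \<in> involutions G. \<beta> v u = 1 \<and> \<beta> w u = 1} = 1 * c"
      if "v \<in> involutions G" "w \<in> involutions G" "\<beta> v w \<noteq> 0" for v w
    proof -
      have "{u \<in> involutions G. \<beta> v u = 1 \<and> \<beta> w u = 1} =
          {u \<in> involutions G. ord (v \<otimes> u) = r \<and> ord (w \<otimes> u) = r}"
        using b1[OF that(1)] b1[OF that(2)] by blast
      then show ?thesis using exceptional_common[OF that(1,2) that(3)[unfolded b0]] by simp
    qed
  qed (use H(2) r_odd k_ge s c_pos finite_involutions im card_involutions in simp_all)
qed

lemma (in fusion_group) quotient:
  assumes Z: "subgroup Z G" and central: "\<And>z g. \<lbrakk>z \<in> Z; g \<in> carrier G\<rbrakk> \<Longrightarrow> z \<otimes> g = g \<otimes> z"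
    and odd: "odd (card Z)"
  shows "fusion_group (G Mod Z) r k s c"
proof -
  have zc: "z \<in> carrier G" if "z \<in> Z" for z using that subgroup.mem_carrier[OF Z] by blast
  have "g \<otimes> z \<otimes> inv g \<in> Z" if "g \<in> carrier G" "z \<in> Z" for g z
  proof -
    have "g \<otimes> z \<otimes> inv g = z"
      unfolding central[OF that(2,1), symmetric] using that(1) zc[OF that(2)] by (simp add: m_assoc)
    then show ?thesis using that by simp
  qed
  then have nZ: "Z \<lhd> G" using Z by (simp add: normal_inv_iff)
  interpret N: normal Z G by (rule nZ)
  interpret H: group "G Mod Z" by (rule N.factorgroup_is_group)
  interpret pi: group_hom G "G Mod Z" "\<lambda>a. Z #> a"
    using N.r_coset_hom_Mod by unfold_locales
  have Zpow: "z [^] card Z = \<one>" if "z \<in> Z" for z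
  proof -
    interpret ZG: group "G\<lparr>carrier := Z\<rparr>" using Z subgroup_imp_group by blast
    have "z [^]\<^bsub>G\<lparr>carrier := Z\<rparr>\<^esub> order (G\<lparr>carrier := Z\<rparr>) = \<one>\<^bsub>G\<lparr>carrier := Z\<rparr>\<^esub>"
      using that by (intro ZG.pow_order_eq_1) simp
    then show ?thesis by (simp add: order_def nat_pow_consistent[symmetric])
  qed
  obtain m where m: "card Z = Suc (2 * m)" using odd by (auto elim: oddE)
  have sq1: "z = \<one>" if "z \<in> Z" "z \<otimes> z = \<one>" for z
  proof -
    have "z [^] (2::nat) = \<one>" using zc that by (simp add: numeral_2_eq_2)
    then have "z [^] (2 * m) = \<one>" using zc[OF that(1)] by (metis nat_pow_one nat_pow_pow)
    then show ?thesis using Zpow[OF that(1)] zc[OF that(1)] by (simp add: m)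
  qed
  have one: "Z #> g = \<one>\<^bsub>G Mod Z\<^esub> \<longleftrightarrow> g \<in> Z" if "g \<in> carrier G" for g
    using that N.rcos_const[OF is_group, of g] rcos_self[OF that Z] by (auto simp: FactGroup_def)
  have mult: "(Z #> x) \<otimes>\<^bsub>G Mod Z\<^esub> (Z #> y) = Z #> (x \<otimes> y)" if "x \<in> carrier G" "y \<in> carrier G" for x y
    using pi.hom_mult[OF that] by simp
  have img: "Z #> x \<in> involutions (G Mod Z)" if x: "x \<in> involutions G" for x
  proof (rule H.involutionsI)
    show "Z #> x \<in> carrier (G Mod Z)" using x by (simp add: pi.hom_closed)
    show "Z #> x \<noteq> \<one>\<^bsub>G Mod Z\<^esub>"
      using one[of x] sq1[of x] involution_neq_one[OF x] involution_sq[OF x] involution_closed[OF x] by blast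
    show "(Z #> x) \<otimes>\<^bsub>G Mod Z\<^esub> (Z #> x) = \<one>\<^bsub>G Mod Z\<^esub>"
      using mult[of x x] x one[of \<one>] subgroup.one_closed[OF Z] by simp
  qed
  \<comment> \<open>The element \<open>x\<close> inverts this power and also commutes with it, as it
    is central. So its square is trivial, and a group of odd order has no involutions.\<close>
  have pow: "(x \<otimes> y) [^] j = \<one>"
    if xy: "x \<in> involutions G" "y \<in> involutions G" and j: "(x \<otimes> y) [^] (j::nat) \<in> Z" for x y j
  proof -
    let ?t = "(x \<otimes> y) [^] j"
    have t: "?t \<in> carrier G" using xy by simp
    have "inv ?t \<otimes> x = ?t \<otimes> x" using dihedral_pow[OF xy, of j] central[OF j, of x] xy by simp
    then have "inv ?t = ?t" using t xy by (metis inv_closed involution_closed right_cancel)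
    then have "?t \<otimes> ?t = \<one>" using t by (metis r_inv)
    then show ?thesis by (rule sq1[OF j])
  qed
  have ord: "H.ord ((Z #> x) \<otimes>\<^bsub>G Mod Z\<^esub> (Z #> y)) = ord (x \<otimes> y)"
    if xy: "x \<in> involutions G" "y \<in> involutions G" for x y
  proof -
    have c: "x \<otimes> y \<in> carrier G" using xy by simp
    have "(Z #> (x \<otimes> y)) [^]\<^bsub>G Mod Z\<^esub> j = \<one>\<^bsub>G Mod Z\<^esub> \<longleftrightarrow> ord (x \<otimes> y) dvd j" for j :: nat
    proof -
      have "(Z #> (x \<otimes> y)) [^]\<^bsub>G Mod Z\<^esub> j = Z #> ((x \<otimes> y) [^] j)" using pi.hom_nat_pow[OF c, of j] by simp
      then have "(Z #> (x \<otimes> y)) [^]\<^bsub>G Mod Z\<^esub> j = \<one>\<^bsub>G Mod Z\<^esub> \<longleftrightarrow> (x \<otimes> y) [^] j \<in> Z" using one c by simp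
      also have "\<dots> \<longleftrightarrow> (x \<otimes> y) [^] j = \<one>" using pow[OF xy] subgroup.one_closed[OF Z] by auto
      finally show ?thesis using pow_eq_id[OF c] by simp
    qed
    then show ?thesis unfolding mult[OF involution_closed[OF xy(1)] involution_closed[OF xy(2)]]
      using H.ord_unique[OF pi.hom_closed[OF c]] by blast
  qed
  have inj: "inj_on (\<lambda>a. Z #> a) (involutions G)"
  proof (rule inj_onI)
    fix x y assume xy: "x \<in> involutions G" "y \<in> involutions G" "Z #> x = Z #> y"
    have "H.ord ((Z #> x) \<otimes>\<^bsub>G Mod Z\<^esub> (Z #> x)) = ord (x \<otimes> y)" using ord[OF xy(1,2)] xy(3) by simp
    then have "ord (x \<otimes> y) = 1" unfolding ord[OF xy(1,1)] using xy(1) by simp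
    then have "x \<otimes> y = \<one>" using ord_eq_1 xy by simp
    then show "x = y" using xy by (metis involution_cancel involution_closed r_one)
  qed
  have "involutions (G Mod Z) \<subseteq> (\<lambda>a. Z #> a) ` involutions G"
  proof
    fix A assume A: "A \<in> involutions (G Mod Z)"
    then obtain g where g: "g \<in> carrier G" "A = Z #> g"
      using H.involution_closed[OF A] by (auto simp: FactGroup_def RCOSETS_def)
    let ?z = "g \<otimes> g"
    have z: "?z \<in> Z" using H.involution_sq[OF A] mult[OF g(1) g(1)] one[of "g \<otimes> g"] g by simp
    have nz: "g \<notin> Z" using H.involution_neq_one[OF A] one[OF g(1)] g(2) by simp
    \<comment> \<open>The representative \<open>g\<close> is corrected inside its coset: with
      \<open>Suc (2 * m)\<close> the order of \<open>Z\<close>, the square of z^m g is z^(2m) z =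
      1.\<close>
    let ?w = "?z [^] m"
    have wZ: "?w \<in> Z" using z Z by (induction m) (auto simp: subgroup.one_closed subgroup.m_closed)
    let ?h = "?w \<otimes> g"
    have hc: "?h \<in> carrier G" using wZ zc g by simp
    have "?h \<otimes> ?h = ?w \<otimes> (g \<otimes> ?w) \<otimes> g" using zc[OF wZ] g by (simp add: m_assoc)
    also have "\<dots> = ?w \<otimes> ?w \<otimes> ?z" unfolding central[OF wZ g(1), symmetric] using zc[OF wZ] g(1) by (simp add: m_assoc)
    also have "\<dots> = ?z [^] Suc (2 * m)" using zc[OF z] by (simp add: nat_pow_mult mult_2)
    also have "\<dots> = \<one>" using Zpow[OF z] m by simp
    finally have hh: "?h \<otimes> ?h = \<one>" .
    have "?h \<notin> Z"
    proof
      assume "?h \<in> Z"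
      then have "inv ?w \<otimes> ?h \<in> Z" using wZ Z subgroup.m_closed subgroup.m_inv_closed by metis
      then show False using nz zc[OF wZ] g(1) by simp
    qed
    then have "?h \<noteq> \<one>" using subgroup.one_closed[OF Z] by metis
    then have "?h \<in> involutions G" using hc hh involutionsI by blast
    moreover have "Z #> ?h = A" using g(2) N.rcos_const[OF is_group wZ] coset_mult_assoc[of Z ?w g, symmetric] zc[OF wZ] g(1)
        subgroup.subset[OF Z] by simp
    ultimately show "A \<in> (\<lambda>a. Z #> a) ` involutions G" by blast
  qed
  then have bij: "bij_betw (\<lambda>a. Z #> a) (involutions G) (involutions (G Mod Z))"
    using inj img by (auto simp: bij_betw_def)
  have "finite (carrier (G Mod Z))" using finite_G by (simp add: FactGroup_def RCOSETS_def)
  then show ?thesis using transfer[OF H.is_group _ bij ord] by simp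
qed

section \<open>Matrix groups and fields of characteristic 2\<close>

lemma even_card_fixpoint_free:
  assumes "finite A" "\<And>x. x \<in> A \<Longrightarrow> f x \<in> A" "\<And>x. x \<in> A \<Longrightarrow> f (f x) = x" "\<And>x. x \<in> A \<Longrightarrow> f x \<noteq> x"
  shows "even (card A)"
  using assms
proof (induction "card A" arbitrary: A rule: less_induct)
  case less
  show ?case
  proof (cases "A = {}")
    case False
    then obtain x where x: "x \<in> A" by blast
    let ?B = "A - {x, f x}"
    have sub: "{x, f x} \<subseteq> A" and two: "card {x, f x} = 2" using x less.prems(2)[OF x] less.prems(4)[OF x, symmetric] by auto
    have cA: "card A = card ?B + 2"
      using card_Diff_subset[of "{x, f x}" A] card_mono[OF less.prems(1) sub] sub two by simp
    have "even (card ?B)"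
    proof (rule less.hyps)
      show "f y \<in> ?B" if "y \<in> ?B" for y using that less.prems(2,3) x by (metis Diff_iff insert_iff empty_iff)
    qed (use cA less.prems in auto)
    then show ?thesis using cA by simp
  qed simp
qed

text \<open>Inversion pairs off the elements other than 1.\<close>

lemma (in group) odd_card_no_involution:
  assumes Z: "subgroup Z G" "finite Z" and sq: "\<And>z. \<lbrakk>z \<in> Z; z \<otimes> z = \<one>\<rbrakk> \<Longrightarrow> z = \<one>"
  shows "odd (card Z)"
proof -
  have c: "z \<in> carrier G" if "z \<in> Z" for z using that subgroup.mem_carrier[OF Z(1)] by blast
  have "even (card (Z - {\<one>}))"
  proof (rule even_card_fixpoint_free[where f = "\<lambda>z. inv z"])
    show "inv z \<in> Z - {\<one>}" if "z \<in> Z - {\<one>}" for z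
      using that subgroup.m_inv_closed[OF Z(1)] c by (auto simp: inv_eq_1_iff)
    show "inv z \<noteq> z" if "z \<in> Z - {\<one>}" for z
      using that sq c r_inv by (metis DiffE singletonI)
  qed (use Z c in auto)
  moreover have "card Z = Suc (card (Z - {\<one>}))"
    by (rule card.remove[OF Z(2) subgroup.one_closed[OF Z(1)]])
  ultimately show ?thesis by simp
qed

text \<open>The cube of xy is (xyx)(yxy), and the second factor is its own inverse. The braid
  relation is the convenient form for transvections, because xyx is the transvection of an image
  vector.\<close>

lemma (in group) ord_three_iff:
  assumes "x \<in> involutions G" "y \<in> involutions G"
  shows "ord (x \<otimes> y) = 3 \<longleftrightarrow> x \<noteq> y \<and> x \<otimes> y \<otimes> x = y \<otimes> x \<otimes> y"
proof -
  have c: "x \<otimes> y \<in> carrier G" "x \<in> carrier G" "y \<in> carrier G" using assms by simp_all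
  have "prime (3::nat)" by simp
  then have "ord (x \<otimes> y) dvd 3 \<longleftrightarrow> ord (x \<otimes> y) = 1 \<or> ord (x \<otimes> y) = 3"
    by (metis dvd_refl one_dvd prime_nat_iff)
  moreover have "ord (x \<otimes> y) = 1 \<longleftrightarrow> x = y"
  proof -
    have "x = y" if "x \<otimes> y = \<one>"
      using inv_equality[OF that c(3,2)] assms by simp
    then show ?thesis using ord_eq_1[OF c(1)] assms by auto
  qed
  moreover have "ord (x \<otimes> y) dvd 3 \<longleftrightarrow> x \<otimes> y \<otimes> x = y \<otimes> x \<otimes> y"
  proof -
    let ?A = "x \<otimes> y \<otimes> x" and ?B = "y \<otimes> x \<otimes> y"
    have AB: "?A \<in> carrier G" "?B \<in> carrier G" using c by simp_all
    have iB: "inv ?B = ?B" using assms by (simp add: inv_mult_group m_assoc)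
    have "(x \<otimes> y) [^] (3::nat) = ?A \<otimes> ?B"
      using c by (simp add: numeral_3_eq_3 m_assoc)
    then have "ord (x \<otimes> y) dvd 3 \<longleftrightarrow> ?A \<otimes> ?B = \<one>" using pow_eq_id[OF c(1), of 3] by simp
    also have "\<dots> \<longleftrightarrow> ?A = ?B"
    proof
      assume "?A \<otimes> ?B = \<one>"
      then show "?A = ?B" using inv_equality[OF _ AB(2,1)] iB by simp
    next
      assume "?A = ?B"
      then show "?A \<otimes> ?B = \<one>" using r_inv[OF AB(2)] iB by simp
    qed
    finally show ?thesis .
  qed
  ultimately show ?thesis by auto
qed

lemma group_GL: "group (GL_group :: ('a::field^'n^'n) monoid)"
proof (rule groupI)
  show "x \<otimes>\<^bsub>GL_group\<^esub> y \<in> carrier GL_group"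
    if "x \<in> carrier GL_group" "y \<in> carrier GL_group" for x y :: "'a^'n^'n"
    using that by (simp add: GL_group_def invertible_mult)
  show "\<exists>y\<in>carrier GL_group. y \<otimes>\<^bsub>GL_group\<^esub> x = \<one>\<^bsub>GL_group\<^esub>"
    if "x \<in> carrier GL_group" for x :: "'a^'n^'n"
    using that unfolding GL_group_def by (auto simp: invertible_def)
qed (auto simp: GL_group_def matrix_mul_assoc invertible_def)

lemma group_GL_carrier_update:
  assumes sub: "\<And>A. A \<in> H \<Longrightarrow> invertible (A :: 'a::field^'n^'n)"
    and one: "mat 1 \<in> H" and mult: "\<And>A B. \<lbrakk>A \<in> H; B \<in> H\<rbrakk> \<Longrightarrow> A ** B \<in> H"
    and inv: "\<And>A B. \<lbrakk>A \<in> H; A ** B = mat 1; B ** A = mat 1\<rbrakk> \<Longrightarrow> B \<in> H"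
  shows "group (GL_group\<lparr>carrier := H\<rparr>)"
proof (rule groupI)
  show "\<exists>y\<in>carrier (GL_group\<lparr>carrier := H\<rparr>). y \<otimes>\<^bsub>GL_group\<lparr>carrier := H\<rparr>\<^esub> x = \<one>\<^bsub>GL_group\<lparr>carrier := H\<rparr>\<^esub>"
    if "x \<in> carrier (GL_group\<lparr>carrier := H\<rparr>)" for x :: "'a^'n^'n"
    using that sub[of x] inv[of x] by (auto simp: GL_group_def invertible_def)
qed (use one mult in \<open>auto simp: GL_group_def matrix_mul_assoc\<close>)

lemma group_SL: "group (SL_group :: ('a::field^'n^'n) monoid)"
  unfolding SL_group_def
proof (rule group_GL_carrier_update)
  show "B \<in> {A. det A = 1}" if "A \<in> {A. det A = 1}" "A ** B = mat 1" for A B :: "'a^'n^'n"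
    using that det_mul[of A B] by simp
qed (auto simp: invertible_det_nz det_mul)

lemma GL_group_simps [simp]:
  "mult (GL_group\<lparr>carrier := H\<rparr>) = (**)" "one (GL_group\<lparr>carrier := H\<rparr>) = mat 1"
  by (simp_all add: GL_group_def)

lemma mat_mult_nth [simp]:
  fixes A :: "'a::field^'n^'n"
  shows "(mat a ** A) $ i $ j = a * A $ i $ j" "(A ** mat a) $ i $ j = A $ i $ j * a"
proof -
  have "(\<Sum>k\<in>UNIV. (if i = k then a else 0) * A $ k $ j) = (\<Sum>k\<in>UNIV. if i = k then a * A $ k $ j else 0)"
    by (rule sum.cong) auto
  then show "(mat a ** A) $ i $ j = a * A $ i $ j"
    by (simp add: matrix_matrix_mult_def mat_def)
  have "(\<Sum>k\<in>UNIV. A $ i $ k * (if k = j then a else 0)) = (\<Sum>k\<in>UNIV. if k = j then A $ i $ k * a else 0)"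
    by (rule sum.cong) auto
  then show "(A ** mat a) $ i $ j = A $ i $ j * a"
    by (simp add: matrix_matrix_mult_def mat_def)
qed

lemma mat_mult_mat: "mat a ** (mat b :: 'a::field^'n^'n) = mat (a * b)"
  by (simp add: vec_eq_iff) (simp add: mat_def)

lemma mat_commute: "mat a ** A = (A :: 'a::field^'n^'n) ** mat a"
  by (simp add: vec_eq_iff mult.commute)

lemma mat_eq_iff: "(mat a :: 'a::field^'n^'n) = mat b \<longleftrightarrow> a = b"
  by (auto simp: vec_eq_iff mat_def)

lemma scalar_subgroup:
  fixes H :: "('a::field^'n^'n) set"
  assumes "group (GL_group\<lparr>carrier := H\<rparr>)"
  shows "subgroup (H \<inter> range mat) (GL_group\<lparr>carrier := H\<rparr>)"
proof -
  interpret group "GL_group\<lparr>carrier := H\<rparr>" by (rule assms)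
  show ?thesis
  proof (rule subgroupI)
    show "H \<inter> range mat \<noteq> {}" using one_closed by auto
    show "A \<otimes>\<^bsub>GL_group\<lparr>carrier := H\<rparr>\<^esub> B \<in> H \<inter> range mat"
      if "A \<in> H \<inter> range mat" "B \<in> H \<inter> range mat" for A B
      using m_closed[of A B] that by (auto simp: mat_mult_mat)
    fix A assume A: "A \<in> H \<inter> range mat"
    then obtain a where a: "A = mat a" by blast
    let ?B = "inv\<^bsub>GL_group\<lparr>carrier := H\<rparr>\<^esub> A"
    have B: "?B \<in> H" "?B ** mat a = mat 1" using inv_closed[of A] l_inv[of A] A a by auto
    have "a * (?B $ i $ i) = 1" for i
      using arg_cong[OF B(2), of "\<lambda>C. C $ i $ i"] by (simp add: mult.commute) (simp add: mat_def)
    then have "a \<noteq> 0" by (metis mult_zero_left zero_neq_one)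
    then have "mat a ** mat (inverse a) = (mat 1 :: 'a^'n^'n)" by (simp add: mat_mult_mat)
    then have "?B = ?B ** mat a ** mat (inverse a)" by (simp flip: matrix_mul_assoc)
    then have "?B = mat (inverse a)" unfolding B(2) by simp
    then show "?B \<in> H \<inter> range mat" using B by auto
  qed auto
qed

lemma fusion_group_projective:
  fixes H :: "('a::{field,finite}^'n^'n) set"
  assumes K: "fusion_group (GL_group\<lparr>carrier := H\<rparr>) r k s c"
    and sq: "\<And>a::'a. a * a = 1 \<Longrightarrow> a = 1"
  shows "fusion_group (projective (GL_group\<lparr>carrier := H\<rparr>)) r k s c"
proof -
  interpret fusion_group "GL_group\<lparr>carrier := H\<rparr>" r k s c by (rule K)
  have sub: "subgroup (H \<inter> range mat) (GL_group\<lparr>carrier := H\<rparr>)" by (rule scalar_subgroup[OF is_group])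
  let ?K = "GL_group\<lparr>carrier := H\<rparr>"
  have "fusion_group (?K Mod (H \<inter> range mat)) r k s c"
  proof (rule quotient[OF sub])
    show "odd (card (H \<inter> range mat))"
    proof (rule odd_card_no_involution[OF sub])
      fix A assume A: "A \<in> H \<inter> range mat" "A \<otimes>\<^bsub>?K\<^esub> A = \<one>\<^bsub>?K\<^esub>"
      then obtain a where a: "A = mat a" by blast
      then have "mat (a * a) = (mat 1 :: 'a^'n^'n)" using A(2) by (simp add: mat_mult_mat)
      then have "a = 1" unfolding mat_eq_iff by (rule sq)
      then show "A = \<one>\<^bsub>?K\<^esub>" using a by simp
    qed simp
    show "A \<otimes>\<^bsub>?K\<^esub> B = B \<otimes>\<^bsub>?K\<^esub> A" if "A \<in> H \<inter> range mat" for A B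
      using that by (auto simp: mat_commute)
  qed
  moreover have "carrier ?K = H" by simp
  ultimately show ?thesis unfolding projective_def by (simp only:)
qed

section \<open>Finite fields of characteristic 2\<close>

locale char2_field =
  fixes ty :: "'a::{field,finite} itself" and n :: nat
  assumes card_field: "CARD('a) = 2 ^ n"
begin

lemma n_pos: "0 < n"
proof (rule ccontr)
  assume "\<not> ?thesis"
  then have "CARD('a) = 1" using card_field by simp
  then have "(0::'a) = 1" by (metis card_1_singletonE UNIV_I singletonD)
  then show False by simp
qed

text \<open>Translation by 1 permutes the field, so comparing the sums of all elements before and
  after shows that the cardinality vanishes in the field; it is a power of 2.\<close>

lemma two: "(2::'a) = 0"
proof -
  have "(\<Sum>x\<in>UNIV. x + 1) = (\<Sum>x\<in>UNIV. x :: 'a)"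
    by (rule sum.reindex_bij_witness[of _ "\<lambda>x. x - 1" "\<lambda>x. x + 1"]) auto
  then have "(of_nat CARD('a) :: 'a) = 0" by (simp add: sum.distrib)
  then show ?thesis by (simp add: card_field)
qed

lemma add_self [simp]: "(x::'a) + x = 0"
  using two by (metis mult_2 mult_zero_left)

lemma add_eq_0_iff2: "(x::'a) + y = 0 \<longleftrightarrow> x = y"
  by (metis add_self add_left_imp_eq)

lemma uminus2 [simp]: "- (x::'a) = x"
  by (metis add_self minus_unique)

lemma diff2 [simp]: "(x::'a) - y = x + y"
  by (metis uminus2 diff_conv_add_uminus)

lemma add_left_self [simp]: "(x::'a) + (x + y) = y"
  by (metis add_self add.assoc add_0)

text \<open>Multiplication by a nonzero \<open>x\<close> permutes the nonzero elements; comparing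
  their products gives x^(q - 1) = 1.\<close>

lemma power_card: "(x::'a) ^ CARD('a) = x"
proof (cases "x = 0")
  case False
  have "(\<Prod>y\<in>UNIV-{0}. x * y) = (\<Prod>y\<in>UNIV-{0}. y)"
    by (rule prod.reindex_bij_witness[of _ "\<lambda>y. y / x" "\<lambda>y. x * y"]) (use False in auto)
  then have "x ^ (CARD('a) - 1) * (\<Prod>y\<in>UNIV-{0}. y) = (\<Prod>y\<in>UNIV-{0}. y)"
    by (simp add: prod.distrib)
  moreover have "(\<Prod>y\<in>UNIV-{0::'a}. y) \<noteq> 0" by simp
  ultimately have "x ^ (CARD('a) - 1) = 1" by simp
  moreover have "CARD('a) = Suc (CARD('a) - 1)" by simp
  ultimately show ?thesis by (metis mult.right_neutral power_Suc)
qed simp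

lemma frobenius: "(x + y :: 'a) ^ (2 ^ j) = x ^ (2 ^ j) + y ^ (2 ^ j)"
proof (induction j)
  case (Suc j)
  have "(a + b) ^ 2 = a ^ 2 + b ^ 2" for a b :: 'a
    by (simp add: power2_sum two)
  then show ?case using Suc by (simp add: power_mult mult.commute[of 2])
qed simp

lemma frobenius_eq_iff: "(x :: 'a) ^ (2 ^ j) = y ^ (2 ^ j) \<longleftrightarrow> x = y"
  using frobenius[of x y j] by (metis add_eq_0_iff2 power_eq_0_iff zero_less_numeral zero_less_power)

lemma square_eq_iff: "(x :: 'a)\<^sup>2 = y\<^sup>2 \<longleftrightarrow> x = y"
  using frobenius_eq_iff[of x 1 y] by simp

lemma square_sum: "(x + y :: 'a)\<^sup>2 = x\<^sup>2 + y\<^sup>2"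
  using frobenius[of x y 1] by simp

lemma mult_self_eq_1: "(x::'a) * x = 1 \<Longrightarrow> x = 1"
  using square_eq_iff[of x 1] by (simp add: power2_eq_square)

lemma ex_root: "\<exists>y::'a. y ^ (2 ^ j) = x"
proof -
  have "inj (\<lambda>y::'a. y ^ (2 ^ j))" using frobenius_eq_iff by (intro injI) simp
  then have "surj (\<lambda>y::'a. y ^ (2 ^ j))" by (intro finite_UNIV_inj_surj) auto
  then show ?thesis by (metis surjD)
qed

end

section \<open>Projective special linear groups\<close>

lemma mat2_eq_iff: "(A :: 'a^2^2) = B \<longleftrightarrow>
    A$1$1 = B$1$1 \<and> A$1$2 = B$1$2 \<and> A$2$1 = B$2$1 \<and> A$2$2 = B$2$2"
  by (auto simp: vec_eq_iff forall_2)

lemma mat2_mult: "((A :: 'a::field^2^2) ** B) $ i $ j = A$i$1 * B$1$j + A$i$2 * B$2$j"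
  by (simp add: matrix_matrix_mult_def sum_2)

lemma mat2_one: "(mat 1 :: 'a::field^2^2)$1$1 = 1" "(mat 1 :: 'a::field^2^2)$1$2 = 0"
  "(mat 1 :: 'a::field^2^2)$2$1 = 0" "(mat 1 :: 'a::field^2^2)$2$2 = 1"
  by (simp_all add: mat_def)

text \<open>The transvection mapping \<open>w\<close> to \<open>w + form2 v w * v\<close>, in characteristic 2.\<close>

definition transv2 :: "'a::field \<times> 'a \<Rightarrow> 'a^2^2" where
  "transv2 v = vector [vector [1 + fst v * snd v, (fst v)\<^sup>2], vector [(snd v)\<^sup>2, 1 + fst v * snd v]]"

text \<open>The determinant of the two vectors, with the sign dropped in characteristic 2.\<close>

definition form2 :: "'a::field \<times> 'a \<Rightarrow> 'a \<times> 'a \<Rightarrow> 'a" where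
  "form2 v w = fst v * snd w + snd v * fst w"

lemma transv2_nth [simp]:
  "transv2 (a, b) $ 1 $ 1 = 1 + a * b" "transv2 (a, b) $ 1 $ 2 = a\<^sup>2"
  "transv2 (a, b) $ 2 $ 1 = b\<^sup>2" "transv2 (a, b) $ 2 $ 2 = 1 + a * b"
  by (simp_all add: transv2_def)

context char2_field begin

lemmas char2_simps = algebra_simps power2_eq_square

lemma transv2_det: "det (transv2 (v :: 'a \<times> 'a)) = 1"
  by (cases v) (simp add: det_2 algebra_simps power2_eq_square add_eq_0_iff2)

lemma transv2_sq: "transv2 (v :: 'a \<times> 'a) ** transv2 v = mat 1"
proof (cases v)
  case (Pair a b)
  then show ?thesis unfolding Pair mat2_eq_iff mat2_mult mat2_one transv2_nth
    by (simp add: char2_simps)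
qed

lemma transv2_inj: "transv2 v = transv2 w \<longleftrightarrow> v = (w :: 'a \<times> 'a)"
  by (cases v; cases w) (auto simp: mat2_eq_iff square_eq_iff)

lemma transv2_eq_1: "transv2 (v :: 'a \<times> 'a) = mat 1 \<longleftrightarrow> v = (0, 0)"
  by (cases v) (auto simp: mat2_eq_iff mat2_one)

lemma transv2_commute:
  "transv2 v ** transv2 w = transv2 w ** transv2 v \<longleftrightarrow> form2 v (w :: 'a \<times> 'a) = 0"
proof (cases v; cases w)
  fix a b c d :: 'a assume v: "v = (a, b)" and w: "w = (c, d)"
  \<comment> \<open>Comparing the upper left entries of the two products already detects the
    form.\<close>
  have "(transv2 v ** transv2 w) $ 1 $ 1 + (transv2 w ** transv2 v) $ 1 $ 1 = (form2 v w)\<^sup>2"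
    unfolding v w mat2_mult transv2_nth form2_def fst_conv snd_conv by (simp add: char2_simps)
  then have "form2 v w = 0" if "transv2 v ** transv2 w = transv2 w ** transv2 v"
    using that by simp
  moreover have "transv2 v ** transv2 w = transv2 w ** transv2 v" if "form2 v w = 0"
  proof -
    have "a * d = b * c" using that by (simp add: v w form2_def add_eq_0_iff2)
    then have "(a * d)\<^sup>2 = (b * c)\<^sup>2" by simp
    then show ?thesis unfolding v w mat2_eq_iff mat2_mult transv2_nth
      by (simp add: algebra_simps power_mult_distrib)
  qed
  ultimately show ?thesis by blast
qed

text \<open>A map of determinant 1 conjugates the transvection of \<open>w\<close> to that of the
  image of \<open>w\<close>; here the conjugating transvection is its own inverse.\<close>

lemma transv2_conj:
  fixes a b c d :: 'a
  defines "e \<equiv> form2 (a, b) (c, d)"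
  shows "transv2 (a, b) ** transv2 (c, d) ** transv2 (a, b) = transv2 (c + e * a, d + e * b)"
  unfolding mat2_mult transv2_nth form2_def fst_conv snd_conv mat2_eq_iff e_def
  by (simp add: char2_simps)

text \<open>In characteristic 2 the equation forces equal diagonal entries, and the off-diagonal
  entries have unique square roots, which are the coordinates of the vector.\<close>

lemma involution_transv2:
  fixes A :: "'a^2^2"
  assumes "A ** A = mat 1"
  shows "\<exists>v. A = transv2 v"
proof -
  let ?a = "A$1$1" and ?b = "A$1$2" and ?c = "A$2$1" and ?d = "A$2$2"
  have e: "?a * ?a + ?b * ?c = 1" "?c * ?b + ?d * ?d = 1"
    using assms unfolding mat2_eq_iff mat2_mult mat2_one by auto
  have "?a * ?a + ?b * ?c = ?d * ?d + ?b * ?c" using e by (simp add: mult.commute add.commute)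
  then have "?a\<^sup>2 = ?d\<^sup>2" by (simp add: power2_eq_square)
  then have ad: "?a = ?d" by (simp add: square_eq_iff)
  obtain p where p: "p\<^sup>2 = ?b" using ex_root[of 1 ?b] by auto
  obtain r where r: "r\<^sup>2 = ?c" using ex_root[of 1 ?c] by auto
  have "(1 + p * r)\<^sup>2 = 1 + ?b * ?c" by (simp add: square_sum power_mult_distrib p r)
  also have "\<dots> = (?a * ?a + ?b * ?c) + ?b * ?c" using e(1) by simp
  also have "\<dots> = ?a\<^sup>2" by (simp add: char2_simps)
  finally have "(1 + p * r)\<^sup>2 = ?a\<^sup>2" .
  then have "1 + p * r = ?a" by (simp add: square_eq_iff)
  then have "A = transv2 (p, r)" using ad p r unfolding mat2_eq_iff by simp
  then show ?thesis by blast
qed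

lemma fusion_group_SL2:
  assumes "2 \<le> n"
  shows "fusion_group (SL_group :: ('a^2^2) monoid) 3 n (2 ^ n) 1"
proof -
  let ?K = "SL_group :: ('a^2^2) monoid" and ?V = "UNIV - {(0, 0)} :: ('a \<times> 'a) set"
  interpret group ?K by (rule group_SL)
  have K: "mult ?K = (**)" "one ?K = mat 1" "carrier ?K = {A. det A = 1}"
    by (simp_all add: SL_group_def)
  have inv: "transv2 ` ?V = involutions ?K"
  proof (intro equalityI subsetI)
    fix A assume "A \<in> transv2 ` ?V"
    then show "A \<in> involutions ?K" unfolding involutions_iff K
      using transv2_det transv2_sq transv2_eq_1 by auto
  next
    fix A assume "A \<in> involutions ?K"
    then have "A ** A = mat 1" "A \<noteq> mat 1" unfolding involutions_iff K by auto
    then show "A \<in> transv2 ` ?V" using involution_transv2[of A] transv2_eq_1 by blast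
  qed
  have q: "(2::nat) ^ n \<ge> 4" using power_increasing[OF assms, of "2::nat"] by simp
  show ?thesis
  proof (rule fusion_group_modelI[where V = ?V and x = transv2 and f = 1 and \<beta> = form2])
    show "card {w \<in> ?V. transv2 w = transv2 v} = 1" if "v \<in> ?V" for v
    proof -
      have "{w \<in> ?V. transv2 w = transv2 v} = {v}" using that by (auto simp: transv2_inj)
      then show ?thesis by simp
    qed
    show "transv2 v \<otimes>\<^bsub>?K\<^esub> transv2 w = transv2 w \<otimes>\<^bsub>?K\<^esub> transv2 v \<longleftrightarrow> form2 v w = 0" for v w
      unfolding K by (rule transv2_commute)
    show "ord (transv2 v \<otimes>\<^bsub>?K\<^esub> transv2 w) = 3 \<longleftrightarrow> form2 v w = 1"
      if vw: "v \<in> ?V" "w \<in> ?V" for v w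
    proof (cases v; cases w)
      fix a b c d assume v: "v = (a, b)" and w: "w = (c, d)"
      have I: "transv2 v \<in> involutions ?K" "transv2 w \<in> involutions ?K" using inv vw by blast+
      let ?e = "form2 v w"
      have ve: "form2 w v = ?e" by (simp add: form2_def algebra_simps)
      have "ord (transv2 v \<otimes>\<^bsub>?K\<^esub> transv2 w) = 3 \<longleftrightarrow>
          v \<noteq> w \<and> (c + ?e * a, d + ?e * b) = (a + ?e * c, b + ?e * d)"
        unfolding ord_three_iff[OF I] unfolding K transv2_inj
        unfolding v w transv2_conj transv2_inj by (simp add: form2_def algebra_simps)
      \<comment> \<open>The difference of the two image vectors is 1 + e times v + w, and v + w is
        nonzero for distinct vectors.\<close>
      also have "\<dots> \<longleftrightarrow> v \<noteq> w \<and> (1 + ?e) * (a + c) = 0 \<and> (1 + ?e) * (b + d) = 0"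
      proof -
        have "c + ?e * a = a + ?e * c \<longleftrightarrow> (1 + ?e) * (a + c) = 0"
          unfolding add_eq_0_iff2[symmetric, of "c + ?e * a"] by (simp add: algebra_simps)
        moreover have "d + ?e * b = b + ?e * d \<longleftrightarrow> (1 + ?e) * (b + d) = 0"
          unfolding add_eq_0_iff2[symmetric, of "d + ?e * b"] by (simp add: algebra_simps)
        ultimately show ?thesis by simp
      qed
      also have "\<dots> \<longleftrightarrow> v \<noteq> w \<and> ?e = 1"
        by (auto simp: add_eq_0_iff2 v w)
      also have "\<dots> \<longleftrightarrow> ?e = 1" by (auto simp: form2_def algebra_simps)
      finally show ?thesis .
    qed
    show "form2 u w = 0" if "u \<in> ?V" "v \<in> ?V" "w \<in> ?V" "form2 u v = 0" "form2 v w = 0" for u v w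
    proof -
      obtain a b c d e f where uvw: "u = (a, b)" "v = (c, d)" "w = (e, f)" by (metis surj_pair)
      have "a * d + b * c = 0" "c * f + d * e = 0" using that by (simp_all add: uvw form2_def)
      \<comment> \<open>The coordinates of the linear relation between three vectors of the plane:
        B(u, w) v = B(v, w) u + B(u, v) w.\<close>
      moreover have "c * (a * f + b * e) = a * (c * f + d * e) + e * (a * d + b * c)"
        "d * (a * f + b * e) = f * (a * d + b * c) + b * (c * f + d * e)"
        by (simp_all add: char2_simps)
      ultimately have "c * (a * f + b * e) = 0" "d * (a * f + b * e) = 0" by simp_all
      then show ?thesis using that(2) by (auto simp: uvw form2_def)
    qed
    have cV: "card ?V = (2 ^ n) * 2 ^ n - 1" by (simp add: card_Diff_subset card_field)
    show "card ?V = 1 * ((2 ^ n + 1) * (2 ^ n - 1))" unfolding cV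
      by (simp add: algebra_simps diff_mult_distrib2)
    show "card {w \<in> ?V. form2 v w = 0} = 1 * (2 ^ n - 1)" if "v \<in> ?V" for v
    proof -
      obtain a b where v: "v = (a, b)" by (metis surj_pair)
      have nz: "a \<noteq> 0 \<or> b \<noteq> 0" using that v by auto
      have "bij_betw (\<lambda>l. (l * a, l * b)) (UNIV - {0}) {w \<in> ?V. form2 v w = 0}"
      proof (rule bij_betw_imageI)
        show "inj_on (\<lambda>l. (l * a, l * b)) (UNIV - {0})" using nz by (auto simp: inj_on_def)
        show "(\<lambda>l. (l * a, l * b)) ` (UNIV - {0}) = {w \<in> ?V. form2 v w = 0}"
        proof (intro equalityI subsetI)
          fix w assume "w \<in> (\<lambda>l. (l * a, l * b)) ` (UNIV - {0})"
          then show "w \<in> {w \<in> ?V. form2 v w = 0}" using nz by (auto simp: form2_def v algebra_simps)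
        next
          fix w assume w: "w \<in> {w \<in> ?V. form2 v w = 0}"
          obtain c d where cd: "w = (c, d)" by (metis surj_pair)
          have z: "a * d = b * c" using w by (simp add: cd v form2_def add_eq_0_iff2)
          define l where "l = (if a = 0 then d / b else c / a)"
          have "w = (l * a, l * b)" using z nz by (auto simp: l_def cd field_simps)
          moreover have "l \<noteq> 0" using w \<open>w = (l * a, l * b)\<close> by auto
          ultimately show "w \<in> (\<lambda>l. (l * a, l * b)) ` (UNIV - {0})" by blast
        qed
      qed
      then have "card {w \<in> ?V. form2 v w = 0} = card (UNIV - {0::'a})" by (simp add: bij_betw_same_card)
      then show ?thesis by (simp add: card_Diff_subset card_field)
    qed
    show "\<exists>u\<in>?V. form2 w u = 0 \<and> form2 v u = 1" if "v \<in> ?V" "w \<in> ?V" "form2 v w \<noteq> 0" for v w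
    proof
      let ?u = "(fst w / form2 v w, snd w / form2 v w)"
      show "form2 w ?u = 0 \<and> form2 v ?u = 1" using that(3) 
        by (simp add: form2_def algebra_simps add_divide_distrib[symmetric])
      show "?u \<in> ?V" using that(2,3) by (cases w) auto
    qed
    show "transv2 v = transv2 w"
      if "u \<in> ?V" "v \<in> ?V" "w \<in> ?V" "form2 v w = 0" "form2 u v = 1" "form2 u w = 1" for u v w
    proof -
      obtain a b c d e f where uvw: "u = (a, b)" "v = (c, d)" "w = (e, f)" by (metis surj_pair)
      have z: "c * f + d * e = 0" "a * d + b * c = 1" "a * f + b * e = 1" using that by (simp_all add: uvw form2_def)
      \<comment> \<open>The same plane relation; with B(u, v) = B(u, w) = 1 and B(v, w) = 0 it reads
        v + w = 0.\<close>
      have "c * (a * f + b * e) + e * (a * d + b * c) = a * (c * f + d * e)"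
        "d * (a * f + b * e) + f * (a * d + b * c) = b * (c * f + d * e)"
        by (simp_all add: char2_simps)
      then have "c = e" "d = f" unfolding z by (simp_all add: add_eq_0_iff2)
      then show ?thesis by (simp add: uvw)
    qed
    show "card {u \<in> ?V. form2 v u = 1 \<and> form2 w u = 1} = 1 * 1"
      if "v \<in> ?V" "w \<in> ?V" and nz: "form2 v w \<noteq> 0" for v w
    proof -
      obtain a b c d where vw: "v = (a, b)" "w = (c, d)" by (metis surj_pair)
      let ?D = "a * d + b * c"
      have D: "?D \<noteq> 0" using nz by (simp add: vw form2_def)
      \<comment> \<open>By Cramer's rule the two linear conditions have the unique solution (v + w)
        / B(v, w).\<close>
      have "{u \<in> ?V. form2 v u = 1 \<and> form2 w u = 1} = {((a + c) / ?D, (b + d) / ?D)}"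
      proof (intro equalityI subsetI)
        fix u assume u: "u \<in> {u \<in> ?V. form2 v u = 1 \<and> form2 w u = 1}"
        obtain x y where xy: "u = (x, y)" by (metis surj_pair)
        have z: "a * y + b * x = 1" "c * y + d * x = 1" using u by (simp_all add: vw xy form2_def)
        have "x * ?D = (c * y + d * x) * a + (a * y + b * x) * c"
          "y * ?D = (c * y + d * x) * b + (a * y + b * x) * d"
          by (simp_all add: char2_simps)
        then have "x * ?D = a + c" "y * ?D = b + d" by (simp_all add: z)
        then show "u \<in> {((a + c) / ?D, (b + d) / ?D)}" using D by (simp add: xy field_simps)
      next
        fix u assume u: "u \<in> {((a + c) / ?D, (b + d) / ?D)}"
        have "a * (b + d) + b * (a + c) = ?D" "c * (b + d) + d * (a + c) = ?D" by (simp_all add: char2_simps)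
        then have "form2 v u = 1" "form2 w u = 1" using u D
          by (simp_all add: vw form2_def add_divide_distrib[symmetric])
        then show "u \<in> {u \<in> ?V. form2 v u = 1 \<and> form2 w u = 1}" by (auto simp: form2_def)
      qed
      then show ?thesis by simp
    qed
  qed (use assms inv in simp_all)
qed

theorem fusion_group_PSL2:
  assumes "2 \<le> n"
  shows "fusion_group (PSL2 :: ('a^2^2) set monoid) 3 n (2 ^ n) 1"
  unfolding PSL2_def SL_group_def
  by (rule fusion_group_projective[OF fusion_group_SL2[OF assms, unfolded SL_group_def] mult_self_eq_1])

end

section \<open>Suzuki groups\<close>

lemma vector_4 [simp]:
  "(vector [a, b, c, d] :: 'a::zero^4) $ 1 = a" "(vector [a, b, c, d] :: 'a^4) $ 2 = b"
  "(vector [a, b, c, d] :: 'a^4) $ 3 = c" "(vector [a, b, c, d] :: 'a^4) $ 4 = d"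
  unfolding vector_def by simp_all

lemma vec4_eq_iff: "(v :: 'a^4) = w \<longleftrightarrow> v$1 = w$1 \<and> v$2 = w$2 \<and> v$3 = w$3 \<and> v$4 = w$4"
  by (auto simp: vec_eq_iff forall_4)

lemma mat4_vec: "((A :: 'a::field^4^4) *v w) $ i = A$i$1 * w$1 + A$i$2 * w$2 + A$i$3 * w$3 + A$i$4 * w$4"
  by (simp add: matrix_vector_mult_def sum_4)

lemma mat4_mult: "((A :: 'a::field^4^4) ** B) $ i $ j = A$i$1 * B$1$j + A$i$2 * B$2$j + A$i$3 * B$3$j + A$i$4 * B$4$j"
  by (simp add: matrix_matrix_mult_def sum_4)

lemma trace4: "trace (A :: 'a::field^4^4) = A$1$1 + A$2$2 + A$3$3 + A$4$4"
  by (simp add: trace_def sum_4)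

text \<open>In characteristic 2 this form is alternating, so its isometries form a symplectic group;
  the Suzuki generators will be seen to preserve it.\<close>

definition form4 :: "'a::field^4 \<Rightarrow> 'a^4 \<Rightarrow> 'a" where
  "form4 v w = v$1 * w$4 + v$2 * w$3 + v$3 * w$2 + v$4 * w$1"

lemma form4_scale [simp]: "form4 (c *s v) w = c * form4 v w" "form4 v (c *s w) = c * form4 v w"
  by (simp_all add: form4_def algebra_simps)

text \<open>The off-diagonal contributions to the trace of the square come in equal pairs and
  cancel.\<close>

lemma (in char2_field) trace_sq4: "trace (A ** A) = (trace (A :: 'a^4^4))\<^sup>2"
  unfolding trace4 mat4_mult square_sum by (simp add: char2_simps)

locale suzuki_field = char2_field ty n for ty :: "'a::{field,finite} itself" and n +
  fixes m :: nat
  assumes n_eq: "n = 2 * m + 1" and m_pos: "1 \<le> m"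
begin

abbreviation \<theta> :: "'a \<Rightarrow> 'a" where "\<theta> \<equiv> suzuki_theta m"
definition \<kappa> :: "'a \<Rightarrow> 'a" where "\<kappa> x = x ^ (2 ^ m)"

lemma theta_add [simp]: "\<theta> (x + y) = \<theta> x + \<theta> y"
  unfolding suzuki_theta_def by (rule frobenius)

lemma theta_mult [simp]: "\<theta> (x * y) = \<theta> x * \<theta> y"
  by (simp add: suzuki_theta_def power_mult_distrib)

lemma theta_simps [simp]: "\<theta> 0 = 0" "\<theta> 1 = 1"
  by (simp_all add: suzuki_theta_def)

lemma theta_eq_iff [simp]: "\<theta> x = \<theta> y \<longleftrightarrow> x = y"
  by (simp add: suzuki_theta_def frobenius_eq_iff del: power_Suc)

lemma theta_eq_0 [simp]: "\<theta> x = 0 \<longleftrightarrow> x = 0"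
  using theta_eq_iff[of x 0] by (simp del: theta_eq_iff)

lemma theta_eq_1 [simp]: "\<theta> x = 1 \<longleftrightarrow> x = 1"
  using theta_eq_iff[of x 1] by (simp del: theta_eq_iff)

lemma theta_inverse [simp]: "\<theta> (inverse x) = inverse (\<theta> x)"
  by (simp add: suzuki_theta_def power_inverse)

lemma theta_divide [simp]: "\<theta> (x / y) = \<theta> x / \<theta> y"
  by (simp add: divide_inverse)

lemma theta_power [simp]: "\<theta> (x ^ j) = \<theta> x ^ j"
  by (simp add: suzuki_theta_def power_mult[symmetric] mult.commute)

lemma theta_kappa [simp]: "\<theta> (\<kappa> x) = x" "\<kappa> (\<theta> x) = x"
proof -
  have e: "(2::nat) ^ m * 2 ^ (m + 1) = CARD('a)"
    unfolding card_field n_eq power_add[symmetric] by (simp add: mult_2)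
  show "\<theta> (\<kappa> x) = x" "\<kappa> (\<theta> x) = x"
    unfolding suzuki_theta_def \<kappa>_def power_mult[symmetric] e mult.commute[of "2 ^ (m + 1)"] by (rule power_card)+
qed

lemma theta_theta [simp]: "\<theta> (\<theta> x) = x\<^sup>2"
proof -
  have e: "(2::nat) ^ (m + 1) * 2 ^ (m + 1) = CARD('a) * 2"
    unfolding card_field n_eq power_add[symmetric] by (simp add: mult_2)
  show ?thesis unfolding suzuki_theta_def power_mult[symmetric] e
    by (simp only: power_mult power_card)
qed

text \<open>A fixed element of \<open>\<theta>\<close> is also fixed by its square, the Frobenius
  map, and so lies in the prime field.\<close>

lemma theta_fixed: "\<theta> x = x \<longleftrightarrow> x = 0 \<or> x = 1"
proof
  assume "\<theta> x = x"
  then have "x\<^sup>2 = x" using theta_theta[of x] by simp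
  then show "x = 0 \<or> x = 1" by (simp add: power2_eq_square)
qed auto

lemma theta_eq_square: "\<theta> x = x\<^sup>2 \<longleftrightarrow> x = 0 \<or> x = 1"
  unfolding theta_theta[symmetric] theta_eq_iff using theta_fixed[of x] by metis

lemma ex_not_01: "\<exists>x::'a. x \<noteq> 0 \<and> x \<noteq> 1"
proof (rule ccontr)
  assume "\<not> ?thesis"
  then have "UNIV \<subseteq> {0, 1::'a}" by auto
  then have "CARD('a) \<le> 2" using card_mono[of "{0, 1::'a}" UNIV] by simp
  moreover have "CARD('a) = 2 * 4 ^ m" by (simp add: card_field n_eq power_mult)
  moreover have "(4::nat) ^ 1 \<le> 4 ^ m" using m_pos by (intro power_increasing) auto
  ultimately show False by simp
qed

text \<open>As \<open>n\<close> is odd, the order of the field is congruent to 2 modulo 3, so x^3 =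
  1 turns x = x^q into x = x^2.\<close>

lemma cube_eq_1: "(x::'a) ^ 3 = 1 \<longleftrightarrow> x = 1"
proof
  assume x: "x ^ 3 = 1"
  have "(2::nat) ^ n mod 3 = 2" unfolding n_eq
    by (simp add: power_mult mod_mult_right_eq[symmetric] power_mod[of 4 3, symmetric])
  then have "CARD('a) = 3 * (2 ^ n div 3) + 2" unfolding card_field by presburger
  then have "x = x ^ (3 * (2 ^ n div 3) + 2)" using power_card[of x] by metis
  also have "\<dots> = x\<^sup>2" by (simp only: power_add power_mult x power_one mult_1)
  finally show "x = 1" using x by (auto simp: power2_eq_square)
qed simp

text \<open>The last coordinate of the affine point (1, x, y, z) of the Suzuki-Tits ovoid; the same
  expression is the lower left entry of \<open>suzuki_unipotent m x y\<close>.\<close>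

definition ovoid :: "'a \<Rightarrow> 'a \<Rightarrow> 'a" where
  "ovoid x y = x\<^sup>2 * \<theta> x + x * y + \<theta> y"

text \<open>With \<open>k = x * \<theta> x\<close> one has \<open>x = \<theta> k / k\<close>, which straightens the second argument.\<close>

lemma ovoid_straighten: "ovoid x (x * \<theta> x * z) = x\<^sup>2 * \<theta> x * (\<theta> z + z + 1)"
  by (simp add: ovoid_def char2_simps)

text \<open>Applying \<open>\<theta>\<close> twice to such a \<open>z\<close> would give
  \<open>z\<close> back, so \<open>z\<close> would be 0 or 1; but these are fixed by
  \<open>\<theta>\<close>.\<close>

lemma theta_add_self_neq_1: "\<theta> z + z + 1 \<noteq> 0"
proof
  assume a: "\<theta> z + z + 1 = 0"
  then have e: "\<theta> z = z + 1" by (simp add: add.assoc add_eq_0_iff2)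
  then have "\<theta> (\<theta> z) = z" by (simp add: two)
  then have "z = 0 \<or> z = 1" by (simp add: power2_eq_square)
  then show False using e by auto
qed

lemma ovoid_eq_0: "ovoid x y = 0 \<longleftrightarrow> x = 0 \<and> y = 0"
proof (cases "x = 0")
  case False
  define z where "z = y / (x * \<theta> x)"
  have "y = x * \<theta> x * z" using False by (simp add: z_def)
  then have "ovoid x y = x\<^sup>2 * \<theta> x * (\<theta> z + z + 1)" using ovoid_straighten[of x z] by simp
  then show ?thesis using False theta_add_self_neq_1[of z] by simp
qed (simp add: ovoid_def)

text \<open>The left side is \<open>\<theta> (x * \<theta> x)\<close>, so applying the inverse
  \<open>\<kappa>\<close> of \<open>\<theta>\<close> recovers \<open>x * \<theta> x\<close>, and
  dividing \<open>t\<close> by this leaves \<open>x\<close>.\<close>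

lemma square_theta_eq_iff:
  assumes "t \<noteq> 0" shows "x\<^sup>2 * \<theta> x = t \<longleftrightarrow> x = t / \<kappa> t"
proof
  assume x: "x\<^sup>2 * \<theta> x = t"
  then have "\<theta> (x * \<theta> x) = t" by (simp add: mult.commute)
  then have "\<kappa> t = x * \<theta> x" using theta_kappa(2) by metis
  then show "x = t / \<kappa> t" using x assms by (auto simp: field_simps power2_eq_square)
next
  assume x: "x = t / \<kappa> t"
  have k: "\<kappa> t \<noteq> 0" using assms theta_kappa(1)[of t] theta_eq_0 by metis
  have "\<theta> t = (\<kappa> t)\<^sup>2" using theta_theta[of "\<kappa> t"] by simp
  then have "\<theta> x = (\<kappa> t)\<^sup>2 / t" by (simp add: x)
  then show "x\<^sup>2 * \<theta> x = t" using k assms by (simp add: x field_simps power2_eq_square)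
qed

text \<open>After straightening, each \<open>z\<close> determines \<open>x\<close> uniquely, as x^2
  \<open>\<theta> x\<close> is an invertible expression. This gives as many solutions as field
  elements; the extra one has \<open>x = 0\<close>.\<close>

lemma card_ovoid_level:
  assumes c: "c \<noteq> 0"
  shows "card {(x, y). ovoid x y = c} = 2 ^ n + 1"
proof -
  define X where "X z = (c / (\<theta> z + z + 1)) / \<kappa> (c / (\<theta> z + z + 1))" for z
  have X: "(X z)\<^sup>2 * \<theta> (X z) = c / (\<theta> z + z + 1)" for z
    using square_theta_eq_iff[of "c / (\<theta> z + z + 1)" "X z"] c theta_add_self_neq_1[of z] by (simp add: X_def)
  have X0: "X z \<noteq> 0" for z using X[of z] c theta_add_self_neq_1[of z] by auto
  define h where "h z = (X z, X z * \<theta> (X z) * z)" for z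
  have "{(x, y). ovoid x y = c} = insert (0, \<kappa> c) (range h)"
  proof (intro equalityI subsetI)
    fix p assume "p \<in> {(x, y). ovoid x y = c}"
    then obtain x y where p: "p = (x, y)" "ovoid x y = c" by auto
    show "p \<in> insert (0, \<kappa> c) (range h)"
    proof (cases "x = 0")
      case True
      then have "\<theta> y = c" using p by (simp add: ovoid_def)
      then show ?thesis using p True by auto
    next
      case False
      define z where "z = y / (x * \<theta> x)"
      have y: "y = x * \<theta> x * z" using False by (simp add: z_def)
      have "x\<^sup>2 * \<theta> x * (\<theta> z + z + 1) = c" using p(2) unfolding y ovoid_straighten .
      then have "x\<^sup>2 * \<theta> x = c / (\<theta> z + z + 1)" using theta_add_self_neq_1[of z] by (simp add: field_simps)
      then have "x = X z" using square_theta_eq_iff[of "c / (\<theta> z + z + 1)" x] c theta_add_self_neq_1[of z]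
        by (simp add: X_def)
      then show ?thesis using y p(1) by (auto simp: h_def)
    qed
  next
    fix p assume "p \<in> insert (0, \<kappa> c) (range h)"
    then consider "p = (0, \<kappa> c)" | z where "p = h z" by auto
    then show "p \<in> {(x, y). ovoid x y = c}"
    proof cases
      case 1 then show ?thesis by (simp add: ovoid_def)
    next
      case 2 then show ?thesis using X[of z] theta_add_self_neq_1[of z] by (simp add: h_def ovoid_straighten)
    qed
  qed
  moreover have "inj h" using X0 by (auto simp: h_def inj_on_def)
  then have "card (range h) = 2 ^ n" using card_image[of h UNIV] card_field by simp
  moreover have "(0, \<kappa> c) \<notin> range h" using X0 by (auto simp: h_def)
  ultimately show ?thesis by simp
qed

end

section \<open>The cone over the Suzuki-Tits ovoid and the stabiliser of one of its vectors\<close>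

context suzuki_field begin

abbreviation u :: "'a \<Rightarrow> 'a \<Rightarrow> 'a^4^4" where "u \<equiv> suzuki_unipotent m"
abbreviation w0 :: "'a^4^4" where "w0 \<equiv> suzuki_flip"
text \<open>With the parameter \<open>\<theta> k\<close> the diagonal entries become
  \<open>k * \<theta> k\<close>, \<open>k\<close> and their inverses, free of roots.\<close>

abbreviation D :: "'a \<Rightarrow> 'a^4^4" where "D k \<equiv> suzuki_diag m (\<theta> k)"
abbreviation e1 :: "'a^4" where "e1 \<equiv> vector [1, 0, 0, 0]"
abbreviation e4 :: "'a^4" where "e4 \<equiv> vector [0, 0, 0, 1]"

lemma u_nth [simp]:
  "u a b $ 1 = vector [1, 0, 0, 0]" "u a b $ 2 = vector [a, 1, 0, 0]"
  "u a b $ 3 = vector [b, \<theta> a, 1, 0]" "u a b $ 4 = vector [ovoid a b, a * \<theta> a + b, a, 1]"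
  by (simp_all add: suzuki_unipotent_def Let_def ovoid_def)

lemma D_nth [simp]:
  "D k $ 1 = vector [k * \<theta> k, 0, 0, 0]" "D k $ 2 = vector [0, k, 0, 0]"
  "D k $ 3 = vector [0, 0, inverse k, 0]" "D k $ 4 = vector [0, 0, 0, inverse (k * \<theta> k)]"
  using theta_kappa(2)[of k]
  by (simp_all add: suzuki_diag_def Let_def \<kappa>_def power_add mult.commute)

lemma w0_nth [simp]:
  "w0 $ 1 = vector [0, 0, 0, 1]" "w0 $ 2 = vector [0, 0, 1, 0]"
  "w0 $ 3 = vector [0, 1, 0, 0]" "w0 $ 4 = vector [1, 0, 0, 0]"
  by (simp_all add: suzuki_flip_def)

lemma mat1_nth [simp]:
  "(mat 1 :: 'a^4^4) $ 1 = vector [1, 0, 0, 0]" "(mat 1 :: 'a^4^4) $ 2 = vector [0, 1, 0, 0]"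
  "(mat 1 :: 'a^4^4) $ 3 = vector [0, 0, 1, 0]" "(mat 1 :: 'a^4^4) $ 4 = vector [0, 0, 0, 1]"
  by (simp_all add: vec4_eq_iff mat_def)

lemma u_mult: "u a b ** u c d = u (a + c) (b + d + \<theta> a * c)"
  by (simp add: vec4_eq_iff mat4_mult ovoid_def char2_simps)

lemma u_0: "u 0 0 = mat 1"
  by (simp add: vec4_eq_iff ovoid_def)

lemma u_inv: "u a b ** u a (b + a * \<theta> a) = mat 1" "u a (b + a * \<theta> a) ** u a b = mat 1"
  unfolding u_mult by (simp_all add: u_0 algebra_simps)

lemma w0_w0: "w0 ** w0 = mat 1"
  by (simp add: vec4_eq_iff mat4_mult)

lemma D_inv: "k \<noteq> 0 \<Longrightarrow> D k ** D (inverse k) = mat 1"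
  by (simp add: vec4_eq_iff mat4_mult del: theta_inverse) (simp add: field_simps)

lemma D_u: "k \<noteq> 0 \<Longrightarrow> D k ** u 0 b = u 0 (b / (k\<^sup>2 * \<theta> k)) ** D k"
  by (simp add: vec4_eq_iff mat4_mult ovoid_def field_simps power2_eq_square)

lemma u_vec: "u a b *v vector [w, x, y, z] =
    vector [w, a * w + x, b * w + \<theta> a * x + y, ovoid a b * w + (a * \<theta> a + b) * x + a * y + z]"
  by (simp add: vec4_eq_iff mat4_vec)

lemma D_vec: "D k *v vector [w, x, y, z] = vector [k * \<theta> k * w, k * x, y / k, z / (k * \<theta> k)]"
  by (simp add: vec4_eq_iff mat4_vec field_simps)

lemma w0_vec: "w0 *v vector [w, x, y, z] = vector [z, y, x, w]"
  by (simp add: vec4_eq_iff mat4_vec)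

lemma scale_vec: "c *s vector [w, x, y, z] = (vector [c * w, c * x, c * y, c * z] :: 'a^4)"
  by (simp add: vec4_eq_iff)

text \<open>Vectors instead of projective points: the point will stand for a commuting class and the
  scalar for an involution in it.\<close>

definition ovoid_cone :: "('a^4) set" where
  "ovoid_cone = {l *s vector [1, x, y, ovoid x y] | l x y. l \<noteq> 0} \<union> {l *s e4 | l. l \<noteq> 0}"

lemma cone_cases:
  assumes "v \<in> ovoid_cone"
  obtains (finite_point) l x y where "l \<noteq> 0" "v = l *s vector [1, x, y, ovoid x y]"
  | (infinite_point) l where "l \<noteq> 0" "v = l *s e4"
  using assms unfolding ovoid_cone_def by blast

lemma cone_scale:
  assumes "v \<in> ovoid_cone" "l \<noteq> 0" shows "l *s v \<in> ovoid_cone"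
proof -
  have s: "l *s (k *s v) = (l * k) *s v" for k and v :: "'a^4" by (simp add: vec_eq_iff mult.assoc)
  from assms(1) show ?thesis
  proof (cases rule: cone_cases)
    case (finite_point k x y)
    then show ?thesis unfolding ovoid_cone_def s using assms(2)
      by (intro UnI1 CollectI exI[of _ "l * k"] exI[of _ x] exI[of _ y]) (simp add: s)
  next
    case (infinite_point k)
    then show ?thesis unfolding ovoid_cone_def s using assms(2)
      by (intro UnI2 CollectI exI[of _ "l * k"]) (simp add: s)
  qed
qed

lemma coneI: "vector [1, x, y, ovoid x y] \<in> ovoid_cone" "e4 \<in> ovoid_cone"
proof -
  have one: "v = 1 *s v" for v :: "'a^4" by (simp add: vec_eq_iff)
  show "vector [1, x, y, ovoid x y] \<in> ovoid_cone" unfolding ovoid_cone_def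
    by (intro UnI1 CollectI exI[of _ 1] exI[of _ x] exI[of _ y] conjI one zero_neq_one[symmetric])
  show "e4 \<in> ovoid_cone" unfolding ovoid_cone_def
    by (intro UnI2 CollectI exI[of _ 1] conjI one zero_neq_one[symmetric])
qed

lemma e1_cone: "e1 \<in> ovoid_cone"
  using coneI(1)[of 0 0] by (simp add: ovoid_def)

lemma cone_maps_to_if:
  assumes "\<And>x y. g *v vector [1, x, y, ovoid x y] \<in> ovoid_cone" "g *v e4 \<in> ovoid_cone" "v \<in> ovoid_cone"
  shows "g *v v \<in> ovoid_cone"
  using assms(3) by (cases rule: cone_cases) (use assms(1,2) cone_scale in \<open>simp_all add: vector_scalar_commute\<close>)

lemma u_cone:
  assumes "v \<in> ovoid_cone" shows "u a b *v v \<in> ovoid_cone"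
proof (rule cone_maps_to_if[OF _ _ assms])
  show "u a b *v vector [1, x, y, ovoid x y] \<in> ovoid_cone" for x y
  proof -
    \<comment> \<open>The parameters on the right are those of \<open>u_mult\<close>: on affine
      points the unipotent matrices act as their group does on itself by left
      multiplication.\<close>
    have "ovoid a b * 1 + (a * \<theta> a + b) * x + a * y + ovoid x y = ovoid (a + x) (b + \<theta> a * x + y)"
      by (simp add: ovoid_def char2_simps)
    then show ?thesis unfolding u_vec using coneI(1)[of "a + x" "b + \<theta> a * x + y"] by simp
  qed
  show "u a b *v e4 \<in> ovoid_cone" unfolding u_vec using coneI(2) by simp
qed

lemma D_cone:
  assumes "v \<in> ovoid_cone" "k \<noteq> 0" shows "D k *v v \<in> ovoid_cone"
proof (rule cone_maps_to_if[OF _ _ assms(1)])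
  show "D k *v vector [1, x, y, ovoid x y] \<in> ovoid_cone" for x y
  proof -
    let ?x = "x / \<theta> k" and ?y = "y / (k\<^sup>2 * \<theta> k)"
    have o: "ovoid ?x ?y = ovoid x y / (k * \<theta> k)\<^sup>2"
      using assms(2) by (simp add: ovoid_def field_simps power2_eq_square)
    have "D k *v vector [1, x, y, ovoid x y] = (k * \<theta> k) *s vector [1, ?x, ?y, ovoid ?x ?y]"
      unfolding D_vec scale_vec o using assms(2) by (simp add: vec4_eq_iff field_simps power2_eq_square)
    then show ?thesis using cone_scale[OF coneI(1)] assms(2) by simp
  qed
  show "D k *v e4 \<in> ovoid_cone"
  proof -
    have "D k *v e4 = inverse (k * \<theta> k) *s e4" unfolding D_vec scale_vec by (simp add: divide_inverse)
    then show ?thesis using cone_scale[OF coneI(2)] assms(2) by simp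
  qed
qed

text \<open>The flip takes (1, x, y, z) to (z, y, x, 1). The identity says that this vector,
  rescaled to first coordinate 1, is again an affine ovoid point.\<close>

lemma ovoid_flip:
  assumes "ovoid x y \<noteq> 0"
  shows "ovoid (y / ovoid x y) (x / ovoid x y) = 1 / ovoid x y"
proof -
  let ?z = "ovoid x y"
  have t: "\<theta> ?z = x\<^sup>2 * (\<theta> x)\<^sup>2 + \<theta> x * \<theta> y + y\<^sup>2" by (simp add: ovoid_def algebra_simps)
  have tz: "\<theta> ?z \<noteq> 0" using assms by simp
  have "y\<^sup>2 * \<theta> y + x * y * \<theta> ?z + ?z\<^sup>2 * \<theta> x = ?z * \<theta> ?z"
    unfolding t ovoid_def by (simp add: char2_simps)
  then have "(y\<^sup>2 * \<theta> y + x * y * \<theta> ?z + ?z\<^sup>2 * \<theta> x) / (?z\<^sup>2 * \<theta> ?z) = 1 / ?z"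
    using assms tz by (simp add: power2_eq_square)
  moreover have "ovoid (y / ?z) (x / ?z) = (y\<^sup>2 * \<theta> y + x * y * \<theta> ?z + ?z\<^sup>2 * \<theta> x) / (?z\<^sup>2 * \<theta> ?z)"
    unfolding ovoid_def[of "y / ?z"] theta_divide using assms tz by (simp add: field_simps power2_eq_square)
  ultimately show ?thesis by simp
qed

lemma w0_cone:
  assumes "v \<in> ovoid_cone" shows "w0 *v v \<in> ovoid_cone"
proof (rule cone_maps_to_if[OF _ _ assms])
  show "w0 *v vector [1, x, y, ovoid x y] \<in> ovoid_cone" for x y
  proof (cases "ovoid x y = 0")
    case True
    then have "x = 0 \<and> y = 0" by (simp add: ovoid_eq_0)
    then show ?thesis unfolding w0_vec using coneI(2) True by simp
  next
    case False
    let ?z = "ovoid x y"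
    have "w0 *v vector [1, x, y, ?z] = ?z *s vector [1, y / ?z, x / ?z, ovoid (y / ?z) (x / ?z)]"
      unfolding w0_vec scale_vec ovoid_flip[OF False] using False by simp
    then show ?thesis using cone_scale[OF coneI(1) False] by simp
  qed
  show "w0 *v e4 \<in> ovoid_cone" unfolding w0_vec using e1_cone by simp
qed

text \<open>An overgroup of the Suzuki group described by invariants instead of generators, so that
  membership gives usable equations while containment has to be checked on generators only.\<close>

definition isometries :: "('a^4^4) set" where
  "isometries = {g. invertible g \<and> (\<forall>v w. form4 (g *v v) (g *v w) = form4 v w) \<and> (\<forall>v\<in>ovoid_cone. g *v v \<in> ovoid_cone)}"

lemma u_isometry: "u a b \<in> isometries"
  unfolding isometries_def
proof (intro CollectI conjI allI ballI)
  show "invertible (u a b)" unfolding invertible_def using u_inv by blast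
  show "form4 (u a b *v v) (u a b *v w) = form4 v w" for v w
    by (simp add: form4_def mat4_vec ovoid_def char2_simps)
qed (rule u_cone)

lemma D_isometry: "k \<noteq> 0 \<Longrightarrow> D k \<in> isometries"
  unfolding isometries_def
proof (intro CollectI conjI allI ballI)
  assume k: "k \<noteq> 0"
  show "invertible (D k)" unfolding invertible_def 
    using D_inv[OF k] D_inv[of "inverse k"] k by (simp del: theta_inverse) blast
  show "form4 (D k *v v) (D k *v w) = form4 v w" for v w
    using k by (simp add: form4_def mat4_vec field_simps)
qed (rule D_cone)

lemma w0_isometry: "w0 \<in> isometries"
  unfolding isometries_def
proof (intro CollectI conjI allI ballI)
  show "invertible w0" unfolding invertible_def using w0_w0 by blast
  show "form4 (w0 *v v) (w0 *v w) = form4 v w" for v w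
    by (simp add: form4_def mat4_vec algebra_simps)
qed (rule w0_cone)

lemma isometries_subgroup: "subgroup isometries GL_group"
proof -
  interpret group "GL_group :: ('a^4^4) monoid" by (rule group_GL)
  show ?thesis
  proof (rule subgroupI)
    show "isometries \<subseteq> carrier GL_group" by (auto simp: isometries_def GL_group_def)
    show "isometries \<noteq> {}" using w0_isometry by blast
    fix g :: "'a^4^4" assume g: "g \<in> isometries"
    then have gc: "g \<in> carrier GL_group" by (auto simp: isometries_def GL_group_def)
    let ?h = "inv\<^bsub>GL_group\<^esub> g"
    have gh: "g ** ?h = mat 1" "?h ** g = mat 1" using r_inv[OF gc] l_inv[OF gc] by (simp_all add: GL_group_def)
    have c1: "g *v (?h *v v) = v" and c2: "?h *v (g *v v) = v" for v
      by (simp_all add: matrix_vector_mul_assoc gh)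
    show "?h \<in> isometries" unfolding isometries_def
    proof (intro CollectI conjI allI ballI)
      show "invertible ?h" unfolding invertible_def using gh by blast
      show "form4 (?h *v v) (?h *v w) = form4 v w" for v w
      proof -
        have "form4 (g *v (?h *v v)) (g *v (?h *v w)) = form4 (?h *v v) (?h *v w)"
          using g by (simp add: isometries_def)
        then show ?thesis by (simp only: c1)
      qed
      fix v assume v: "v \<in> ovoid_cone"
      have "inj_on ((*v) g) ovoid_cone" by (rule inj_on_inverseI[where g = "(*v) ?h"]) (rule c2)
      moreover have "(*v) g ` ovoid_cone \<subseteq> ovoid_cone" using g by (auto simp: isometries_def)
      ultimately have "(*v) g ` ovoid_cone = ovoid_cone" by (intro endo_inj_surj) auto
      then obtain w where "w \<in> ovoid_cone" "v = g *v w" using v by blast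
      then show "?h *v v \<in> ovoid_cone" by (simp only: c2)
    qed
    fix h :: "'a^4^4" assume h: "h \<in> isometries"
    show "g \<otimes>\<^bsub>GL_group\<^esub> h \<in> isometries"
      using g h unfolding isometries_def GL_group_def
      by (simp add: invertible_mult matrix_vector_mul_assoc[symmetric])
  qed
qed

text \<open>For \<open>x = 0\<close>, comparing \<open>y\<close> with \<open>y + 1\<close> shows that the coefficient \<open>E\<close> of the only
  non-additive term \<open>y\<^sup>2 * \<theta> y\<close> vanishes.\<close>

lemma ovoid_linear_fixed:
  assumes det: "\<alpha> * \<delta> + \<beta> * \<gamma> = 1"
    and fixed: "\<And>x y. ovoid (\<alpha> * x + \<gamma> * y) (\<beta> * x + \<delta> * y) = ovoid x y"
  shows "\<alpha> = 1 \<and> \<beta> = 0 \<and> \<gamma> = 0 \<and> \<delta> = 1"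
proof -
  define E where "E = \<gamma>\<^sup>2 * \<theta> \<gamma>"
  have f0: "E * (y\<^sup>2 * \<theta> y) + \<gamma> * \<delta> * y\<^sup>2 + \<theta> \<delta> * \<theta> y = \<theta> y" for y
    using fixed[of 0 y] by (simp add: ovoid_def E_def power2_eq_square algebra_simps)
  have f1: "E + \<gamma> * \<delta> + \<theta> \<delta> = 1" using f0[of 1] by simp
  have "E * (y\<^sup>2 + \<theta> y) = 0" for y
  proof -
    have "E * (y\<^sup>2 + \<theta> y) =
        (E * ((y + 1)\<^sup>2 * \<theta> (y + 1)) + \<gamma> * \<delta> * (y + 1)\<^sup>2 + \<theta> \<delta> * \<theta> (y + 1)) +
        (E * (y\<^sup>2 * \<theta> y) + \<gamma> * \<delta> * y\<^sup>2 + \<theta> \<delta> * \<theta> y) + (E + \<gamma> * \<delta> + \<theta> \<delta>)"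
      by (simp add: char2_simps)
    also have "\<dots> = \<theta> (y + 1) + \<theta> y + 1" unfolding f0 f1 by (rule refl)
    finally show ?thesis by (simp add: algebra_simps)
  qed
  \<comment> \<open>An element outside the prime field, where squaring and \<open>\<theta>\<close>
    differ; it exists because \<open>m\<close> is positive. For q = 2 this step would break
    down.\<close>
  moreover obtain t :: 'a where t: "t \<noteq> 0" "t \<noteq> 1" using ex_not_01 by blast
  have tt: "t\<^sup>2 + \<theta> t \<noteq> 0" using theta_eq_square[of t] t by (metis add_eq_0_iff2)
  ultimately have "E = 0" using mult_eq_0_iff by blast
  then have g: "\<gamma> = 0" by (simp add: E_def)
  then have d: "\<delta> = 1" using f1 \<open>E = 0\<close> by simp
  have a: "\<alpha> = 1" using det g d by simp
  \<comment> \<open>With \<open>y = 0\<close> only this additive condition remains. At 1 it says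
    that \<open>\<theta>\<close> fixes \<open>\<beta>\<close>, and then at \<open>t\<close> it
    forces \<open>\<beta>\<close> to vanish.\<close>
  have b: "\<theta> \<beta> * \<theta> x = \<beta> * x\<^sup>2" for x
  proof -
    have "x\<^sup>2 * \<theta> x + (\<beta> * x\<^sup>2 + \<theta> \<beta> * \<theta> x) = x\<^sup>2 * \<theta> x + 0"
      using fixed[of x 0] by (simp add: ovoid_def a g d power2_eq_square algebra_simps)
    then show ?thesis by (simp only: add_left_cancel add_eq_0_iff2)
  qed
  have "\<theta> \<beta> = \<beta>" using b[of 1] by simp
  then have "\<beta> * t\<^sup>2 = \<beta> * \<theta> t" using b[of t] by metis
  then have "\<beta> * t\<^sup>2 + \<beta> * \<theta> t = 0" by (simp only: add_self)
  then have "\<beta> * (t\<^sup>2 + \<theta> t) = 0" by (simp only: distrib_left)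
  then have "\<beta> = 0" using tt mult_eq_0_iff by blast
  then show ?thesis using a g d by simp
qed

text \<open>The image of \<open>e1\<close> has form value 1 with \<open>e4\<close>, hence is an
  affine point with scalar 1, and a unipotent matrix moves it back to \<open>e1\<close>. The
  remaining map fixes \<open>e1\<close> and \<open>e4\<close>, so it acts only on the two middle
  coordinates, by a matrix of determinant 1 that leaves \<open>ovoid\<close> invariant; only the
  identity does this.\<close>

lemma stabilizer_e4:
  assumes g: "g \<in> isometries" "g *v e4 = e4"
  shows "\<exists>a b. g = u a b"
proof -
  have form: "form4 (h *v v) (h *v w) = form4 v w" if "h \<in> isometries" for h v w
    using that by (simp add: isometries_def)
  have "g *v e1 \<in> ovoid_cone" using g e1_cone by (simp add: isometries_def)
  then obtain x y where xy: "g *v e1 = vector [1, x, y, ovoid x y]"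
  proof (cases rule: cone_cases)
    case (finite_point l x y)
    have "form4 (g *v e1) (g *v e4) = 1" unfolding form[OF g(1)] by (simp add: form4_def)
    then have "l = 1" using finite_point g(2) by (simp add: form4_def)
    then show ?thesis using that[of x y] finite_point by (simp add: vec4_eq_iff)
  next
    case (infinite_point l)
    have "form4 (g *v e1) (g *v e4) = 1" unfolding form[OF g(1)] by (simp add: form4_def)
    then show ?thesis using infinite_point g(2) by (simp add: form4_def)
  qed
  let ?ui = "u x (y + x * \<theta> x)"
  let ?h = "?ui ** g"
  have h: "?h \<in> isometries"
    using subgroup.m_closed[OF isometries_subgroup u_isometry g(1)] by (simp add: GL_group_def)
  have "?ui *v (u x y *v e1) = e1" by (simp add: matrix_vector_mul_assoc u_inv)
  then have h1: "?h *v e1 = e1" using xy by (simp add: matrix_vector_mul_assoc[symmetric] u_vec)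
  have h4: "?h *v e4 = e4" using g(2) by (simp add: matrix_vector_mul_assoc[symmetric] u_vec)
  let ?e2 = "vector [0, 1, 0, 0] :: 'a^4" and ?e3 = "vector [0, 0, 1, 0] :: 'a^4"
  have z: "(?h *v w) $ 4 = w $ 4" "(?h *v w) $ 1 = w $ 1" for w
    using form[OF h, of e1 w] form[OF h, of e4 w] unfolding h1 h4 by (simp_all add: form4_def)
  let ?\<alpha> = "?h $ 2 $ 2" and ?\<beta> = "?h $ 3 $ 2" and ?\<gamma> = "?h $ 2 $ 3" and ?\<delta> = "?h $ 3 $ 3"
  have c1: "?h $ 1 $ 1 = 1" "?h $ 2 $ 1 = 0" "?h $ 3 $ 1 = 0" "?h $ 4 $ 1 = 0"
    using h1 by (simp_all add: vec4_eq_iff mat4_vec)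
  have c4: "?h $ 1 $ 4 = 0" "?h $ 2 $ 4 = 0" "?h $ 3 $ 4 = 0" "?h $ 4 $ 4 = 1"
    using h4 by (simp_all add: vec4_eq_iff mat4_vec)
  have c23: "?h $ 1 $ 2 = 0" "?h $ 4 $ 2 = 0" "?h $ 1 $ 3 = 0" "?h $ 4 $ 3 = 0"
    using z[of ?e2] z[of ?e3] by (simp_all add: mat4_vec)
  have hv: "?h *v vector [1, x, y, t] = vector [1, ?\<alpha> * x + ?\<gamma> * y, ?\<beta> * x + ?\<delta> * y, t]" for x y t
    by (simp add: vec4_eq_iff mat4_vec c1 c4 c23)
  have "form4 (?h *v ?e2) (?h *v ?e3) = 1" unfolding form[OF h] by (simp add: form4_def)
  then have det: "?\<alpha> * ?\<delta> + ?\<beta> * ?\<gamma> = 1" by (simp add: form4_def mat4_vec c23)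
  have "ovoid (?\<alpha> * x + ?\<gamma> * y) (?\<beta> * x + ?\<delta> * y) = ovoid x y" for x y
  proof -
    have "?h *v vector [1, x, y, ovoid x y] \<in> ovoid_cone" using h coneI by (simp add: isometries_def)
    then show ?thesis unfolding hv
    proof (cases rule: cone_cases)
      case (finite_point l a b)
      then have "l = 1" by (simp add: vec4_eq_iff)
      then show ?thesis using finite_point by (simp add: vec4_eq_iff)
    qed (simp add: vec4_eq_iff)
  qed
  from ovoid_linear_fixed[OF det this]
  have "?h = mat 1" by (simp add: vec4_eq_iff c1 c4 c23)
  then have "u x y ** ?h = u x y" by simp
  then have "g = u x y" by (simp add: matrix_mul_assoc u_inv)
  then show ?thesis by blast
qed

end

section \<open>Involutions of Sz(q) as vectors of the cone\<close>

context suzuki_field begin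

abbreviation K :: "('a^4^4) monoid" where "K \<equiv> Suzuki_group m"

lemma group_K: "group K"
  unfolding Suzuki_group_def by (rule group.group_subgroup_generated[OF group_GL])

lemma K_simps [simp]: "mult K = (**)" "one K = mat 1"
  by (simp_all add: Suzuki_group_def GL_group_def)

lemma carrier_K_isometries: "carrier K \<subseteq> isometries"
  unfolding Suzuki_group_def carrier_subgroup_generated
proof (rule group.generate_subgroup_incl[OF group_GL _ isometries_subgroup])
  have "suzuki_diag m c \<in> isometries" if "c \<noteq> 0" for c
  proof -
    have "\<kappa> c \<noteq> 0" using theta_kappa(1)[of c] that theta_eq_0 by metis
    from D_isometry[OF this] show ?thesis by simp
  qed
  note diag = this
  show "carrier GL_group \<inter> ({u a b | a b. True} \<union> {suzuki_diag m c | c. c \<noteq> 0} \<union> {w0}) \<subseteq> isometries"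
  proof
    fix g assume "g \<in> carrier GL_group \<inter> ({u a b | a b. True} \<union> {suzuki_diag m c | c. c \<noteq> 0} \<union> {w0})"
    then consider a b where "g = u a b" | c where "c \<noteq> 0" "g = suzuki_diag m c" | "g = w0" by blast
    then show "g \<in> isometries" using u_isometry diag w0_isometry by cases simp_all
  qed
qed

lemma K_generators: "u a b \<in> carrier K" "k \<noteq> 0 \<Longrightarrow> D k \<in> carrier K" "w0 \<in> carrier K"
proof -
  have gen: "g \<in> carrier K"
    if "g \<in> isometries" "g \<in> {u a b | a b. True} \<union> {suzuki_diag m c | c. c \<noteq> 0} \<union> {w0}" for g
    unfolding Suzuki_group_def carrier_subgroup_generated
    by (rule generate.incl, rule IntI[OF _ that(2)]) (use that(1) in \<open>simp add: isometries_def GL_group_def\<close>)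
  show "u a b \<in> carrier K" by (rule gen[OF u_isometry]) blast
  show "w0 \<in> carrier K" by (rule gen[OF w0_isometry]) blast
  assume k: "k \<noteq> 0"
  then have "D k \<in> {suzuki_diag m c | c. c \<noteq> 0}" using theta_eq_0[of k] by blast
  then show "D k \<in> carrier K" by (intro gen[OF D_isometry[OF k]] UnI1 UnI2)
qed

sublocale K: group K by (rule group_K)

lemma K_mult_closed: "\<lbrakk>g \<in> carrier K; h \<in> carrier K\<rbrakk> \<Longrightarrow> g ** h \<in> carrier K"
  using K.m_closed[of g h] by simp

lemma K_inv:
  assumes "g \<in> carrier K"
  shows "inv\<^bsub>K\<^esub> g \<in> carrier K" "g ** inv\<^bsub>K\<^esub> g = mat 1" "inv\<^bsub>K\<^esub> g ** g = mat 1"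
  using K.inv_closed[OF assms] K.r_inv[OF assms] K.l_inv[OF assms] by simp_all

lemma K_inv_vec:
  assumes "g \<in> carrier K"
  shows "g *v (inv\<^bsub>K\<^esub> g *v v) = v" "inv\<^bsub>K\<^esub> g *v (g *v v) = v"
  by (simp_all add: matrix_vector_mul_assoc K_inv[OF assms])

lemma K_form: "g \<in> carrier K \<Longrightarrow> form4 (g *v v) (g *v w) = form4 v w"
  using carrier_K_isometries by (auto simp: isometries_def)

lemma K_cone: "\<lbrakk>g \<in> carrier K; v \<in> ovoid_cone\<rbrakk> \<Longrightarrow> g *v v \<in> ovoid_cone"
  using carrier_K_isometries by (auto simp: isometries_def)

lemma K_eq_iff: "g \<in> carrier K \<Longrightarrow> g *v v = g *v w \<longleftrightarrow> v = w"
  by (metis K_inv_vec(2))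

lemma one_scale [simp]: "1 *s v = (v :: 'a^4)"
  by (simp add: vec_eq_iff)

lemma ex_D:
  assumes "l \<noteq> 0"
  obtains k where "k \<noteq> 0" "D k *v e4 = l *s e4" "k\<^sup>2 * \<theta> k = 1 / \<theta> l"
proof
  \<comment> \<open>Since \<open>\<theta> (\<theta> l)\<close> is the square of \<open>l\<close>,
    this choice makes \<open>k * \<theta> k\<close> equal to 1 / l, the inverse of the scalar by
    which \<open>D k\<close> multiplies \<open>e4\<close>.\<close>
  let ?k = "l / \<theta> l"
  have e: "?k * \<theta> ?k = 1 / l" using assms by (simp add: field_simps power2_eq_square)
  show "?k \<noteq> 0" using assms by simp
  show "D ?k *v e4 = l *s e4" unfolding D_vec scale_vec e using assms by simp
  show "?k\<^sup>2 * \<theta> ?k = 1 / \<theta> l" using assms by (simp add: field_simps power2_eq_square)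
qed

text \<open>A diagonal matrix sets the scalar; the flip and a unipotent matrix then carry the point
  of \<open>e4\<close> to any affine point.\<close>

lemma cone_transitive:
  assumes "v \<in> ovoid_cone"
  shows "\<exists>g\<in>carrier K. g *v e4 = v"
  using assms
proof (cases rule: cone_cases)
  case (finite_point l x y)
  obtain k where k: "k \<noteq> 0" "D k *v e4 = l *s e4" using ex_D[OF finite_point(1)] by metis
  have "(u x y ** w0 ** D k) *v e4 = u x y *v (w0 *v (l *s e4))"
    using k by (simp add: matrix_vector_mul_assoc[symmetric])
  also have "\<dots> = v" unfolding scale_vec w0_vec u_vec finite_point(2) by (simp add: mult.commute)
  finally show ?thesis
    by (rule bexI) (intro K_mult_closed K_generators k)
next
  case (infinite_point l)
  obtain k where k: "k \<noteq> 0" "D k *v e4 = l *s e4" using ex_D[OF infinite_point(1)] by metis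
  from k(2) show ?thesis unfolding infinite_point(2)
    by (rule bexI) (intro K_generators k)
qed

text \<open>The involution fixing the vector \<open>v\<close>; it does not depend on the choice of \<open>g\<close> because the
  stabiliser of \<open>e4\<close> centralises \<open>u 0 1\<close>.\<close>

definition \<phi> :: "'a^4 \<Rightarrow> 'a^4^4" where
  "\<phi> v = (let g = SOME g. g \<in> carrier K \<and> g *v e4 = v in g ** u 0 1 ** inv\<^bsub>K\<^esub> g)"

lemma phi_eq:
  assumes g: "g \<in> carrier K"
  shows "\<phi> (g *v e4) = g ** u 0 1 ** inv\<^bsub>K\<^esub> g"
proof -
  define h where "h = (SOME h. h \<in> carrier K \<and> h *v e4 = g *v e4)"
  have h: "h \<in> carrier K \<and> h *v e4 = g *v e4"
    unfolding h_def by (rule someI[of _ g]) (use g in simp)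
  let ?s = "inv\<^bsub>K\<^esub> g ** h"
  have sK: "?s \<in> carrier K" using K_inv[OF g] h K_mult_closed by blast
  have "?s *v e4 = e4" using h K_inv_vec(2)[OF g] by (simp add: matrix_vector_mul_assoc[symmetric])
  then obtain a b where ab: "?s = u a b" using stabilizer_e4 sK carrier_K_isometries by blast
  have hs: "h = g ** ?s" by (simp add: matrix_mul_assoc K_inv(2)[OF g])
  have c: "?s ** u 0 1 = u 0 1 ** ?s" unfolding ab u_mult by (simp add: add.commute)
  have "h ** u 0 1 ** inv\<^bsub>K\<^esub> h = g ** (?s ** u 0 1) ** inv\<^bsub>K\<^esub> h"
    using hs by (simp add: matrix_mul_assoc)
  also have "\<dots> = g ** u 0 1 ** (inv\<^bsub>K\<^esub> g ** (h ** inv\<^bsub>K\<^esub> h))" unfolding c by (simp only: matrix_mul_assoc)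
  also have "\<dots> = g ** u 0 1 ** inv\<^bsub>K\<^esub> g" using h K_inv by simp
  finally show ?thesis unfolding \<phi>_def h_def[symmetric] Let_def .
qed

lemma phi_conj:
  assumes g: "g \<in> carrier K" and v: "v \<in> ovoid_cone"
  shows "\<phi> (g *v v) = g ** \<phi> v ** inv\<^bsub>K\<^esub> g"
proof -
  obtain h where h: "h \<in> carrier K" "v = h *v e4" using cone_transitive[OF v] by blast
  have gh: "g ** h \<in> carrier K" using g h K_mult_closed by blast
  have "\<phi> (g *v v) = \<phi> ((g ** h) *v e4)" by (simp add: h matrix_vector_mul_assoc)
  also have "\<dots> = g ** h ** u 0 1 ** inv\<^bsub>K\<^esub> (g ** h)" by (rule phi_eq[OF gh])
  also have "inv\<^bsub>K\<^esub> (g ** h) = inv\<^bsub>K\<^esub> h ** inv\<^bsub>K\<^esub> g" using K.inv_mult_group[OF g h(1)] by simp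
  finally show ?thesis unfolding h(2) phi_eq[OF h(1)] by (simp only: matrix_mul_assoc)
qed

lemma phi_infinite:
  assumes "l \<noteq> 0" shows "\<phi> (l *s e4) = u 0 (\<theta> l)"
proof -
  obtain k where k: "k \<noteq> 0" "D k *v e4 = l *s e4" "k\<^sup>2 * \<theta> k = 1 / \<theta> l" using ex_D[OF assms] by metis
  have "\<phi> (l *s e4) = D k ** u 0 1 ** inv\<^bsub>K\<^esub> (D k)"
    using phi_eq[OF K_generators(2)[OF k(1)]] k(2) by simp
  also have "\<dots> = u 0 (\<theta> l)" unfolding D_u[OF k(1)] k(3)
    using K_inv[OF K_generators(2)[OF k(1)]] by (simp flip: matrix_mul_assoc)
  finally show ?thesis .
qed

lemma phi_e1:
  assumes "l \<noteq> 0" shows "\<phi> (l *s e1) = w0 ** u 0 (\<theta> l) ** w0"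
proof -
  have "w0 *v (l *s e4) = l *s e1" by (simp add: scale_vec w0_vec)
  moreover have "inv\<^bsub>K\<^esub> w0 = w0" using K.inv_equality[of w0 w0] K_generators(3) w0_w0 by simp
  ultimately show ?thesis
    using phi_conj[OF K_generators(3) cone_scale[OF coneI(2) assms]] phi_infinite[OF assms] by simp
qed

lemma u_involution: "b \<noteq> 0 \<Longrightarrow> u 0 b \<in> involutions K"
  using K_generators(1) unfolding K.involutions_iff
  by (simp add: u_mult u_0) (simp add: vec4_eq_iff)

lemma phi_involution:
  assumes "v \<in> ovoid_cone" shows "\<phi> v \<in> involutions K"
proof -
  obtain g where g: "g \<in> carrier K" "v = g *v e4" using cone_transitive[OF assms] by blast
  show ?thesis unfolding g(2) phi_eq[OF g(1)]
    using K.conjugate_involution[OF u_involution g(1), of 1] by simp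
qed

text \<open>Normal forms of pairs of vectors under the group: the form value is the only invariant
  of a pair on different ovoid points. Statements about two involutions thus need to be checked only
  for \<open>e4\<close> together with a multiple of \<open>e4\<close> or of
  \<open>e1\<close>.\<close>

lemma cone_pair_cases:
  assumes v: "v \<in> ovoid_cone" and w: "w \<in> ovoid_cone"
  obtains (proportional) g l where "g \<in> carrier K" "l \<noteq> 0" "g *v v = e4" "g *v w = l *s e4" "w = l *s v" "form4 v w = 0"
  | (opposite) g where "g \<in> carrier K" "g *v v = e4" "g *v w = form4 v w *s e1" "form4 v w \<noteq> 0"
proof -
  obtain h where h: "h \<in> carrier K" "h *v e4 = v" using cone_transitive[OF v] by blast
  let ?g = "inv\<^bsub>K\<^esub> h"
  have g: "?g \<in> carrier K" using K_inv h by blast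
  have gv: "?g *v v = e4" using K_inv_vec(2)[OF h(1)] h(2) by metis
  have form: "form4 v w = form4 e4 (?g *v w)" using K_form[OF g, of v w] gv by simp
  have "?g *v w \<in> ovoid_cone" using K_cone[OF g w] .
  then show thesis
  proof (cases rule: cone_cases)
    case (infinite_point l)
    have "?g *v w = ?g *v (l *s v)" unfolding infinite_point(2) vector_scalar_commute gv ..
    then have "w = l *s v" using K_eq_iff[OF g] by blast
    moreover have "form4 v w = 0" unfolding form infinite_point(2) by (simp add: form4_def)
    ultimately show thesis using proportional[OF g infinite_point(1) gv infinite_point(2)] by blast
  next
    case (finite_point l x y)
    have f: "form4 v w = l" unfolding form finite_point(2) by (simp add: form4_def)
    let ?s = "u x (y + x * \<theta> x)"
    have "?s *v (u x y *v (l *s e1)) = l *s e1"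
      by (simp only: matrix_vector_mul_assoc u_inv matrix_vector_mul_lid)
    moreover have "u x y *v (l *s e1) = ?g *v w" unfolding finite_point(2) scale_vec u_vec
      by (simp add: mult.commute)
    ultimately have "(?s ** ?g) *v w = l *s e1" by (simp add: matrix_vector_mul_assoc[symmetric])
    moreover have "(?s ** ?g) *v v = e4" by (simp add: matrix_vector_mul_assoc[symmetric] gv u_vec)
    moreover have "?s ** ?g \<in> carrier K" using K_mult_closed[OF K_generators(1) g] .
    ultimately show thesis using opposite f finite_point(1) by blast
  qed
qed

lemma form4_self: "form4 v v = (0 :: 'a)"
  by (simp add: form4_def algebra_simps)

lemma phi_commute_conj:
  assumes "g \<in> carrier K" "v \<in> ovoid_cone" "w \<in> ovoid_cone"
  shows "\<phi> v ** \<phi> w = \<phi> w ** \<phi> v \<longleftrightarrow> \<phi> (g *v v) ** \<phi> (g *v w) = \<phi> (g *v w) ** \<phi> (g *v v)"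
    and "K.ord (\<phi> v ** \<phi> w) = K.ord (\<phi> (g *v v) ** \<phi> (g *v w))"
proof -
  have c: "\<phi> v \<in> carrier K" "\<phi> w \<in> carrier K" using phi_involution assms by simp_all
  have m: "\<phi> (g *v v) ** \<phi> (g *v w) = g ** (\<phi> v ** \<phi> w) ** inv\<^bsub>K\<^esub> g"
    if "v \<in> ovoid_cone" "w \<in> ovoid_cone" for v w
    using K.conjugate_mult[of "\<phi> v" "\<phi> w" g] that assms(1) phi_involution
    by (simp add: phi_conj)
  show "\<phi> v ** \<phi> w = \<phi> w ** \<phi> v \<longleftrightarrow> \<phi> (g *v v) ** \<phi> (g *v w) = \<phi> (g *v w) ** \<phi> (g *v v)"
    unfolding m[OF assms(2,3)] m[OF assms(3,2)]
    using K.conjugate_inj[of "\<phi> v ** \<phi> w" "\<phi> w ** \<phi> v" g] c assms(1) K_mult_closed by simp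
  show "K.ord (\<phi> v ** \<phi> w) = K.ord (\<phi> (g *v v) ** \<phi> (g *v w))"
    unfolding m[OF assms(2,3)]
    using K.conjugate_ord[of "\<phi> v ** \<phi> w" g] c assms(1) K_mult_closed by simp
qed

lemma trace_opposite: "trace (u 0 b ** (w0 ** u 0 c ** w0)) = \<theta> (b * c)"
  by (simp add: trace4 mat4_mult ovoid_def char2_simps)

lemma pow5_eq_1:
  assumes "x \<in> carrier K"
  shows "x [^]\<^bsub>K\<^esub> (5::nat) = x ** (x ** x ** (x ** x))"
proof -
  have "x [^]\<^bsub>K\<^esub> (5::nat) = x \<otimes>\<^bsub>K\<^esub> (x [^]\<^bsub>K\<^esub> (2::nat) \<otimes>\<^bsub>K\<^esub> x [^]\<^bsub>K\<^esub> (2::nat))"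
    using assms by (simp only: K.nat_pow_mult K.nat_pow_Suc2[symmetric]) simp
  then show ?thesis using assms by (simp add: numeral_2_eq_2)
qed

text \<open>All entries are 0 or 1, so this is a computation over the prime field, made short by
  squaring twice.\<close>

lemma opposite_unit_pow5:
  defines "M \<equiv> u 0 1 ** (w0 ** u 0 1 ** w0)"
  shows "M ** (M ** M ** (M ** M)) = mat 1"
proof -
  have M: "M $ 1 = vector [1, 0, 1, 1]" "M $ 2 = vector [0, 1, 0, 1]" "M $ 3 = vector [1, 0, 0, 1]"
    "M $ 4 = vector [1, 1, 1, 1]"
    by (simp_all add: M_def vec4_eq_iff mat4_mult ovoid_def two)
  define N where "N = M ** M"
  have N: "N $ 1 = vector [1, 1, 0, 1]" "N $ 2 = vector [1, 0, 1, 0]" "N $ 3 = vector [0, 1, 0, 0]"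
    "N $ 4 = vector [1, 0, 0, 0]"
    by (simp_all add: N_def vec4_eq_iff mat4_mult M two)
  show ?thesis unfolding N_def[symmetric] by (simp add: vec4_eq_iff mat4_mult M N two)
qed

text \<open>For an opposite pair the product has trace equal to the square of the form value. If the
  involutions commuted, the square of that trace would be the trace of the identity, which is 4 =
  0.\<close>

lemma phi_commute_iff:
  assumes v: "v \<in> ovoid_cone" and w: "w \<in> ovoid_cone"
  shows "\<phi> v ** \<phi> w = \<phi> w ** \<phi> v \<longleftrightarrow> form4 v w = 0"
  using v w
proof (cases rule: cone_pair_cases)
  case (proportional g l)
  have "\<phi> e4 = u 0 1" using phi_infinite[of 1] by simp
  then show ?thesis unfolding phi_commute_conj(1)[OF proportional(1) v w] proportional(3,4)
    using phi_infinite[OF proportional(2)] proportional(6) by (simp add: u_mult add.commute)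
next
  case (opposite g)
  have I: "\<phi> v \<in> involutions K" "\<phi> w \<in> involutions K" using phi_involution v w by simp_all
  have e: "\<phi> e4 = u 0 1" using phi_infinite[of 1] by simp
  let ?M = "\<phi> e4 ** \<phi> (form4 v w *s e1)"
  have tr: "trace ?M = (form4 v w)\<^sup>2" unfolding e phi_e1[OF opposite(4)] trace_opposite by simp
  have I': "\<phi> e4 \<in> involutions K" "\<phi> (form4 v w *s e1) \<in> involutions K"
    using phi_involution coneI(2) cone_scale[OF e1_cone opposite(4)] by blast+
  have "\<phi> v ** \<phi> w \<noteq> \<phi> w ** \<phi> v"
  proof
    assume "\<phi> v ** \<phi> w = \<phi> w ** \<phi> v"
    then have "\<phi> e4 ** \<phi> (form4 v w *s e1) = \<phi> (form4 v w *s e1) ** \<phi> e4"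
      unfolding phi_commute_conj(1)[OF opposite(1) v w] opposite(2,3) .
    then have "?M [^]\<^bsub>K\<^esub> (2::nat) = mat 1" using K.commuting_iff_sq[OF I'] by simp
    then have "?M ** ?M = mat 1" using K_mult_closed I' by (simp add: numeral_2_eq_2)
    then have "(trace ?M)\<^sup>2 = trace (mat 1 :: 'a^4^4)" using trace_sq4[of ?M] by simp
    also have "\<dots> = 0" by (simp add: trace4)
    finally show False using tr opposite(4) by simp
  qed
  then show ?thesis using opposite(4) by simp
qed

text \<open>If M = xy has order 5, then M^4 = M^(-1) = yx has the same trace as xy. With \<mu> the
  form value, this reads \<mu>^8 = \<mu>^2, so \<mu>^3 = 1 and \<mu> = 1. Conversely, \<mu> = 1
  leads to one explicit matrix with fifth power 1, which is not the identity because its trace is 1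
  and not 0.\<close>

lemma phi_ord_5_iff:
  assumes v: "v \<in> ovoid_cone" and w: "w \<in> ovoid_cone"
  shows "K.ord (\<phi> v ** \<phi> w) = 5 \<longleftrightarrow> form4 v w = 1"
  using v w
proof (cases rule: cone_pair_cases)
  case (proportional g l)
  have I: "\<phi> v \<in> involutions K" "\<phi> w \<in> involutions K" using phi_involution v w by simp_all
  have "\<phi> v ** \<phi> w = \<phi> w ** \<phi> v" using phi_commute_iff[OF v w] proportional(6) by simp
  then have "(\<phi> v ** \<phi> w) [^]\<^bsub>K\<^esub> (2::nat) = mat 1" using K.commuting_iff_sq[OF I] by simp
  then have "K.ord (\<phi> v ** \<phi> w) dvd 2" using K.pow_eq_id[of "\<phi> v ** \<phi> w" 2] I K_mult_closed by simp
  then have "K.ord (\<phi> v ** \<phi> w) \<noteq> 5" by auto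
  then show ?thesis using proportional(6) by simp
next
  case (opposite g)
  let ?\<mu> = "form4 v w"
  let ?x = "\<phi> e4" and ?y = "\<phi> (?\<mu> *s e1)"
  let ?M = "?x ** ?y"
  have e: "?x = u 0 1" using phi_infinite[of 1] by simp
  have I: "?x \<in> involutions K" "?y \<in> involutions K"
    using phi_involution coneI(2) cone_scale[OF e1_cone opposite(4)] by blast+
  have Mc: "?M \<in> carrier K" using I K_mult_closed by simp
  have tr: "trace ?M = ?\<mu>\<^sup>2" unfolding e phi_e1[OF opposite(4)] trace_opposite by simp
  have ord: "K.ord (\<phi> v ** \<phi> w) = K.ord ?M"
    unfolding phi_commute_conj(2)[OF opposite(1) v w] opposite(2,3) ..
  show ?thesis unfolding ord
  proof
    assume "K.ord ?M = 5"
    then have "?M [^]\<^bsub>K\<^esub> (5::nat) = mat 1" using K.pow_ord_eq_1[OF Mc] by simp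
    then have M5: "?M ** (?M ** ?M ** (?M ** ?M)) = mat 1" using pow5_eq_1[OF Mc] by simp
    have "?y ** ?x ** ?M = mat 1"
      using K.inv_prod_involutions[OF I] K_inv(3)[OF Mc] by simp
    then have "?M ** ?M ** (?M ** ?M) = ?y ** ?x ** (?M ** (?M ** ?M ** (?M ** ?M)))"
      by (simp only: matrix_mul_assoc matrix_mul_lid)
    then have "?M ** ?M ** (?M ** ?M) = ?y ** ?x" unfolding M5 by simp
    then have "((trace ?M)\<^sup>2)\<^sup>2 = trace (?y ** ?x)" unfolding trace_sq4[symmetric] by simp
    also have "\<dots> = trace ?M" by (rule trace_mul_sym)
    finally have "?\<mu>\<^sup>2 * (?\<mu> ^ 3)\<^sup>2 = ?\<mu>\<^sup>2 * 1"
      unfolding tr by (simp flip: power_mult power_add)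
    then have "(?\<mu> ^ 3)\<^sup>2 = 1" using opposite(4) by (simp only: mult_cancel_left) simp
    then have "(?\<mu> ^ 3)\<^sup>2 = 1\<^sup>2" by (simp only: power_one)
    then have "?\<mu> ^ 3 = 1" unfolding square_eq_iff .
    then show "?\<mu> = 1" by (simp add: cube_eq_1)
  next
    assume mu: "?\<mu> = 1"
    have "?M = u 0 1 ** (w0 ** u 0 1 ** w0)" unfolding e phi_e1[OF opposite(4)] by (simp add: mu)
    then have "?M ** (?M ** ?M ** (?M ** ?M)) = mat 1" using opposite_unit_pow5 by simp
    then have "K.ord ?M dvd 5" using pow5_eq_1[OF Mc] K.pow_eq_id[OF Mc, of 5] by simp
    moreover have "?M \<noteq> mat 1"
    proof
      assume M1: "?M = mat 1"
      have "trace (mat 1 :: 'a^4^4) = 0" by (simp add: trace4)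
      then have "?\<mu>\<^sup>2 = 0" using tr unfolding M1 by simp
      then show False using mu by simp
    qed
    then have "K.ord ?M \<noteq> 1" using K.ord_eq_1[OF Mc] by simp
    moreover have "prime (5::nat)" by simp
    ultimately show "K.ord ?M = 5" by (metis prime_nat_iff)
  qed
qed

lemma phi_inj:
  assumes v: "v \<in> ovoid_cone" and w: "w \<in> ovoid_cone" and eq: "\<phi> v = \<phi> w"
  shows "v = w"
  using v w
proof (cases rule: cone_pair_cases)
  case (proportional g l)
  have "\<phi> (g *v v) = \<phi> (g *v w)" using eq phi_conj proportional(1) v w by simp
  then have "u 0 1 = u 0 (\<theta> l)"
    unfolding proportional(3,4) using phi_infinite[of 1] phi_infinite[OF proportional(2)] by simp
  then have "l = 1" by (simp add: vec4_eq_iff)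
  then show ?thesis using proportional by simp
next
  case (opposite g)
  then show ?thesis using phi_commute_iff[OF v w] eq by simp
qed

lemma card_cone: "card ovoid_cone = ((2 ^ n)\<^sup>2 + 1) * (2 ^ n - 1)"
proof -
  let ?A = "{l *s vector [1, x, y, ovoid x y] | l x y. l \<noteq> 0} :: ('a^4) set"
  let ?B = "{l *s e4 | l. l \<noteq> 0} :: ('a^4) set"
  have F: "card (UNIV - {0::'a}) = 2 ^ n - 1" by (simp add: card_Diff_subset card_field)
  have "bij_betw (\<lambda>(l, x, y). l *s vector [1, x, y, ovoid x y]) ((UNIV - {0}) \<times> UNIV \<times> UNIV) ?A"
    by (rule bij_betw_imageI) (auto simp: inj_on_def scale_vec vec4_eq_iff image_iff)
  then have A: "card ?A = (2 ^ n - 1) * (2 ^ n * 2 ^ n)"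
    using bij_betw_same_card F by (fastforce simp: card_cartesian_product card_field)
  have "bij_betw (\<lambda>l. l *s e4) (UNIV - {0}) ?B"
    by (rule bij_betw_imageI) (auto simp: inj_on_def scale_vec vec4_eq_iff image_iff)
  then have B: "card ?B = 2 ^ n - 1" using bij_betw_same_card F by fastforce
  have "?A \<inter> ?B = {}" by (auto simp: scale_vec vec4_eq_iff)
  then have "card ovoid_cone = card ?A + card ?B" unfolding ovoid_cone_def by (intro card_Un_disjoint) auto
  then show ?thesis unfolding A B by (simp add: algebra_simps power2_eq_square)
qed

text \<open>An involution permutes the odd number of cone vectors, so it fixes one. After
  conjugation it fixes \<open>e4\<close> and is unipotent, and having square 1 it has first
  parameter 0.\<close>

lemma involutions_eq_phi: "involutions K = \<phi> ` ovoid_cone"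
proof (intro equalityI subsetI)
  fix g assume g: "g \<in> involutions K"
  then have gK: "g \<in> carrier K" and gg: "g ** g = mat 1" and g1: "g \<noteq> mat 1"
    using K.involution_sq[OF g] K.involution_neq_one[OF g] by simp_all
  have "\<exists>v\<in>ovoid_cone. g *v v = v"
  proof (rule ccontr)
    assume "\<not> ?thesis"
    then have "even (card ovoid_cone)"
      by (intro even_card_fixpoint_free[where f = "(*v) g"])
        (use K_cone[OF gK] gg in \<open>auto simp: matrix_vector_mul_assoc\<close>)
    then show False using n_pos unfolding card_cone by simp
  qed
  then obtain v where v: "v \<in> ovoid_cone" "g *v v = v" by blast
  obtain h where h: "h \<in> carrier K" "h *v e4 = v" using cone_transitive[OF v(1)] by blast
  let ?k = "inv\<^bsub>K\<^esub> h ** g ** h"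
  have kK: "?k \<in> carrier K" by (intro K_mult_closed K_inv(1) h(1) gK)
  have "?k *v e4 = e4" using h(2) v(2) K_inv_vec(2)[OF h(1)] by (metis matrix_vector_mul_assoc)
  then obtain a b where ab: "?k = u a b" using stabilizer_e4 kK carrier_K_isometries by blast
  have g_eq: "g = h ** u a b ** inv\<^bsub>K\<^esub> h" unfolding ab[symmetric]
    by (metis K_inv(2)[OF h(1)] matrix_mul_assoc matrix_mul_lid matrix_mul_rid)
  have "?k ** ?k = inv\<^bsub>K\<^esub> h ** (g ** (h ** inv\<^bsub>K\<^esub> h) ** g) ** h" by (simp only: matrix_mul_assoc)
  also have "\<dots> = mat 1" using K_inv[OF h(1)] gg by simp
  finally have "u a b ** u a b = mat 1" unfolding ab .
  then have a: "a = 0" unfolding u_mult by (auto simp: vec4_eq_iff)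
  have b: "b \<noteq> 0"
  proof
    assume "b = 0"
    then have "g = mat 1" using g_eq a K_inv[OF h(1)] by (simp add: u_0)
    then show False using g1 by simp
  qed
  let ?l = "\<kappa> b"
  have l: "?l \<noteq> 0" using b theta_kappa(1)[of b] theta_eq_0 by metis
  have "g = h ** \<phi> (?l *s e4) ** inv\<^bsub>K\<^esub> h" using g_eq a phi_infinite[OF l] by simp
  also have "\<dots> = \<phi> (h *v (?l *s e4))" using phi_conj[OF h(1) cone_scale[OF coneI(2) l]] by simp
  finally show "g \<in> \<phi> ` ovoid_cone" using K_cone[OF h(1) cone_scale[OF coneI(2) l]] by blast
qed (use phi_involution in blast)

lemma card_cone_transport:
  assumes "g \<in> carrier K"
  shows "card {w \<in> ovoid_cone. P (g *v w)} = card {w \<in> ovoid_cone. P w}"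
proof (rule bij_betw_same_card[of "(*v) g"], rule bij_betw_imageI)
  show "inj_on ((*v) g) {w \<in> ovoid_cone. P (g *v w)}" using K_eq_iff[OF assms] by (simp add: inj_on_def)
  show "(*v) g ` {w \<in> ovoid_cone. P (g *v w)} = {w \<in> ovoid_cone. P w}"
  proof (intro equalityI subsetI)
    fix w assume w: "w \<in> {w \<in> ovoid_cone. P w}"
    have "w = g *v (inv\<^bsub>K\<^esub> g *v w)" by (simp add: K_inv_vec[OF assms])
    then show "w \<in> (*v) g ` {w \<in> ovoid_cone. P (g *v w)}"
      using w K_cone[OF K_inv(1)[OF assms]] K_inv_vec(1)[OF assms]
      by (intro image_eqI[of _ _ "inv\<^bsub>K\<^esub> g *v w"]) auto
  qed (use K_cone[OF assms] in auto)
qed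

theorem fusion_group_Suzuki: "fusion_group K 5 n ((2 ^ n)\<^sup>2) (2 ^ n + 1)"
proof (rule K.fusion_group_modelI[where V = ovoid_cone and x = \<phi> and f = 1 and \<beta> = form4])
  show "finite (carrier K)" "finite ovoid_cone" by simp_all
  show "2 \<le> n" using n_eq m_pos by simp
  show "even ((2 ^ n)\<^sup>2 :: nat)" using n_pos by simp
  show "\<phi> ` ovoid_cone = involutions K" by (rule involutions_eq_phi[symmetric])
  show "card {w \<in> ovoid_cone. \<phi> w = \<phi> v} = 1" if "v \<in> ovoid_cone" for v
  proof -
    have "{w \<in> ovoid_cone. \<phi> w = \<phi> v} = {v}" using that phi_inj by blast
    then show ?thesis by simp
  qed
  show "\<phi> v \<otimes>\<^bsub>K\<^esub> \<phi> w = \<phi> w \<otimes>\<^bsub>K\<^esub> \<phi> v \<longleftrightarrow> form4 v w = 0" if "v \<in> ovoid_cone" "w \<in> ovoid_cone" for v w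
    using phi_commute_iff[OF that] by simp
  show "K.ord (\<phi> v \<otimes>\<^bsub>K\<^esub> \<phi> w) = 5 \<longleftrightarrow> form4 v w = 1" if "v \<in> ovoid_cone" "w \<in> ovoid_cone" for v w
    using phi_ord_5_iff[OF that] by simp
  have multiple: "\<exists>l. w = l *s v" if vw: "v \<in> ovoid_cone" "w \<in> ovoid_cone" "form4 v w = 0" for v w
    using vw(1,2) by (cases rule: cone_pair_cases) (use vw(3) in auto)
  show "form4 x z = 0"
    if xyz: "x \<in> ovoid_cone" "y \<in> ovoid_cone" "z \<in> ovoid_cone" "form4 x y = 0" "form4 y z = 0" for x y z
  proof -
    obtain l where "y = l *s x" using multiple[OF xyz(1,2,4)] by blast
    moreover obtain l' where "z = l' *s y" using multiple[OF xyz(2,3,5)] by blast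
    ultimately show ?thesis by (simp add: form4_self)
  qed
  show "card ovoid_cone = 1 * (((2 ^ n)\<^sup>2 + 1) * (2 ^ n - 1))" by (simp add: card_cone)
  show "card {w \<in> ovoid_cone. form4 v w = 0} = 1 * (2 ^ n - 1)" if v: "v \<in> ovoid_cone" for v
  proof -
    obtain g where g: "g \<in> carrier K" "g *v e4 = v" using cone_transitive[OF v] by blast
    have "card {w \<in> ovoid_cone. form4 v w = 0} = card {w \<in> ovoid_cone. form4 v (g *v w) = 0}"
      using card_cone_transport[OF g(1), of "\<lambda>w. form4 v w = 0"] by simp
    also have "{w \<in> ovoid_cone. form4 v (g *v w) = 0} = {w \<in> ovoid_cone. form4 e4 w = 0}"
      unfolding g(2)[symmetric] K_form[OF g(1)] by (rule refl)
    also have "\<dots> = (\<lambda>l. l *s e4) ` (UNIV - {0})"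
    proof (intro equalityI subsetI)
      fix w assume w: "w \<in> {w \<in> ovoid_cone. form4 e4 w = 0}"
      then have "w \<in> ovoid_cone" by simp
      then show "w \<in> (\<lambda>l. l *s e4) ` (UNIV - {0})"
        by (cases rule: cone_cases) (use w in \<open>auto simp: form4_def\<close>)
    qed (use cone_scale[OF coneI(2)] in \<open>auto simp: form4_def\<close>)
    also have "card \<dots> = card (UNIV - {0::'a})"
      by (rule card_image) (auto simp: inj_on_def vec4_eq_iff)
    finally show ?thesis by (simp add: card_Diff_subset card_field)
  qed
  show "\<exists>z\<in>ovoid_cone. form4 w z = 0 \<and> form4 v z = 1"
    if "v \<in> ovoid_cone" "w \<in> ovoid_cone" "form4 v w \<noteq> 0" for v w
    using that cone_scale[of w "1 / form4 v w"] by (intro bexI[of _ "(1 / form4 v w) *s w"]) (simp_all add: form4_self)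
  show "\<phi> v = \<phi> w" if xvw: "x \<in> ovoid_cone" "v \<in> ovoid_cone" "w \<in> ovoid_cone"
    "form4 v w = 0" "form4 x v = 1" "form4 x w = 1" for x v w
  proof -
    obtain l where "w = l *s v" using multiple[OF xvw(2,3,4)] by blast
    then show ?thesis using xvw(5,6) by simp
  qed
  show "card {z \<in> ovoid_cone. form4 v z = 1 \<and> form4 w z = 1} = 1 * (2 ^ n + 1)"
    if vw: "v \<in> ovoid_cone" "w \<in> ovoid_cone" and nz: "form4 v w \<noteq> 0" for v w
    using vw
  proof (cases rule: cone_pair_cases)
    case (opposite g)
    let ?\<mu> = "form4 v w"
    have "card {z \<in> ovoid_cone. form4 v z = 1 \<and> form4 w z = 1} =
        card {z \<in> ovoid_cone. form4 e4 (g *v z) = 1 \<and> form4 (?\<mu> *s e1) (g *v z) = 1}"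
      unfolding opposite(2,3)[symmetric] K_form[OF opposite(1)] by (rule refl)
    also have "\<dots> = card {z \<in> ovoid_cone. form4 e4 z = 1 \<and> form4 (?\<mu> *s e1) z = 1}"
      using card_cone_transport[OF opposite(1), of "\<lambda>z. form4 e4 z = 1 \<and> form4 (?\<mu> *s e1) z = 1"] by simp
    \<comment> \<open>The first condition sets the first coordinate to 1, and the second fixes the
      last coordinate, which leaves a level set of \<open>ovoid\<close>.\<close>
    also have "{z \<in> ovoid_cone. form4 e4 z = 1 \<and> form4 (?\<mu> *s e1) z = 1} =
        (\<lambda>(x, y). vector [1, x, y, ovoid x y]) ` {(x, y). ovoid x y = 1 / ?\<mu>}"
    proof (intro equalityI subsetI)
      fix z assume z: "z \<in> {z \<in> ovoid_cone. form4 e4 z = 1 \<and> form4 (?\<mu> *s e1) z = 1}"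
      then have "z \<in> ovoid_cone" by simp
      then show "z \<in> (\<lambda>(x, y). vector [1, x, y, ovoid x y]) ` {(x, y). ovoid x y = 1 / ?\<mu>}"
      proof (cases rule: cone_cases)
        case (finite_point l x y)
        then have "l = 1" "?\<mu> * ovoid x y = 1" using z by (auto simp: form4_def)
        then show ?thesis using finite_point nz by (auto simp: field_simps)
      qed (use z in \<open>simp add: form4_def\<close>)
    next
      fix z :: "'a^4" assume "z \<in> (\<lambda>(x, y). vector [1, x, y, ovoid x y]) ` {(x, y). ovoid x y = 1 / ?\<mu>}"
      then obtain x y where "z = vector [1, x, y, ovoid x y]" "ovoid x y = 1 / ?\<mu>" by auto
      then show "z \<in> {z \<in> ovoid_cone. form4 e4 z = 1 \<and> form4 (?\<mu> *s e1) z = 1}"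
        using coneI(1)[of x y] nz by (simp add: form4_def)
    qed
    also have "card \<dots> = card {(x, y). ovoid x y = 1 / ?\<mu>}"
      by (rule card_image) (auto simp: inj_on_def vec4_eq_iff)
    also have "\<dots> = 2 ^ n + 1" using card_ovoid_level[of "1 / ?\<mu>"] nz by simp
    finally show ?thesis by simp
  qed (use nz in simp)
qed simp_all

end

section \<open>Projective special unitary groups\<close>

text \<open>If upper bounds for the fibres and for the target multiply to the size of the source,
  all of them are attained. It will be applied to the norm and the trace, where the bounds come from
  degrees of polynomials.\<close>

lemma card_eq_fibres_bounded:
  assumes fin: "finite A" "finite B" and sub: "h ` A \<subseteq> B"
    and fib: "\<And>y. y \<in> B \<Longrightarrow> card {x \<in> A. h x = y} \<le> k"
    and B: "card B \<le> l" and A: "card A = k * l" and k: "0 < k"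
  shows "card B = l" "\<And>y. y \<in> B \<Longrightarrow> card {x \<in> A. h x = y} = k"
proof -
  have "A = (\<Union>y\<in>B. {x \<in> A. h x = y})" using sub by auto
  also have "card \<dots> = (\<Sum>y\<in>B. card {x \<in> A. h x = y})"
    by (rule card_UN_disjoint) (use fin in auto)
  finally have s: "k * l = (\<Sum>y\<in>B. card {x \<in> A. h x = y})" using A by simp
  have "k * l \<le> k * card B" unfolding s using sum_bounded_above[of B "\<lambda>y. card {x \<in> A. h x = y}" k] fib
    by (simp add: mult.commute)
  then show cB: "card B = l" using B k by simp
  fix y assume y: "y \<in> B"
  show "card {x \<in> A. h x = y} = k"
  proof (rule ccontr)
    assume "card {x \<in> A. h x = y} \<noteq> k"
    then have "card {x \<in> A. h x = y} < k" using fib[OF y] by simp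
    then have "(\<Sum>y\<in>B. card {x \<in> A. h x = y}) < (\<Sum>y\<in>B. k)"
      by (intro sum_strict_mono_ex1 ballI fib fin bexI[OF _ y])
    then show False using s cB by (simp add: mult.commute)
  qed
qed

lemma card_power_eq_le:
  fixes a :: "'a::field"
  assumes "0 < k" shows "card {x. x ^ k = a} \<le> k" and "finite {x. x ^ k = a}"
proof -
  let ?p = "Polynomial.monom 1 k + [:- a:]"
  have d: "Polynomial.degree ?p = k"
    using assms by (subst degree_add_eq_left) (auto simp: degree_monom_eq)
  then have nz: "?p \<noteq> 0" using assms by auto
  have "{x. x ^ k = a} = {x. poly ?p x = 0}" by (simp add: poly_monom)
  then show "card {x. x ^ k = a} \<le> k" "finite {x. x ^ k = a}"
    using card_poly_roots_bound[OF nz] poly_roots_finite[OF nz] d by simp_all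
qed

lemma card_power_add_eq_le:
  fixes a :: "'a::field"
  assumes "1 < k" shows "card {x. x ^ k + x = a} \<le> k"
proof -
  let ?p = "Polynomial.monom 1 k + [:- a, 1:]"
  have d: "Polynomial.degree ?p = k"
    using assms by (subst degree_add_eq_left) (auto simp: degree_monom_eq)
  then have nz: "?p \<noteq> 0" using assms by auto
  have "{x. x ^ k + x = a} = {x. poly ?p x = 0}" by (auto simp: poly_monom algebra_simps)
  then show ?thesis using card_poly_roots_bound[OF nz] d by simp
qed

section \<open>Norm and trace equations in the quadratic extension\<close>

locale unitary_field = char2_field ty "2 * n" for ty :: "'a::{field,finite} itself" and n +
  assumes n_ge: "2 \<le> n"
begin

abbreviation q :: nat where "q \<equiv> 2 ^ n"

lemma q_gt: "3 < q"
  using power_increasing[OF n_ge, of "2::nat"] by simp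

lemma card_q: "CARD('a) = q * q"
  using card_field by (simp add: power_add[symmetric] mult_2)

definition bar :: "'a \<Rightarrow> 'a" where "bar x = x ^ q"

lemma bar_add [simp]: "bar (x + y) = bar x + bar y"
  unfolding bar_def by (rule frobenius)

lemma bar_mult [simp]: "bar (x * y) = bar x * bar y"
  by (simp add: bar_def power_mult_distrib)

lemma bar_simps [simp]: "bar 0 = 0" "bar 1 = 1"
  by (simp_all add: bar_def)

lemma bar_bar [simp]: "bar (bar x) = x"
  using power_card[of x] by (simp add: bar_def card_q power_mult)

lemma bar_eq_iff [simp]: "bar x = bar y \<longleftrightarrow> x = y"
  by (metis bar_bar)

lemma bar_eq_0 [simp]: "bar x = 0 \<longleftrightarrow> x = 0"
  using bar_eq_iff[of x 0] by (simp del: bar_eq_iff)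

lemma bar_inverse [simp]: "bar (inverse x) = inverse (bar x)"
  by (simp add: bar_def power_inverse)

lemma bar_divide [simp]: "bar (x / y) = bar x / bar y"
  by (simp add: divide_inverse)

lemma card_fixed_le: "card {x. bar x = x} \<le> q"
  using card_power_add_eq_le[of q "0::'a"] q_gt by (simp add: bar_def add_eq_0_iff2)

lemma card_norm: "\<lbrakk>bar a = a; a \<noteq> 0\<rbrakk> \<Longrightarrow> card {x. x * bar x = a} = q + 1"
proof -
  assume a: "bar a = a" "a \<noteq> 0"
  let ?B = "{a. bar a = a} - {0}"
  have p: "{x \<in> UNIV - {0}. x * bar x = y} = {x. x ^ (q + 1) = y}" if "y \<noteq> 0" for y
    using that by (auto simp: bar_def)
  have "card {x \<in> UNIV - {0}. x * bar x = a} = q + 1"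
  proof (rule card_eq_fibres_bounded(2)[where B = ?B and l = "q - 1"])
    show "card {x \<in> UNIV - {0}. x * bar x = y} \<le> q + 1" if "y \<in> ?B" for y
      using that card_power_eq_le(1)[of "q + 1" y] by (subst p) auto
    show "card ?B \<le> q - 1" using card_fixed_le card_Diff_singleton[of 0 "{a. bar a = a}"] by simp
    show "card (UNIV - {0 :: 'a}) = (q + 1) * (q - 1)"
      using card_q by (simp add: card_Diff_subset algebra_simps)
  qed (use a in auto)
  moreover have "{x \<in> UNIV - {0}. x * bar x = a} = {x. x * bar x = a}" using a by auto
  ultimately show ?thesis by simp
qed

lemma card_trace:
  assumes "bar a = a"
  shows "card {x. x + bar x = a} = q"
proof -
  have fib: "card {x \<in> UNIV. x + bar x = y} \<le> q" for y
    using card_power_add_eq_le[of q y] q_gt by (simp add: bar_def add.commute)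
  have img: "range (\<lambda>x. x + bar x) \<subseteq> {x. bar x = x}" by (auto simp: add.commute)
  from card_eq_fibres_bounded(2)[OF finite_class.finite_UNIV finite_class.finite img fib card_fixed_le card_q, of a]
  show ?thesis using assms by simp
qed

lemma ex_norm: "bar a = a \<Longrightarrow> \<exists>x. x * bar x = a"
proof (cases "a = 0")
  case False
  assume "bar a = a"
  then have "card {x. x * bar x = a} \<noteq> 0" using card_norm False by simp
  then show ?thesis by (metis (mono_tags, lifting) card.empty empty_Collect_eq)
qed auto

text \<open>The norm equation and the trace equation are solved for \<open>x\<close> and \<open>g\<close> jointly; \<open>x + bar x = 0\<close>
  holds exactly for the square root of \<open>d\<close>, which contributes the single solution with \<open>g = 0\<close>.\<close>

lemma card_norm_trace:
  assumes d: "bar d = d" "d \<noteq> 0" and e: "bar e = e" "e \<noteq> 0"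
  shows "card {(x, g). x * bar x = d \<and> x + bar x = g * bar g * e} = q * (q + 1) + 1"
proof -
  obtain r where r: "r\<^sup>2 = d" using ex_root[of 1 d] by auto
  have "(bar r)\<^sup>2 = r\<^sup>2" using d(1) r by (simp add: power2_eq_square flip: bar_mult)
  then have rb: "bar r = r" unfolding square_eq_iff .
  let ?N = "{x. x * bar x = d}"
  have zero: "x + bar x = 0 \<longleftrightarrow> x = r" if "x \<in> ?N" for x
  proof
    assume "x + bar x = 0"
    then have "bar x = x" unfolding add_eq_0_iff2 by simp
    then have "x\<^sup>2 = r\<^sup>2" using that r by (simp add: power2_eq_square)
    then show "x = r" unfolding square_eq_iff .
  qed (simp add: rb)
  have rN: "r \<in> ?N" using r rb by (simp add: power2_eq_square)
  have cN: "card ?N = q + 1" by (rule card_norm[OF d])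
  have fib: "card {g. x + bar x = g * bar g * e} = (if x = r then 1 else q + 1)" if "x \<in> ?N" for x
  proof (cases "x = r")
    case True
    then have "{g. x + bar x = g * bar g * e} = {0}" using e rb by auto
    then show ?thesis using True by simp
  next
    case False
    let ?t = "(x + bar x) / e"
    have "?t \<noteq> 0" "bar ?t = ?t" using False zero[OF that] e by (simp_all add: add.commute)
    moreover have "{g. x + bar x = g * bar g * e} = {g. g * bar g = ?t}"
      using e(2) by (auto simp: field_simps)
    ultimately show ?thesis using card_norm False by simp
  qed
  have "{(x, g). x * bar x = d \<and> x + bar x = g * bar g * e} =
      (SIGMA x:?N. {g. x + bar x = g * bar g * e})" by auto
  then have "card {(x, g). x * bar x = d \<and> x + bar x = g * bar g * e} =
      (\<Sum>x\<in>?N. card {g. x + bar x = g * bar g * e})" by simp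
  moreover have "(\<Sum>x\<in>?N. card {g. x + bar x = g * bar g * e}) = (\<Sum>x\<in>?N. if x = r then 1 else q + 1)"
    by (intro sum.cong refl fib)
  moreover have "(\<Sum>x\<in>?N. if x = r then 1 else q + 1) = 1 + (\<Sum>x\<in>?N - {r}. if x = r then 1 else q + 1)"
    by (subst sum.remove[OF _ rN]) auto
  moreover have "(\<Sum>x\<in>?N - {r}. if x = r then 1 else q + 1) = (\<Sum>x\<in>?N - {r}. q + 1)"
    by (intro sum.cong) auto
  moreover have "(\<Sum>x\<in>?N - {r}. q + 1) = q * (q + 1)"
    using cN card_Diff_singleton[OF rN] by simp
  ultimately show ?thesis by simp
qed

lemma card_trace_norm:
  assumes e: "bar e = e"
  shows "card {(x, g). x + bar x = g * bar g * e} = q ^ 3"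
proof -
  have "bij_betw prod.swap (SIGMA g:UNIV. {x. x + bar x = g * bar g * e})
      {(x, g). x + bar x = g * bar g * e}"
    by (rule bij_betw_imageI) (auto simp: image_iff)
  then have "card {(x, g). x + bar x = g * bar g * e} =
      card (SIGMA g:UNIV. {x. x + bar x = g * bar g * e})"
    by (rule bij_betw_same_card[symmetric])
  also have "\<dots> = (\<Sum>g\<in>UNIV. card {x. x + bar x = g * bar g * e})"
    by (rule card_SigmaI) auto
  also have "\<dots> = (\<Sum>g\<in>(UNIV::'a set). q)"
    using e by (intro sum.cong card_trace) (simp_all add: mult.commute)
  finally show ?thesis using card_q by (simp add: power3_eq_cube)
qed

text \<open>All \<open>2 \<times> 2\<close> minors of a Hermitian matrix of order 3 with square 0 vanish, so it has rank 1.\<close>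

lemma hermitian_square_zero:
  assumes d: "bar d = d" "d \<noteq> 0"
    and e11: "d * d + a * bar a + b * bar b = 0" and e22: "a * bar a + e * e + c * bar c = 0"
    and e33: "b * bar b + c * bar c + f * f = 0"
    and e12: "d * a + a * e + b * bar c = 0" and e13: "d * b + a * c + b * f = 0"
    and e23: "bar a * b + e * c + c * f = 0"
  shows "\<exists>v1 v2 v3. v1 * bar v1 = d \<and> v2 * bar v2 = e \<and> v3 * bar v3 = f \<and>
    v1 * bar v2 = a \<and> v1 * bar v3 = b \<and> v2 * bar v3 = c"
proof -
  \<comment> \<open>In characteristic 2 the square of the trace is the sum of the three diagonal
    equations, so the trace vanishes and \<open>f\<close> can be eliminated.\<close>
  have "(d + e + f)\<^sup>2 = (d * d + a * bar a + b * bar b) + (a * bar a + e * e + c * bar c) + (b * bar b + c * bar c + f * f)"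
    by (simp add: char2_simps)
  then have "d + e + f = 0" unfolding e11 e22 e33 by simp
  then have f: "f = d + e" unfolding add_eq_0_iff2 by (rule sym)
  then have e: "e = d + f" by simp
  have cd: "c * d = bar a * b" 
  proof -
    have "c * d + bar a * b = bar a * b + e * c + c * f" unfolding f by (simp add: char2_simps)
    then show ?thesis unfolding e23 add_eq_0_iff2 .
  qed
  have be: "b * e = a * c"
  proof -
    have "b * e + a * c = d * b + a * c + b * f" unfolding f by (simp add: char2_simps)
    then show ?thesis unfolding e13 add_eq_0_iff2 .
  qed
  have af: "a * f = b * bar c"
  proof -
    have "a * f + b * bar c = d * a + a * e + b * bar c" unfolding f by (simp add: char2_simps)
    then show ?thesis unfolding e12 add_eq_0_iff2 .
  qed
  have dcb: "bar c * d = a * bar b" using arg_cong[OF cd, of bar] d by simp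
  have df: "d * f = b * bar b \<and> d * e = a * bar a"
  proof (cases "a = 0")
    case True
    then have "c = 0" using cd d by simp
    have "b \<noteq> 0" using e11 True d by auto
    then have "e = 0" using be True by simp
    then show ?thesis using e11 True f by (simp add: add_eq_0_iff2)
  next
    case False
    have "a * (d * f) = b * (bar c * d)" using af by (simp add: algebra_simps)
    also have "\<dots> = a * (b * bar b)" unfolding dcb by (simp add: algebra_simps)
    finally have df: "d * f = b * bar b" using False by simp
    have "d * e + a * bar a = d * d + a * bar a + b * bar b" unfolding df[symmetric] e by (simp add: char2_simps)
    then show ?thesis using df unfolding e11 add_eq_0_iff2 by simp
  qed
  \<comment> \<open>The first coordinate is any element of norm \<open>d\<close>; the other two are
    then read off from the first row, and the vanishing minors make the remaining entries
    fit.\<close>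
  obtain m where m: "m * bar m = d" using ex_norm d by blast
  then have m0: "m \<noteq> 0" using d by auto
  have md: "bar m * m = d" using m by (simp add: mult.commute)
  show ?thesis
  proof (intro exI conjI)
    show "m * bar m = d" by (rule m)
    show "bar a / bar m * bar (bar a / bar m) = e" "bar b / bar m * bar (bar b / bar m) = f"
      using df d md by (auto simp: field_simps)
    show "m * bar (bar a / bar m) = a" "m * bar (bar b / bar m) = b" using m0 by simp_all
    show "bar a / bar m * bar (bar b / bar m) = c" using cd d md by (simp add: field_simps)
  qed
qed

end

section \<open>Hermitian transvections as the involutions of SU_3(q)\<close>

lemma vec3_eq_iff: "(v :: 'a^3) = w \<longleftrightarrow> v$1 = w$1 \<and> v$2 = w$2 \<and> v$3 = w$3"
  by (auto simp: vec_eq_iff forall_3)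

context unitary_field begin

definition SU :: "('a^3^3) set" where
  "SU = {A. A ** conj_transpose q A = mat 1 \<and> det A = 1}"

lemma SU_group_eq: "SU_group q = GL_group\<lparr>carrier := SU\<rparr>"
  by (simp add: SU_group_def SU_def)

lemma conj_transpose_nth [simp]: "conj_transpose q A $ i $ j = bar (A $ j $ i)"
  by (simp add: conj_transpose_def bar_def)

lemma bar_sum: "bar (sum h S) = (\<Sum>x\<in>S. bar (h x))"
  by (induction S rule: infinite_finite_induct) simp_all

lemma conj_transpose_mult: "conj_transpose q (A ** B) = conj_transpose q B ** conj_transpose q (A :: 'a^3^3)"
  by (simp add: vec_eq_iff matrix_matrix_mult_def bar_sum mult.commute)

lemma conj_transpose_conj_transpose: "conj_transpose q (conj_transpose q A) = (A :: 'a^3^3)"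
  by (simp add: vec_eq_iff)

lemma conj_transpose_1: "conj_transpose q (mat 1 :: 'a^3^3) = mat 1"
  by (simp add: vec_eq_iff) (simp add: mat_def)

lemma group_SU: "group (GL_group\<lparr>carrier := SU\<rparr>)"
proof (rule group_GL_carrier_update)
  show "invertible A" if "A \<in> SU" for A using that by (simp add: SU_def invertible_det_nz)
  show "mat 1 \<in> SU" by (simp add: SU_def conj_transpose_1)
  show "A ** B \<in> SU" if "A \<in> SU" "B \<in> SU" for A B
  proof -
    have "(A ** B) ** conj_transpose q (A ** B) = A ** (B ** conj_transpose q B) ** conj_transpose q A"
      by (simp only: conj_transpose_mult matrix_mul_assoc)
    then show ?thesis using that by (simp add: SU_def det_mul)
  qed
  show "B \<in> SU" if "A \<in> SU" and AB: "A ** B = mat 1" "B ** A = mat 1" for A B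
  proof -
    have A: "A ** conj_transpose q A = mat 1" "det A = 1" using that(1) by (simp_all add: SU_def)
    have "B = B ** (A ** conj_transpose q A)" using A by simp
    also have "\<dots> = conj_transpose q A" by (simp add: matrix_mul_assoc AB)
    finally have B: "B = conj_transpose q A" .
    have "B ** conj_transpose q B = mat 1" using AB B by (simp add: conj_transpose_conj_transpose)
    moreover have "det B = 1" using det_mul[of A B] AB A by simp
    ultimately show ?thesis by (simp add: SU_def)
  qed
qed

definition herm :: "'a^3 \<Rightarrow> 'a^3 \<Rightarrow> 'a" where
  "herm v w = bar (v$1) * w$1 + bar (v$2) * w$2 + bar (v$3) * w$3"

lemma herm_linear [simp]:
  "herm v (x + y) = herm v x + herm v y" "herm (x + y) v = herm x v + herm y v"
  "herm v (l *s x) = l * herm v x" "herm (l *s x) v = bar l * herm x v"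
  by (simp_all add: herm_def algebra_simps)

lemma herm_swap: "herm w v = bar (herm v w)"
  by (simp add: herm_def mult.commute)

text \<open>The identity plus the rank one matrix formed from \<open>v\<close> and its conjugate
  transpose, that is, the map adding \<open>herm v w *s v\<close> to \<open>w\<close>.\<close>

definition transv3 :: "'a^3 \<Rightarrow> 'a^3^3" where
  "transv3 v = (\<chi> i j. (if i = j then 1 else 0) + v$i * bar (v$j))"

lemma transv3_nth: "transv3 v $ i $ j = (if i = j then 1 else 0) + v$i * bar (v$j)"
  by (simp add: transv3_def)

lemma transv3_vec: "transv3 v *v w = w + herm v w *s v"
  by (simp add: vec3_eq_iff matrix_vector_mult_def sum_3 transv3_nth herm_def algebra_simps)

definition isotropic :: "('a^3) set" where
  "isotropic = {v. v \<noteq> 0 \<and> herm v v = 0}"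

lemma isotropicD: "v \<in> isotropic \<Longrightarrow> v \<noteq> 0" "v \<in> isotropic \<Longrightarrow> herm v v = 0"
  by (simp_all add: isotropic_def)

lemma add_self_vec [simp]: "(v :: 'a^3) + v = 0"
  by (simp add: vec_eq_iff two)

lemma scale_distrib: "(a + b) *s (v :: 'a^3) = a *s v + b *s v"
  by (simp add: vec_eq_iff algebra_simps)

lemma transv3_sq: "herm v v = 0 \<Longrightarrow> transv3 v ** transv3 v = mat 1"
  by (simp add: matrix_eq matrix_vector_mul_assoc[symmetric] transv3_vec add.assoc)

lemma transv3_conj_transpose: "conj_transpose q (transv3 v) = transv3 v"
  by (auto simp: vec_eq_iff transv3_nth mult.commute)

lemma sq_eq_1_det: "A ** A = mat 1 \<Longrightarrow> det (A :: 'a^3^3) = 1"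
  by (rule mult_self_eq_1) (simp only: det_mul[symmetric] det_I)

text \<open>The rank one part determines \<open>v\<close> up to a scalar of norm 1, which can be
  computed at any nonzero coordinate. This ambiguity makes the fibres of size q + 1.\<close>

lemma transv3_eq_iff: "transv3 v = transv3 w \<longleftrightarrow> (\<exists>l. l * bar l = 1 \<and> w = l *s v)"
proof
  assume eq: "transv3 v = transv3 w"
  have e: "v$i * bar (v$j) = w$i * bar (w$j)" for i j
    using arg_cong[OF eq, of "\<lambda>A. A$i$j"] by (simp add: transv3_nth)
  show "\<exists>l. l * bar l = 1 \<and> w = l *s v"
  proof (cases "v = 0")
    case True
    have "w$i = 0" for i using e[of i i] True by simp
    then have "w = 0" by (simp add: vec_eq_iff)
    then show ?thesis using True by (intro exI[of _ 1]) (simp add: vec_eq_iff)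
  next
    case False
    then obtain j where j: "v$j \<noteq> 0" by (auto simp: vec_eq_iff)
    then have wj: "w$j \<noteq> 0" using e[of j j] by auto
    let ?l = "bar (v$j) / bar (w$j)"
    have "w = ?l *s v" unfolding vec_eq_iff
    proof
      fix i show "w$i = (?l *s v)$i" using e[of i j] wj by (simp add: field_simps)
    qed
    moreover have "?l * bar ?l = 1" using e[of j j] j wj by (simp add: field_simps)
    ultimately show ?thesis by blast
  qed
next
  assume "\<exists>l. l * bar l = 1 \<and> w = l *s v"
  then obtain l where l: "l * bar l = 1" "w = l *s v" by blast
  have "w$i * bar (w$j) = (l * bar l) * (v$i * bar (v$j))" for i j by (simp add: l(2) algebra_simps)
  then show "transv3 v = transv3 w" by (simp add: vec_eq_iff transv3_nth l(1))
qed

lemma transv3_neq_1: "v \<noteq> 0 \<Longrightarrow> transv3 v \<noteq> mat 1"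
proof
  assume "v \<noteq> 0" "transv3 v = mat 1"
  moreover have "transv3 0 = mat 1" by (simp add: vec_eq_iff transv3_nth) (simp add: mat_def)
  ultimately have "transv3 0 = transv3 v" by simp
  then have "v = 0" unfolding transv3_eq_iff by (auto simp: vec_eq_iff)
  then show False using \<open>v \<noteq> 0\<close> by simp
qed

text \<open>A unitary matrix that is its own inverse is Hermitian. So N = A + 1 is Hermitian with
  square 0, has rank at most 1 and is built from a vector \<open>v\<close>; the vanishing square
  makes \<open>v\<close> isotropic.\<close>

lemma involution_transv3:
  assumes A: "A \<in> SU" "A ** A = mat 1" "A \<noteq> mat 1"
  shows "\<exists>v\<in>isotropic. A = transv3 v"
proof -
  have "A = A ** (A ** conj_transpose q A)" using A(1) by (simp add: SU_def)
  then have AH: "A = conj_transpose q A" using A(2) by (simp add: matrix_mul_assoc)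
  define N where "N i j = A$i$j + (if i = j then 1 else 0)" for i j
  have NA: "A$i$j = (if i = j then 1 else 0) + N i j" for i j by (simp add: N_def two)
  have H: "N j i = bar (N i j)" for i j
    using arg_cong[OF AH, of "\<lambda>B. B$j$i"] by (auto simp: N_def two)
  have "(\<Sum>k\<in>UNIV. N i k * N k j) = 0" for i j
  proof -
    have "(\<Sum>k\<in>UNIV. N i k * N k j) = (A ** A)$i$j + A$i$j + A$i$j + (if i = j then 1 else 0)"
      using exhaust_3[of i] exhaust_3[of j]
      by (auto simp: N_def matrix_matrix_mult_def sum_3 algebra_simps two)
    moreover have "x + a + a + x = 0" for x a :: 'a by (simp add: char2_simps)
    moreover have "(A ** A)$i$j = (if i = j then 1 else 0)" unfolding A(2) by (simp add: mat_def)
    ultimately show ?thesis by (simp only:)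
  qed
  then have sq: "N i 1 * N 1 j + N i 2 * N 2 j + N i 3 * N 3 j = 0" for i j by (simp add: sum_3)
  have sol: "\<exists>v. \<forall>i j. N i j = v$i * bar (v$j)"
    if v: "v1 * bar v1 = N 1 1" "v2 * bar v2 = N 2 2" "v3 * bar v3 = N 3 3"
      "v1 * bar v2 = N 1 2" "v1 * bar v3 = N 1 3" "v2 * bar v3 = N 2 3" for v1 v2 v3
  proof -
    let ?v = "vector [v1, v2, v3] :: 'a^3"
    have "N 2 1 = bar (v1 * bar v2)" "N 3 1 = bar (v1 * bar v3)" "N 3 2 = bar (v2 * bar v3)"
      unfolding v by (rule H)+
    then have "N 2 1 = v2 * bar v1" "N 3 1 = v3 * bar v1" "N 3 2 = v3 * bar v2"
      by (simp_all add: mult.commute)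
    then show ?thesis using v by (intro exI[of _ ?v]) (simp add: forall_3)
  qed
  have "\<exists>v. \<forall>i j. N i j = v$i * bar (v$j)"
  proof -
    have dg: "bar (N i i) = N i i" for i by (rule H[symmetric])
    have b: "bar (N 1 2) = N 2 1" "bar (N 1 3) = N 3 1" "bar (N 2 3) = N 3 2"
      "bar (N 2 1) = N 1 2" "bar (N 3 1) = N 1 3" "bar (N 3 2) = N 2 3"
      by (rule H[symmetric])+
    \<comment> \<open>The rank one lemma starts from a nonzero first diagonal entry; the second and
      third cases apply it after a permutation of the coordinates.\<close>
    consider "N 1 1 \<noteq> 0" | "N 2 2 \<noteq> 0" | "N 3 3 \<noteq> 0" | "N 1 1 = 0" "N 2 2 = 0" "N 3 3 = 0" by blast
    then show ?thesis
    proof cases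
      case 1
      have "\<exists>v1 v2 v3. v1 * bar v1 = N 1 1 \<and> v2 * bar v2 = N 2 2 \<and> v3 * bar v3 = N 3 3 \<and>
          v1 * bar v2 = N 1 2 \<and> v1 * bar v3 = N 1 3 \<and> v2 * bar v3 = N 2 3"
        by (rule hermitian_square_zero)
          (use sq[of 1 1] sq[of 2 2] sq[of 3 3] sq[of 1 2] sq[of 1 3] sq[of 2 3] dg 1 b
           in \<open>simp_all add: ac_simps\<close>)
      then show ?thesis using sol by blast
    next
      case 2
      have "\<exists>v2 v1 v3. v2 * bar v2 = N 2 2 \<and> v1 * bar v1 = N 1 1 \<and> v3 * bar v3 = N 3 3 \<and>
          v2 * bar v1 = N 2 1 \<and> v2 * bar v3 = N 2 3 \<and> v1 * bar v3 = N 1 3"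
        by (rule hermitian_square_zero)
          (use sq[of 1 1] sq[of 2 2] sq[of 3 3] sq[of 2 1] sq[of 1 3] sq[of 2 3] dg 2 b
           in \<open>simp_all add: ac_simps\<close>)
      then obtain v1 v2 v3 where v: "v2 * bar v2 = N 2 2" "v1 * bar v1 = N 1 1" "v3 * bar v3 = N 3 3"
          "v2 * bar v1 = N 2 1" "v2 * bar v3 = N 2 3" "v1 * bar v3 = N 1 3" by blast
      have "v1 * bar v2 = N 1 2" using arg_cong[OF v(4), of bar] b by (simp add: mult.commute)
      then show ?thesis using sol v by blast
    next
      case 3
      have "\<exists>v3 v2 v1. v3 * bar v3 = N 3 3 \<and> v2 * bar v2 = N 2 2 \<and> v1 * bar v1 = N 1 1 \<and>
          v3 * bar v2 = N 3 2 \<and> v3 * bar v1 = N 3 1 \<and> v2 * bar v1 = N 2 1"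
        by (rule hermitian_square_zero)
          (use sq[of 1 1] sq[of 2 2] sq[of 3 3] sq[of 2 1] sq[of 3 1] sq[of 3 2] dg 3 b
           in \<open>simp_all add: ac_simps\<close>)
      then obtain v1 v2 v3 where v: "v3 * bar v3 = N 3 3" "v2 * bar v2 = N 2 2" "v1 * bar v1 = N 1 1"
          "v3 * bar v2 = N 3 2" "v3 * bar v1 = N 3 1" "v2 * bar v1 = N 2 1" by blast
      have "v2 * bar v3 = N 2 3" "v1 * bar v3 = N 1 3" "v1 * bar v2 = N 1 2"
        using arg_cong[OF v(4), of bar] arg_cong[OF v(5), of bar] arg_cong[OF v(6), of bar] b
        by (simp_all add: mult.commute)
      then show ?thesis using sol v by blast
    next
      \<comment> \<open>With zero diagonal the three off-diagonal entries have equal norms and one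
        of them is 0, so N = 0. The vector is then 0, which is refuted afterwards by
        \<open>A \<noteq> mat 1\<close>.\<close>
      case 4
      have "N 1 3 * N 3 2 = 0" using sq[of 1 2] 4 by simp
      then have "N 1 3 = 0 \<or> N 2 3 = 0" using b(3) by auto
      moreover have "N 1 2 * bar (N 1 2) = N 1 3 * bar (N 1 3)" "N 1 2 * bar (N 1 2) = N 2 3 * bar (N 2 3)"
        using sq[of 1 1] sq[of 2 2] 4 by (simp_all add: b add_eq_0_iff2 mult.commute)
      ultimately have "N 1 2 = 0" "N 1 3 = 0" "N 2 3 = 0" by auto
      then show ?thesis using sol[of 0 0 0] 4 by simp
    qed
  qed
  then obtain v where v: "\<And>i j. N i j = v$i * bar (v$j)" by blast
  have Av: "A = transv3 v" by (simp add: vec_eq_iff transv3_nth NA v)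
  have v0: "v \<noteq> 0"
  proof
    assume "v = 0"
    then have "A = mat 1" unfolding Av by (simp add: vec_eq_iff transv3_nth) (simp add: mat_def)
    then show False using A(3) by simp
  qed
  then obtain i where i: "v$i \<noteq> 0" by (auto simp: vec_eq_iff)
  have "v$i * bar (v$i) * herm v v = 0"
    using sq[of i i] by (simp add: v herm_def algebra_simps)
  then have "herm v v = 0" using i by simp
  then show ?thesis using Av v0 by (auto simp: isotropic_def)
qed

lemma transv3_SU: "v \<in> isotropic \<Longrightarrow> transv3 v \<in> SU"
  using transv3_sq[OF isotropicD(2)] sq_eq_1_det transv3_conj_transpose by (simp add: SU_def)

lemma transv3_commute:
  assumes v: "v \<in> isotropic" and w: "w \<in> isotropic"
  shows "transv3 v ** transv3 w = transv3 w ** transv3 v \<longleftrightarrow> herm v w = 0"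
proof
  assume "transv3 v ** transv3 w = transv3 w ** transv3 v"
  \<comment> \<open>Evaluation at \<open>w\<close>, which \<open>transv3 w\<close> fixes: the two
    sides differ by \<open>(herm v w * herm w v) *s w\<close>.\<close>
  then have "transv3 v *v (transv3 w *v w) = transv3 w *v (transv3 v *v w)"
    by (simp add: matrix_vector_mul_assoc)
  then have "w + herm v w *s v = w + herm v w *s v + (herm v w * herm w v) *s w"
    using isotropicD(2)[OF w] by (simp add: transv3_vec scale_distrib vec_eq_iff algebra_simps)
  then have "(herm v w * herm w v) *s w = 0" by (metis add_cancel_right_right)
  then have "herm v w * herm w v = 0" using isotropicD(1)[OF w] by (auto simp: vec_eq_iff)
  then show "herm v w = 0" unfolding herm_swap[of w v] by simp
next
  assume c: "herm v w = 0"
  then have "herm w v = 0" by (simp add: herm_swap[of w v])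
  then show "transv3 v ** transv3 w = transv3 w ** transv3 v"
    using c by (simp add: matrix_eq matrix_vector_mul_assoc[symmetric] transv3_vec vec_eq_iff algebra_simps)
qed

text \<open>A unitary map conjugates the transvection of \<open>w\<close> to that of the image of
  \<open>w\<close>; the transvection of the isotropic \<open>v\<close> is unitary and its own
  inverse.\<close>

lemma transv3_conj:
  assumes v: "herm v v = 0"
  shows "transv3 v ** transv3 w ** transv3 v = transv3 (transv3 v *v w)"
proof -
  have "transv3 v *v (transv3 w *v (transv3 v *v x)) = transv3 (transv3 v *v w) *v x" for x
  proof -
    have a: "herm w (transv3 v *v x) = herm (transv3 v *v w) x"
      by (simp add: transv3_vec herm_swap[of w v] mult.commute)
    have b: "transv3 v *v (transv3 v *v x) = x"
      using transv3_sq[OF v] by (simp add: matrix_vector_mul_assoc)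
    show ?thesis unfolding transv3_vec[of w] a
      by (simp add: matrix_vector_right_distrib vector_scalar_commute b transv3_vec[of "transv3 v *v w"])
  qed
  then show ?thesis by (simp add: matrix_eq flip: matrix_vector_mul_assoc)
qed

text \<open>Both sides of the braid relation are transvections, of w + cv and of v + bar(c) w, where
  c is \<open>herm v w\<close>. They agree iff the vectors differ by a scalar l of norm 1. Pairing
  with the isotropic \<open>w\<close> gives lc = 1, so c has norm 1; conversely l = 1/c
  works.\<close>

lemma transv3_braid:
  assumes v: "v \<in> isotropic" and w: "w \<in> isotropic"
  shows "transv3 v \<noteq> transv3 w \<and>
      transv3 v ** transv3 w ** transv3 v = transv3 w ** transv3 v ** transv3 w \<longleftrightarrow>
    herm v w * bar (herm v w) = 1"
proof -
  let ?c = "herm v w"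
  have vv: "herm v v = 0" and ww: "herm w w = 0" using v w isotropicD by auto
  have cs: "herm w v = bar ?c" by (rule herm_swap)
  have x: "transv3 v *v w = w + ?c *s v" and y: "transv3 w *v v = v + bar ?c *s w"
    by (simp_all add: transv3_vec cs)
  have eq: "transv3 v ** transv3 w ** transv3 v = transv3 w ** transv3 v ** transv3 w \<longleftrightarrow>
      (\<exists>l. l * bar l = 1 \<and> v + bar ?c *s w = l *s (w + ?c *s v))"
    unfolding transv3_conj[OF vv] transv3_conj[OF ww] x y transv3_eq_iff ..
  show ?thesis
  proof
    assume a: "transv3 v \<noteq> transv3 w \<and>
      transv3 v ** transv3 w ** transv3 v = transv3 w ** transv3 v ** transv3 w"
    then obtain l where l: "l * bar l = 1" "v + bar ?c *s w = l *s (w + ?c *s v)" unfolding eq by blast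
    have "?c \<noteq> 0"
    proof
      assume c: "?c = 0"
      then have "v = l *s w" using l(2) by simp
      then have "transv3 w = transv3 v" unfolding transv3_eq_iff using l(1) by blast
      then show False using a by simp
    qed
    moreover have "herm w (v + bar ?c *s w) = herm w (l *s (w + ?c *s v))" using l(2) by simp
    then have "bar ?c = l * (?c * bar ?c)" by (simp add: ww cs)
    ultimately have lc: "l * ?c = 1" by simp
    have "(l * bar l) * (?c * bar ?c) = (l * ?c) * bar (l * ?c)" by (simp add: algebra_simps)
    then show "?c * bar ?c = 1" unfolding l lc by simp
  next
    assume c: "?c * bar ?c = 1"
    then have c0: "?c \<noteq> 0" by auto
    have "transv3 v \<noteq> transv3 w"
    proof
      assume "transv3 v = transv3 w"
      then obtain l where "w = l *s v" unfolding transv3_eq_iff by blast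
      then have "?c = 0" by (simp add: vv)
      then show False using c0 by simp
    qed
    moreover have "(1 / ?c) * bar (1 / ?c) = 1" using c by (simp add: field_simps)
    moreover have "bar ?c = 1 / ?c" using c c0 by (simp add: field_simps)
    then have "v + bar ?c *s w = (1 / ?c) *s (w + ?c *s v)" using c0
      by (simp add: vec_eq_iff algebra_simps)
    ultimately show "transv3 v \<noteq> transv3 w \<and>
      transv3 v ** transv3 w ** transv3 v = transv3 w ** transv3 v ** transv3 w" unfolding eq by blast
  qed
qed

definition cross :: "'a^3 \<Rightarrow> 'a^3 \<Rightarrow> 'a^3" where
  "cross v w = vector [v$2 * w$3 + v$3 * w$2, v$3 * w$1 + v$1 * w$3, v$1 * w$2 + v$2 * w$1]"

text \<open>Conjugating the coordinates of the cross product turns orthogonality for the bilinear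
  form into orthogonality for the Hermitian one.\<close>

definition cross_bar :: "'a^3 \<Rightarrow> 'a^3 \<Rightarrow> 'a^3" where
  "cross_bar v w = vector [bar (cross v w $ 1), bar (cross v w $ 2), bar (cross v w $ 3)]"

lemma herm_cross_bar:
  "herm (cross_bar v w) v = 0" "herm (cross_bar v w) w = 0"
  "herm (cross_bar v w) (cross_bar v w) = herm v v * herm w w + herm v w * bar (herm v w)"
  by (simp_all add: herm_def cross_bar_def cross_def char2_simps)

text \<open>A nondegenerate Hermitian space of dimension 3 has no totally isotropic plane.
  Concretely, the conjugates of \<open>v\<close> and \<open>w\<close> both annihilate
  \<open>v\<close> and \<open>w\<close>, so they would be parallel to the cross product of
  \<open>v\<close> and \<open>w\<close>; then their own cross product, the conjugate of that one,
  vanishes.\<close>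

lemma isotropic_proportional:
  assumes v: "v \<in> isotropic" and w: "w \<in> isotropic" and vw: "herm v w = 0"
  shows "\<exists>l. l \<noteq> 0 \<and> w = l *s v"
proof -
  have h: "herm v v = 0" "herm w w = 0" "herm v w = 0" "herm w v = 0"
    using v w vw isotropicD herm_swap[of w v] by auto
  let ?c1 = "v$2 * w$3 + v$3 * w$2" and ?c2 = "v$3 * w$1 + v$1 * w$3" and ?c3 = "v$1 * w$2 + v$2 * w$1"
  have p: "bar (x$1) * ?c3 = bar (x$3) * ?c1" "bar (x$2) * ?c3 = bar (x$3) * ?c2"
    "bar (x$1) * ?c2 = bar (x$2) * ?c1"
    if x: "herm x v = 0" "herm x w = 0" for x
  proof -
    have "bar (x$1) * ?c3 + bar (x$3) * ?c1 = w$2 * herm x v + v$2 * herm x w"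
      "bar (x$2) * ?c3 + bar (x$3) * ?c2 = w$1 * herm x v + v$1 * herm x w"
      "bar (x$1) * ?c2 + bar (x$2) * ?c1 = w$3 * herm x v + v$3 * herm x w"
      by (simp_all add: herm_def char2_simps)
    then show "bar (x$1) * ?c3 = bar (x$3) * ?c1" "bar (x$2) * ?c3 = bar (x$3) * ?c2"
      "bar (x$1) * ?c2 = bar (x$2) * ?c1" unfolding x by (simp_all add: add_eq_0_iff2)
  qed
  have cube: "x = 0" if "bar x * x * x = 0" for x using that by simp
  note pv = p[OF h(1,3)] and pw = p[OF h(4,2)]
  \<comment> \<open>The factor \<open>bar ?c3\<close> is a minor of the conjugates of
    \<open>v\<close> and \<open>w\<close>; the two extra factors \<open>?c3\<close> allow the
    parallelity equations to be used in each of its terms.\<close>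
  have "bar ?c3 * ?c3 * ?c3 = (bar (v$1) * ?c3) * (bar (w$2) * ?c3) + (bar (v$2) * ?c3) * (bar (w$1) * ?c3)"
    by (simp add: algebra_simps)
  also have "\<dots> = 0" unfolding pv(1,2) pw(1,2) by (simp add: char2_simps)
  finally have c3: "?c3 = 0" by (rule cube)
  have "bar ?c1 * ?c1 * ?c1 = (bar (v$2) * ?c1) * (bar (w$3) * ?c1) + (bar (v$3) * ?c1) * (bar (w$2) * ?c1)"
    by (simp add: algebra_simps)
  also have "\<dots> = 0" unfolding pv(1,3)[symmetric] pw(1,3)[symmetric] by (simp add: char2_simps)
  finally have c1: "?c1 = 0" by (rule cube)
  have "bar ?c2 * ?c2 * ?c2 = (bar (v$3) * ?c2) * (bar (w$1) * ?c2) + (bar (v$1) * ?c2) * (bar (w$3) * ?c2)"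
    by (simp add: algebra_simps)
  also have "\<dots> = 0" unfolding pv(2)[symmetric] pw(2)[symmetric] pv(3) pw(3) c1 c3 by simp
  finally have c2: "?c2 = 0" by (rule cube)
  have e: "v$i * w$j = v$j * w$i" for i j
    using exhaust_3[of i] exhaust_3[of j] c1 c2 c3 by (auto simp: add_eq_0_iff2 mult.commute)
  obtain i where i: "v$i \<noteq> 0" using isotropicD(1)[OF v] by (auto simp: vec_eq_iff)
  define l where "l = w$i / v$i"
  have wl: "w = l *s v" unfolding vec_eq_iff
  proof
    fix j show "w$j = (l *s v)$j" using e[of i j] i by (simp add: l_def field_simps)
  qed
  moreover have "l \<noteq> 0"
  proof
    assume "l = 0"
    then have "w = 0" using wl by (simp add: vec_eq_iff)
    then show False using isotropicD(1)[OF w] by simp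
  qed
  ultimately show ?thesis by blast
qed

end

section \<open>Counting isotropic vectors in hyperbolic coordinates\<close>

context unitary_field begin

lemma card_UNIV_minus_0: "card (UNIV - {0 :: 'a}) = (q + 1) * (q - 1)"
  by (simp add: card_Diff_subset card_q algebra_simps)

text \<open>Coordinates with respect to a hyperbolic pair \<open>v, w\<close> and the vector \<open>cross_bar v w\<close>
  orthogonal to both.\<close>

definition coord :: "'a^3 \<Rightarrow> 'a^3 \<Rightarrow> 'a \<times> 'a \<times> 'a \<Rightarrow> 'a^3" where
  "coord v w t = (case t of (a, b, g) \<Rightarrow> a *s v + b *s w + g *s cross_bar v w)"

context
  fixes v w :: "'a^3"
  assumes vv: "herm v v = 0" and ww: "herm w w = 0" and vw: "herm v w \<noteq> 0"
begin

abbreviation c where "c \<equiv> herm v w"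

lemma herm_wv: "herm w v = bar c"
  by (rule herm_swap)

lemma herm_z:
  "herm (cross_bar v w) v = 0" "herm (cross_bar v w) w = 0" "herm v (cross_bar v w) = 0"
  "herm w (cross_bar v w) = 0" "herm (cross_bar v w) (cross_bar v w) = c * bar c"
  using herm_cross_bar[of v w] herm_swap[of v "cross_bar v w"] herm_swap[of w "cross_bar v w"]
  by (simp_all add: vv)

lemma herm_coord:
  "herm v (coord v w (a, b, g)) = b * c"
  "herm w (coord v w (a, b, g)) = a * bar c"
  "herm (cross_bar v w) (coord v w (a, b, g)) = g * (c * bar c)"
  by (simp_all add: coord_def vv ww herm_z herm_wv)

lemma herm_coord_self:
  "herm (coord v w (a, b, g)) (coord v w (a, b, g)) =
    (bar a * b * c) + bar (bar a * b * c) + g * bar g * (c * bar c)"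
proof -
  let ?u = "coord v w (a, b, g)"
  have "herm ?u ?u = bar a * herm v ?u + bar b * herm w ?u + bar g * herm (cross_bar v w) ?u"
    by (subst coord_def) simp
  then show ?thesis unfolding herm_coord by (simp add: algebra_simps)
qed

lemma coord_bij: "bij (coord v w)"
proof -
  have inj: "inj (coord v w)"
  proof (rule injI)
    fix s t assume eq: "coord v w s = coord v w t"
    obtain a b g a' b' g' where st: "s = (a, b, g)" "t = (a', b', g')" by (metis surj_pair)
    have "b * c = b' * c" "a * bar c = a' * bar c" "g * (c * bar c) = g' * (c * bar c)"
      using eq herm_coord unfolding st by metis+
    then show "s = t" using vw by (simp add: st)
  qed
  have "card (range (coord v w)) = CARD('a \<times> 'a \<times> 'a)" by (rule card_image[OF inj])
  also have "\<dots> = CARD('a^3)" by (simp add: power3_eq_cube)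
  finally have "range (coord v w) = UNIV" by (intro card_subset_eq) auto
  then show ?thesis using inj by (simp add: bij_def)
qed

lemma card_coord: "card {u. P u} = card {t. P (coord v w t)}"
proof -
  have "bij_betw (coord v w) {t. P (coord v w t)} {u. P u}"
    using coord_bij by (auto simp: bij_betw_def bij_def inj_on_def surj_def image_iff)
  then show ?thesis by (rule bij_betw_same_card[symmetric])
qed

lemma coord_eq_0: "coord v w t = 0 \<longleftrightarrow> t = (0, 0, 0)"
proof -
  have "coord v w (0, 0, 0) = 0" by (simp add: coord_def vec_eq_iff)
  then show ?thesis using coord_bij by (metis bij_pointE)
qed

lemma norm_c: "bar (c * bar c) = c * bar c" "c * bar c \<noteq> 0" "bar (1 / (c * bar c)) = 1 / (c * bar c)"
  using vw by (simp_all add: mult.commute)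

text \<open>With x = bar(a) b c, isotropy becomes x + bar(x) = g bar(g) c bar(c). For b nonzero, x
  can replace the coordinate a, and the trace equation is counted; b = 0 forces g = 0 and leaves the
  multiples of \<open>v\<close>.\<close>

lemma card_isotropic_pair: "card isotropic = (q + 1) * ((q ^ 3 + 1) * (q - 1))"
proof -
  let ?e = "c * bar c"
  let ?S = "{t. coord v w t \<noteq> 0 \<and> herm (coord v w t) (coord v w t) = 0}"
  let ?T = "{(x, g). x + bar x = g * bar g * ?e}"
  let ?A = "(\<lambda>a. (a, 0, 0)) ` (UNIV - {0 :: 'a}) :: ('a \<times> 'a \<times> 'a) set"
  let ?h = "\<lambda>(b, x, g). (bar (x / (b * c)), b, g)"
  let ?B = "?h ` ((UNIV - {0}) \<times> ?T)"
  have iso: "herm (coord v w (a, b, g)) (coord v w (a, b, g)) = 0 \<longleftrightarrow>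
      bar a * b * c + bar (bar a * b * c) = g * bar g * ?e" for a b g
    unfolding herm_coord_self add_eq_0_iff2 ..
  have "?S = ?A \<union> ?B"
  proof (intro equalityI subsetI)
    fix t assume t: "t \<in> ?S"
    obtain a b g where abg: "t = (a, b, g)" by (metis surj_pair)
    have e: "bar a * b * c + bar (bar a * b * c) = g * bar g * ?e" using t iso unfolding abg by blast
    show "t \<in> ?A \<union> ?B"
    proof (cases "b = 0")
      case True
      then have "g = 0" using e norm_c(2) by simp
      then have "a \<noteq> 0" using t True coord_eq_0 unfolding abg by blast
      then show ?thesis using True \<open>g = 0\<close> abg by blast
    next
      case False
      have "t = ?h (b, bar a * b * c, g)" using False vw by (simp add: abg)
      moreover have "(b, bar a * b * c, g) \<in> (UNIV - {0}) \<times> ?T" using False e by simp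
      ultimately show ?thesis by blast
    qed
  next
    fix t assume "t \<in> ?A \<union> ?B"
    then show "t \<in> ?S"
    proof
      assume "t \<in> ?A"
      then obtain a where t: "t = (a, 0, 0)" "a \<noteq> 0" by auto
      then have "coord v w t \<noteq> 0" unfolding coord_eq_0 by simp
      moreover have "herm (coord v w t) (coord v w t) = 0" unfolding t(1) iso by simp
      ultimately show ?thesis by simp
    next
      assume "t \<in> ?B"
      then obtain b x g where t: "t = (bar (x / (b * c)), b, g)" "b \<noteq> 0" "x + bar x = g * bar g * ?e"
        by auto
      have "bar (bar (x / (b * c))) * b * c = x" using t(2) vw by simp
      then have "herm (coord v w t) (coord v w t) = 0" unfolding t(1) iso using t(3) by simp
      moreover have "coord v w t \<noteq> 0" unfolding coord_eq_0 t(1) using t(2) by simp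
      ultimately show ?thesis by simp
    qed
  qed
  moreover have "?A \<inter> ?B = {}" by auto
  moreover have "finite ?A" "finite ?B" by simp_all
  ultimately have S: "card ?S = card ?A + card ?B" by (simp only: card_Un_disjoint)
  have "inj_on (\<lambda>a. (a, 0, 0)) (UNIV - {0 :: 'a})" by (simp add: inj_on_def)
  then have A: "card ?A = (q + 1) * (q - 1)" using card_image card_UNIV_minus_0 by fastforce
  have "inj_on ?h ((UNIV - {0}) \<times> ?T)" using vw by (auto simp: inj_on_def)
  then have "card ?B = card ((UNIV - {0 :: 'a}) \<times> ?T)" by (rule card_image)
  also have "\<dots> = (q + 1) * (q - 1) * q ^ 3"
    using card_trace_norm[OF norm_c(1)] card_UNIV_minus_0 by (simp only: card_cartesian_product)
  finally have B: "card ?B = (q + 1) * (q - 1) * q ^ 3" .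
  have "card isotropic = card ?S" unfolding isotropic_def by (rule card_coord)
  then show ?thesis unfolding S A B by (simp add: algebra_simps)
qed

text \<open>The two norm conditions prescribe the norms of a and b, and then x = bar(a) b c has the
  same norm d. So b ranges over the q + 1 elements of norm d, and independently (x, g) over the
  solutions counted by \<open>card_norm_trace\<close>.\<close>

lemma card_common_pair:
  "card {u \<in> isotropic. herm v u * bar (herm v u) = 1 \<and> herm w u * bar (herm w u) = 1} =
    (q + 1) * (q\<^sup>2 + q + 1)"
proof -
  let ?e = "c * bar c"
  let ?d = "1 / ?e"
  let ?P = "\<lambda>u. u \<in> isotropic \<and> herm v u * bar (herm v u) = 1 \<and> herm w u * bar (herm w u) = 1"
  let ?T = "{(x, g). x * bar x = ?d \<and> x + bar x = g * bar g * ?e}"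
  let ?N = "{b. b * bar b = ?d}"
  let ?h = "\<lambda>(b, x, g). (bar (x / (b * c)), b, g)"
  have P: "?P (coord v w (a, b, g)) \<longleftrightarrow> b * bar b = ?d \<and> a * bar a = ?d \<and>
      bar a * b * c + bar (bar a * b * c) = g * bar g * ?e" for a b g
  proof -
    have "b * c * bar (b * c) = 1 \<longleftrightarrow> b * bar b = ?d" "a * bar c * bar (a * bar c) = 1 \<longleftrightarrow> a * bar a = ?d"
      using vw by (auto simp: field_simps)
    moreover have "coord v w (a, b, g) \<noteq> 0" if "b * bar b = ?d"
      using that norm_c(2) coord_eq_0 by auto
    ultimately show ?thesis unfolding isotropic_def herm_coord mem_Collect_eq herm_coord_self add_eq_0_iff2
      by blast
  qed
  have "{t. ?P (coord v w t)} = ?h ` (?N \<times> ?T)"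
  proof (intro equalityI subsetI)
    fix t assume t: "t \<in> {t. ?P (coord v w t)}"
    obtain a b g where abg: "t = (a, b, g)" by (metis surj_pair)
    have e: "b * bar b = ?d" "a * bar a = ?d"
      "bar a * b * c + bar (bar a * b * c) = g * bar g * ?e"
      using t P[of a b g] unfolding abg mem_Collect_eq by blast+
    have "b \<noteq> 0" using e(1) norm_c(2) by auto
    then have "t = ?h (b, bar a * b * c, g)" using vw by (simp add: abg)
    moreover have "(bar a * b * c) * bar (bar a * b * c) = (a * bar a) * (b * bar b) * ?e"
      by (simp add: algebra_simps)
    then have "(bar a * b * c) * bar (bar a * b * c) = ?d" unfolding e(1,2) using norm_c(2) by simp
    then have "(b, bar a * b * c, g) \<in> ?N \<times> ?T" using e by simp
    ultimately show "t \<in> ?h ` (?N \<times> ?T)" by blast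
  next
    fix t assume "t \<in> ?h ` (?N \<times> ?T)"
    then obtain b x g where t: "t = (bar (x / (b * c)), b, g)" "b * bar b = ?d"
      "x * bar x = ?d" "x + bar x = g * bar g * ?e" by auto
    let ?a = "bar (x / (b * c))"
    have b0: "b \<noteq> 0" using t(2) norm_c(2) by auto
    have x: "bar ?a * b * c = x" using b0 vw by simp
    have "?a * bar ?a = (x * bar x) / ((b * bar b) * ?e)" by (simp add: field_simps)
    also have "\<dots> = ?d" unfolding t(2,3) using norm_c(2) by simp
    finally have "?P (coord v w t)" unfolding t(1) P x using t(2,4) by blast
    then show "t \<in> {t. ?P (coord v w t)}" by blast
  qed
  moreover have "inj_on ?h (?N \<times> ?T)"
  proof (rule inj_onI)
    fix s t assume "s \<in> ?N \<times> ?T" "t \<in> ?N \<times> ?T" and eq: "?h s = ?h t"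
    moreover obtain b x g b' x' g' where st: "s = (b, x, g)" "t = (b', x', g')" by (metis surj_pair)
    ultimately have "b * bar b = ?d" by simp
    then have "b \<noteq> 0" using norm_c(2) by auto
    then show "s = t" using eq vw by (auto simp: st)
  qed
  ultimately have "card {t. ?P (coord v w t)} = card (?N \<times> ?T)" by (simp only: card_image)
  moreover have "card ?N = q + 1" by (rule card_norm[OF norm_c(3)]) (use norm_c(2) in simp)
  moreover have "card ?T = q * (q + 1) + 1"
    by (rule card_norm_trace[OF norm_c(3) _ norm_c(1,2)]) (use norm_c(2) in simp)
  ultimately have "card {t. ?P (coord v w t)} = (q + 1) * (q * (q + 1) + 1)"
    by (simp only: card_cartesian_product)
  then have "card {u. ?P u} = (q + 1) * (q * (q + 1) + 1)" unfolding card_coord[of ?P] .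
  then show ?thesis by (simp add: power2_eq_square)
qed

end

lemma card_isotropic: "card isotropic = (q + 1) * ((q ^ 3 + 1) * (q - 1))"
  \<comment> \<open>Both vectors are isotropic because 1 + 1 = 0, and their Hermitian product is
    1.\<close>
  by (rule card_isotropic_pair[of "vector [1, 1, 0]" "vector [0, 1, 1]"])
    (simp_all add: herm_def)

lemma card_multiples:
  assumes "(v :: 'a^3) \<noteq> 0" shows "card {l *s v | l. P l} = card {l. P l}"
proof -
  have "inj_on (\<lambda>l. l *s v) {l. P l}"
  proof (rule inj_onI)
    fix l k :: 'a assume "l *s v = k *s v"
    then show "l = k" using assms by simp
  qed
  moreover have "{l *s v | l. P l} = (\<lambda>l. l *s v) ` {l. P l}" by blast
  ultimately show ?thesis by (simp add: card_image)
qed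

lemma isotropic_scale: "\<lbrakk>v \<in> isotropic; l \<noteq> 0\<rbrakk> \<Longrightarrow> l *s v \<in> isotropic"
  by (auto simp: isotropic_def vec_eq_iff)

text \<open>Taking the norm removes the dependence on scalars of norm 1, by which vectors of the
  same transvection differ.\<close>

definition form3 :: "'a^3 \<Rightarrow> 'a^3 \<Rightarrow> 'a" where
  "form3 v w = herm v w * bar (herm v w)"

lemma form3_eq_0: "form3 v w = 0 \<longleftrightarrow> herm v w = 0"
  by (simp add: form3_def)

theorem fusion_group_SU3: "fusion_group (GL_group\<lparr>carrier := SU\<rparr>) 3 n (q ^ 3) (q\<^sup>2 + q + 1)"
proof -
  let ?K = "GL_group\<lparr>carrier := SU\<rparr>"
  interpret group ?K by (rule group_SU)
  have inv: "transv3 ` isotropic = involutions ?K"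
  proof (intro equalityI subsetI)
    fix A assume "A \<in> transv3 ` isotropic"
    then show "A \<in> involutions ?K" unfolding involutions_iff
      using transv3_SU transv3_sq isotropicD transv3_neq_1 by auto
  next
    fix A assume "A \<in> involutions ?K"
    then have "A \<in> SU" "A ** A = mat 1" "A \<noteq> mat 1" unfolding involutions_iff by auto
    then show "A \<in> transv3 ` isotropic" using involution_transv3[of A] by blast
  qed
  have mem: "transv3 v \<in> involutions ?K" if "v \<in> isotropic" for v using inv that by blast
  show ?thesis
  proof (rule fusion_group_modelI[where V = isotropic and x = transv3 and f = "q + 1" and \<beta> = form3])
    show "card {w \<in> isotropic. transv3 w = transv3 v} = q + 1" if v: "v \<in> isotropic" for v
    proof -
      have "{w \<in> isotropic. transv3 w = transv3 v} = {l *s v | l. l * bar l = 1}"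
      proof (intro equalityI subsetI)
        fix w assume "w \<in> {w \<in> isotropic. transv3 w = transv3 v}"
        then have "transv3 v = transv3 w" by simp
        then show "w \<in> {l *s v | l. l * bar l = 1}" unfolding transv3_eq_iff by blast
      next
        fix w assume "w \<in> {l *s v | l. l * bar l = 1}"
        then obtain l where l: "l * bar l = 1" "w = l *s v" by blast
        then have "transv3 v = transv3 w" unfolding transv3_eq_iff by blast
        moreover have "l \<noteq> 0" using l(1) by auto
        ultimately show "w \<in> {w \<in> isotropic. transv3 w = transv3 v}"
          using isotropic_scale[OF v] l(2) by simp
      qed
      then show ?thesis using card_multiples[OF isotropicD(1)[OF v]] card_norm[of 1] by simp
    qed
    show "transv3 v \<otimes>\<^bsub>?K\<^esub> transv3 w = transv3 w \<otimes>\<^bsub>?K\<^esub> transv3 v \<longleftrightarrow> form3 v w = 0"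
      if "v \<in> isotropic" "w \<in> isotropic" for v w
      unfolding form3_eq_0 using transv3_commute[OF that] by simp
    show "ord (transv3 v \<otimes>\<^bsub>?K\<^esub> transv3 w) = 3 \<longleftrightarrow> form3 v w = 1"
      if "v \<in> isotropic" "w \<in> isotropic" for v w
      unfolding ord_three_iff[OF mem[OF that(1)] mem[OF that(2)]] form3_def
      using transv3_braid[OF that] by simp
    show "form3 u w = 0" if uvw: "u \<in> isotropic" "v \<in> isotropic" "w \<in> isotropic" "form3 u v = 0" "form3 v w = 0" for u v w
    proof -
      obtain l where "v = l *s u" using isotropic_proportional[OF uvw(1,2)] uvw(4) form3_eq_0 by blast
      moreover obtain k where "w = k *s v" using isotropic_proportional[OF uvw(2,3)] uvw(5) form3_eq_0 by blast
      ultimately show ?thesis using isotropicD(2)[OF uvw(1)] by (simp add: form3_eq_0)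
    qed
    show "card isotropic = (q + 1) * ((q ^ 3 + 1) * (2 ^ n - 1))" by (rule card_isotropic)
    show "card {w \<in> isotropic. form3 v w = 0} = (q + 1) * (2 ^ n - 1)" if v: "v \<in> isotropic" for v
    proof -
      have "{w \<in> isotropic. form3 v w = 0} = {l *s v | l. l \<noteq> 0}"
        using isotropic_proportional[OF v] isotropic_scale[OF v] isotropicD(2)[OF v]
        by (auto simp: form3_eq_0)
      then have "card {w \<in> isotropic. form3 v w = 0} = card {l :: 'a. l \<noteq> 0}"
        using card_multiples[OF isotropicD(1)[OF v], of "\<lambda>l. l \<noteq> 0"] by simp
      moreover have "{l :: 'a. l \<noteq> 0} = UNIV - {0}" by auto
      ultimately show ?thesis using card_UNIV_minus_0 by simp
    qed
    show "\<exists>u\<in>isotropic. form3 w u = 0 \<and> form3 v u = 1"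
      if "v \<in> isotropic" "w \<in> isotropic" "form3 v w \<noteq> 0" for v w
    proof
      let ?u = "(1 / herm v w) *s w"
      have nz: "herm v w \<noteq> 0" using that(3) form3_eq_0 by blast
      then show "?u \<in> isotropic" by (intro isotropic_scale that(2)) simp
      show "form3 w ?u = 0 \<and> form3 v ?u = 1" using nz isotropicD(2)[OF that(2)] by (simp add: form3_def)
    qed
    show "transv3 v = transv3 w" if uvw: "u \<in> isotropic" "v \<in> isotropic" "w \<in> isotropic"
      "form3 v w = 0" "form3 u v = 1" "form3 u w = 1" for u v w
    proof -
      obtain l where l: "w = l *s v" using isotropic_proportional[OF uvw(2,3)] uvw(4) form3_eq_0 by blast
      have "form3 u w = (l * bar l) * form3 u v" by (simp add: l form3_def algebra_simps)
      then have "l * bar l = 1" using uvw(5,6) by simp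
      then show ?thesis unfolding transv3_eq_iff using l by blast
    qed
    show "card {u \<in> isotropic. form3 v u = 1 \<and> form3 w u = 1} = (q + 1) * (q\<^sup>2 + q + 1)"
      if "v \<in> isotropic" "w \<in> isotropic" "form3 v w \<noteq> 0" for v w
      unfolding form3_def
      by (rule card_common_pair) (use that isotropicD form3_eq_0 in auto)
  qed (use n_ge n_pos inv in simp_all)
qed

theorem fusion_group_PSU3: "fusion_group (PSU3 q :: ('a^3^3) set monoid) 3 n (q ^ 3) (q\<^sup>2 + q + 1)"
  unfolding PSU3_def SU_group_eq
  by (rule fusion_group_projective[OF fusion_group_SU3 mult_self_eq_1])

end

section \<open>Parameters for the three families of groups\<close>

theorem theorem2p1:
  fixes q n :: nat
  assumes "q = 2 ^ n" and "q \<ge> 4"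
  shows
    "(CARD('a::{field,finite}) = q \<longrightarrow>
       (let G = (PSL2 :: ('a^2^2) set monoid); \<pi> = odd_orders_except G 3 in
        \<forall>C. involution_class G C \<longrightarrow>
          (let F = local_fusion_graph G \<pi> C in
            vertex_transitive F \<and> edge_regular F \<and> graph_diameter F = 2 \<and>
            deza_graph F (q^2 - 1) (q * (q - 2)) (q * (q - 3)) ((q - 2)^2) \<and>
            divisible_design_graph F \<and> canonical_partition F (sylow2_involution_sets G) \<and>
            (q * (q - 3) \<noteq> (q - 2)^2 \<longrightarrow>
              (\<forall>P. canonical_partition F P \<longrightarrow> P = sylow2_involution_sets G)))))
     \<and>
     (\<forall>m. CARD('a) = q \<and> n \<ge> 3 \<and> n = 2 * m + 1 \<longrightarrow>
       (let G = (Suzuki_group m :: ('a^4^4) monoid); \<pi> = odd_orders_except G 5 in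
        \<forall>C. involution_class G C \<longrightarrow>
          (let F = local_fusion_graph G \<pi> C in
            vertex_transitive F \<and> edge_regular F \<and> graph_diameter F = 2 \<and>
            deza_graph F ((q^2 + 1) * (q - 1)) (q^2 * (q - 2))
              ((q - 2)^2 * (q + 1)) (q^2 * (q - 3)) \<and>
            divisible_design_graph F \<and> canonical_partition F (sylow2_involution_sets G) \<and>
            (\<forall>P. canonical_partition F P \<longrightarrow> P = sylow2_involution_sets G))))
     \<and>
     (CARD('b::{field,finite}) = q^2 \<longrightarrow>
       (let G = (PSU3 q :: ('b^3^3) set monoid); \<pi> = odd_orders_except G 3 in
        \<forall>C. involution_class G C \<longrightarrow>
          (let F = local_fusion_graph G \<pi> C in
            vertex_transitive F \<and> edge_regular F \<and> graph_diameter F = 2 \<and>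
            deza_graph F ((q^3 + 1) * (q - 1)) (q^3 * (q - 2))
              ((q - 2)^2 * (q^2 + q + 1)) (q^3 * (q - 3)) \<and>
            divisible_design_graph F \<and> canonical_partition F (sylow2_involution_sets G) \<and>
            (\<forall>P. canonical_partition F P \<longrightarrow> P = sylow2_involution_sets G))))"
proof -
  have "(2::nat) ^ 2 \<le> 2 ^ n" using assms(2) unfolding assms(1) by simp
  then have n2: "2 \<le> n" by (rule power_le_imp_le_exp[rotated]) simp
  obtain t where t: "(2::nat) ^ n = t + 4"
    using le_Suc_ex[OF assms(2)] unfolding assms(1) by (auto simp: add.commute)
  note q = assms(1)
  show ?thesis
  proof (intro conjI impI allI, goal_cases)
    case 1
    interpret char2_field "TYPE('a)" n using 1 assms(1) by unfold_locales simp
    interpret G: fusion_group "PSL2 :: ('a^2^2) set monoid" 3 n "2 ^ n" 1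
      by (rule fusion_group_PSL2[OF n2])
    have v: "q\<^sup>2 - 1 = (2 ^ n + 1) * (2 ^ n - 1)" and d: "q * (q - 2) = 2 ^ n * (2 ^ n - 2)"
      and ab: "2 ^ n * (2 ^ n - 3) = q * (q - 3) \<and> (2 ^ n - 1) * (2 ^ n - 3) + 1 = (q - 2)\<^sup>2"
      and le: "(q - 2)\<^sup>2 \<le> q * (q - 3)"
      unfolding q t by (simp_all add: power2_eq_square algebra_simps)
    \<comment> \<open>For PSL_2 the count inside a class is the larger one, hence the second
      alternative. The two counts agree at q = 4, so uniqueness of the partition stays conditional
      here.\<close>
    show ?case unfolding Let_def
      using G.fusion_graph_properties[OF _ v d disjI2[OF ab] le] by (metis (no_types, lifting))
  next
    case (2 m)
    interpret suzuki_field "TYPE('a)" n m using 2 assms(1) by unfold_locales auto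
    interpret G: fusion_group "Suzuki_group m :: ('a^4^4) monoid" 5 n "(2 ^ n)\<^sup>2" "2 ^ n + 1"
      by (rule fusion_group_Suzuki)
    have v: "(q\<^sup>2 + 1) * (q - 1) = ((2 ^ n)\<^sup>2 + 1) * (2 ^ n - 1)" and d: "q\<^sup>2 * (q - 2) = (2 ^ n)\<^sup>2 * (2 ^ n - 2)"
      and ab: "(2 ^ n)\<^sup>2 * (2 ^ n - 3) = q\<^sup>2 * (q - 3) \<and>
        ((2 ^ n)\<^sup>2 - 1) * (2 ^ n - 3) + (2 ^ n + 1) = (q - 2)\<^sup>2 * (q + 1)"
      and le: "q\<^sup>2 * (q - 3) \<le> (q - 2)\<^sup>2 * (q + 1)" and ne: "q\<^sup>2 * (q - 3) \<noteq> (q - 2)\<^sup>2 * (q + 1)"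
      unfolding q t by (simp_all add: power2_eq_square algebra_simps)
    show ?case unfolding Let_def
      using G.fusion_graph_properties[OF _ v d disjI1[OF ab] le] ne by (metis (no_types, lifting))
  next
    case 3
    interpret unitary_field "TYPE('b)" n using 3 assms(1) n2
      by unfold_locales (simp_all add: power_mult[symmetric] mult.commute)
    interpret G: fusion_group "PSU3 q :: ('b^3^3) set monoid" 3 n "q ^ 3" "q\<^sup>2 + q + 1"
      using fusion_group_PSU3 assms(1) by simp
    have v: "(q ^ 3 + 1) * (q - 1) = (q ^ 3 + 1) * (2 ^ n - 1)" and d: "q ^ 3 * (q - 2) = q ^ 3 * (2 ^ n - 2)"
      and ab: "q ^ 3 * (2 ^ n - 3) = q ^ 3 * (q - 3) \<and>
        (q ^ 3 - 1) * (2 ^ n - 3) + (q\<^sup>2 + q + 1) = (q - 2)\<^sup>2 * (q\<^sup>2 + q + 1)"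
      and le: "q ^ 3 * (q - 3) \<le> (q - 2)\<^sup>2 * (q\<^sup>2 + q + 1)"
      and ne: "q ^ 3 * (q - 3) \<noteq> (q - 2)\<^sup>2 * (q\<^sup>2 + q + 1)"
      unfolding q t by (simp_all add: power2_eq_square power3_eq_cube algebra_simps)
    show ?case unfolding Let_def
      using G.fusion_graph_properties[OF _ v d disjI1[OF ab] le] ne by (metis (no_types, lifting))
  qed
qed


end
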